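(* The query $\mathrm{MatrixRank}$ is in $\mathsf{DynFO}(+,\times)$.
   Context: Dynamic complexity setting. An input is a relational structure (database) over a finite domain $\mathrm{dom}$ fixed for the whole computation. A change operation inserts or deletes a single tuple of one (changeable) input relation. A dynamic program maintains auxiliary relations over $\mathrm{dom}$; for every auxiliary relation $R$ and every change type $\delta$ it has a first-order update formula $\varphi^R_\delta(\vec x;\vec y)$, and after a change $\delta(\vec a)$ the new $R$ is the set of $\vec b$ with $\text{current state}\models\varphi^R_\delta(\vec a;\vec b)$. The program maintains a query $q$ if a designated auxiliary relation always equals $q$ of the current input after every change sequence starting from the initial input. $\mathsf{DynFO}(+,\times)$: the program additionally has three auxiliary relations initialized as a linear order on $\mathrm{dom}$ and the corresponding ternary addition and multiplication relations; all other auxiliary relations are initially empty. Representation of $\mathrm{MatrixRank}$: the domain is $\{1,\dots,n\}$ via a linear order $<$ (the $k$-th element is identified with the number $k$), and this order is required to be identical to the linear order provided to the $\mathsf{DynFO}(+,\times)$ program; $<$ is never changed. There are two ternary relations $M_+,M_-$ encoding an $n\times n$ integer matrix $A$ with entries in $\{-n,\dots,n\}$: $(i,j,a)\in M_+$ means $a_{ij}=a>0$, $(i,j,a)\in M_-$ means $a_{ij}=-a<0$, for each $(i,j)$ at most one triple $(i,j,\cdot)$ lies in $M_+\cup M_-$, and absence of such a triple means $a_{ij}=0$. Initially $M_+,M_-$ are empty. Changes insert a triple $(i,j,a)$ into $M_+$ or $M_-$ (only if no triple $(i,j,b)$ is present) or delete a triple. The query $\mathrm{MatrixRank}$ returns $\{\mathrm{rank}(A)\}$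 (rank over $\mathbb{Q}$) if $\mathrm{rank}(A)>0$, and $\emptyset$ otherwise. *)

theory Defs
  imports "Jordan_Normal_Form.DL_Rank"
begin

section \<open>First-order logic over relational structures\<close>

text \<open>Tuples are lists and a relation is a set of tuples. An interpretation assigns a relation
  to every relation symbol; the domain is a separate set.\<close>

type_synonym ('r, 'a) interp = "'r \<Rightarrow> 'a list set"

definition tuples :: "'a set \<Rightarrow> nat \<Rightarrow> 'a list set" where
  "tuples D k = {xs. length xs = k \<and> set xs \<subseteq> D}"

datatype 'r fm =
    Equal nat nat
  | Atom 'r "nat list"
  | Neg "'r fm"
  | Conj "'r fm" "'r fm"
  | Disj "'r fm" "'r fm"
  | Exists nat "'r fm"
  | Forall nat "'r fm"

primrec sat :: "'a set \<Rightarrow> ('r, 'a) interp \<Rightarrow> (nat \<Rightarrow> 'a) \<Rightarrow> 'r fm \<Rightarrow> bool" where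
  "sat D I v (Equal x y) \<longleftrightarrow> v x = v y"
| "sat D I v (Atom R xs) \<longleftrightarrow> map v xs \<in> I R"
| "sat D I v (Neg \<phi>) \<longleftrightarrow> \<not> sat D I v \<phi>"
| "sat D I v (Conj \<phi> \<psi>) \<longleftrightarrow> sat D I v \<phi> \<and> sat D I v \<psi>"
| "sat D I v (Disj \<phi> \<psi>) \<longleftrightarrow> sat D I v \<phi> \<or> sat D I v \<psi>"
| "sat D I v (Exists x \<phi>) \<longleftrightarrow> (\<exists>d\<in>D. sat D I (v(x := d)) \<phi>)"
| "sat D I v (Forall x \<phi>) \<longleftrightarrow> (\<forall>d\<in>D. sat D I (v(x := d)) \<phi>)"

primrec free_vars :: "'r fm \<Rightarrow> nat set" where
  "free_vars (Equal x y) = {x, y}"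
| "free_vars (Atom R xs) = set xs"
| "free_vars (Neg \<phi>) = free_vars \<phi>"
| "free_vars (Conj \<phi> \<psi>) = free_vars \<phi> \<union> free_vars \<psi>"
| "free_vars (Disj \<phi> \<psi>) = free_vars \<phi> \<union> free_vars \<psi>"
| "free_vars (Exists x \<phi>) = free_vars \<phi> - {x}"
| "free_vars (Forall x \<phi>) = free_vars \<phi> - {x}"

text \<open>Every atom uses a symbol of the vocabulary \<open>V\<close> with the right number of arguments.\<close>

primrec over_vocab :: "'r set \<Rightarrow> ('r \<Rightarrow> nat) \<Rightarrow> 'r fm \<Rightarrow> bool" where
  "over_vocab V ar (Equal x y) \<longleftrightarrow> True"
| "over_vocab V ar (Atom R xs) \<longleftrightarrow> R \<in> V \<and> length xs = ar R"
| "over_vocab V ar (Neg \<phi>) \<longleftrightarrow> over_vocab V ar \<phi>"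
| "over_vocab V ar (Conj \<phi> \<psi>) \<longleftrightarrow> over_vocab V ar \<phi> \<and> over_vocab V ar \<psi>"
| "over_vocab V ar (Disj \<phi> \<psi>) \<longleftrightarrow> over_vocab V ar \<phi> \<and> over_vocab V ar \<psi>"
| "over_vocab V ar (Exists x \<phi>) \<longleftrightarrow> over_vocab V ar \<phi>"
| "over_vocab V ar (Forall x \<phi>) \<longleftrightarrow> over_vocab V ar \<phi>"

section \<open>Linear orders and arithmetic on the domain\<close>

definition strict_order_of :: "'a set \<Rightarrow> ('a \<times> 'a) set \<Rightarrow> bool" where
  "strict_order_of D L \<longleftrightarrow> L \<subseteq> D \<times> D \<and> strict_linear_order_on D L"

text \<open>The \<open>k\<close>-th element of the domain is identified with the number \<open>k\<close>, starting with 1.\<close>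

definition pos :: "('a \<times> 'a) set \<Rightarrow> 'a \<Rightarrow> nat" where
  "pos L x = card {y. (y, x) \<in> L} + 1"

definition elem_at :: "'a set \<Rightarrow> ('a \<times> 'a) set \<Rightarrow> nat \<Rightarrow> 'a" where
  "elem_at D L = the_inv_into D (pos L)"

section \<open>Dynamic problems and dynamic programs\<close>

datatype 'i change_type = Insert 'i | Delete 'i

primrec changed_sym :: "'i change_type \<Rightarrow> 'i" where
  "changed_sym (Insert R) = R"
| "changed_sym (Delete R) = R"

primrec apply_change :: "'i change_type \<Rightarrow> 'a list \<Rightarrow> ('i, 'a) interp \<Rightarrow> ('i, 'a) interp" where
  "apply_change (Insert R) a I = I(R := insert a (I R))"
| "apply_change (Delete R) a I = I(R := I R - {a})"

text \<open>A query with its input vocabulary \<open>'i\<close>, its changeable relations and the changes that are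
  allowed in a given input. The initial input takes the linear order provided to the dynamic
  program as an argument, since a problem may require its input to contain that same order.\<close>

record ('i, 'a) dyn_problem =
  in_arity :: "'i \<Rightarrow> nat"
  changeable :: "'i set"
  initial :: "'a set \<Rightarrow> ('a \<times> 'a) set \<Rightarrow> ('i, 'a) interp"
  allowed :: "('i, 'a) interp \<Rightarrow> 'i change_type \<Rightarrow> 'a list \<Rightarrow> bool"
  query_arity :: nat
  query :: "'a set \<Rightarrow> ('i, 'a) interp \<Rightarrow> 'a list set"

text \<open>A program has the three arithmetical auxiliary relations and finitely many further ones,
  \<open>Aux k\<close> for \<open>k < length (aux_arities P)\<close>. All of them, the arithmetical ones included, have
  update formulas. Formulas speak about input symbols (\<open>Inl\<close>) and auxiliary symbols (\<open>Inr\<close>).\<close>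

datatype aux_sym = Order | Plus | Times | Aux nat

record 'i dyn_program =
  aux_arities :: "nat list"
  update :: "'i change_type \<Rightarrow> aux_sym \<Rightarrow> ('i + aux_sym) fm"
  answer :: aux_sym

definition aux_syms :: "'i dyn_program \<Rightarrow> aux_sym set" where
  "aux_syms P = {Order, Plus, Times} \<union> Aux ` {..<length (aux_arities P)}"

primrec aux_arity :: "'i dyn_program \<Rightarrow> aux_sym \<Rightarrow> nat" where
  "aux_arity P Order = 2"
| "aux_arity P Plus = 3"
| "aux_arity P Times = 3"
| "aux_arity P (Aux k) = aux_arities P ! k"

text \<open>In an update formula \<open>\<phi>(x; y)\<close> the variables \<open>0, \<dots>, m - 1\<close> are the \<open>x\<close>, standing for the
  changed tuple, and \<open>m, \<dots>, m + k - 1\<close> are the \<open>y\<close>, standing for the tuple of the auxiliary relation.\<close>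

definition wf_program :: "('i, 'a) dyn_problem \<Rightarrow> 'i dyn_program \<Rightarrow> bool" where
  "wf_program Q P \<longleftrightarrow>
     answer P \<in> aux_syms P \<and> aux_arity P (answer P) = query_arity Q \<and>
     (\<forall>\<delta> S. changed_sym \<delta> \<in> changeable Q \<longrightarrow> S \<in> aux_syms P \<longrightarrow>
        free_vars (update P \<delta> S) \<subseteq> {..<in_arity Q (changed_sym \<delta>) + aux_arity P S} \<and>
        over_vocab (UNIV <+> aux_syms P) (case_sum (in_arity Q) (aux_arity P)) (update P \<delta> S))"

primrec initial_aux :: "'a set \<Rightarrow> ('a \<times> 'a) set \<Rightarrow> (aux_sym, 'a) interp" where
  "initial_aux D L Order = {[x, y] | x y. (x, y) \<in> L}"
| "initial_aux D L Plus = {[x, y, z] | x y z. {x, y, z} \<subseteq> D \<and> pos L x + pos L y = pos L z}"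
| "initial_aux D L Times = {[x, y, z] | x y z. {x, y, z} \<subseteq> D \<and> pos L x * pos L y = pos L z}"
| "initial_aux D L (Aux k) = {}"

text \<open>Update formulas are evaluated in the state (input and auxiliary relations) before the change.\<close>

definition update_aux ::
  "'i dyn_program \<Rightarrow> 'a set \<Rightarrow> 'i change_type \<Rightarrow> 'a list \<Rightarrow> ('i, 'a) interp \<Rightarrow> (aux_sym, 'a) interp
     \<Rightarrow> (aux_sym, 'a) interp" where
  "update_aux P D \<delta> a I A S =
     (if S \<in> aux_syms P
      then {b \<in> tuples D (aux_arity P S). sat D (case_sum I A) (\<lambda>i. (a @ b) ! i) (update P \<delta> S)}
      else {})"

inductive reachable ::
  "('i, 'a) dyn_problem \<Rightarrow> 'i dyn_program \<Rightarrow> 'a set \<Rightarrow> ('a \<times> 'a) set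
     \<Rightarrow> ('i, 'a) interp \<Rightarrow> (aux_sym, 'a) interp \<Rightarrow> bool"
  for Q P D L where
  start: "reachable Q P D L (initial Q D L) (initial_aux D L)"
| change: "reachable Q P D L I A \<Longrightarrow> changed_sym \<delta> \<in> changeable Q \<Longrightarrow>
    a \<in> tuples D (in_arity Q (changed_sym \<delta>)) \<Longrightarrow> allowed Q I \<delta> a \<Longrightarrow>
    reachable Q P D L (apply_change \<delta> a I) (update_aux P D \<delta> a I A)"

definition maintains :: "'i dyn_program \<Rightarrow> ('i, 'a) dyn_problem \<Rightarrow> bool" where
  "maintains P Q \<longleftrightarrow>
     (\<forall>D L I A. finite D \<longrightarrow> strict_order_of D L \<longrightarrow> reachable Q P D L I A \<longrightarrow>
        A (answer P) = query Q D I)"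

text \<open>Domains are the finite subsets of the type \<open>'a\<close>, and a single program has to work for all
  of them. When \<open>'a\<close> is infinite (e.g. \<open>nat\<close>), these are all finite domains up to isomorphism.\<close>

definition DynFO_arith :: "('i, 'a) dyn_problem set" where
  "DynFO_arith = {Q. \<exists>P. wf_program Q P \<and> maintains P Q}"

section \<open>The rank of an integer matrix\<close>

datatype matrix_sym = Less | MPlus | MMinus

primrec matrix_arity :: "matrix_sym \<Rightarrow> nat" where
  "matrix_arity Less = 2"
| "matrix_arity MPlus = 3"
| "matrix_arity MMinus = 3"

primrec matrix_initial :: "'a set \<Rightarrow> ('a \<times> 'a) set \<Rightarrow> (matrix_sym, 'a) interp" where
  "matrix_initial D L Less = {[x, y] | x y. (x, y) \<in> L}"
| "matrix_initial D L MPlus = {}"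
| "matrix_initial D L MMinus = {}"

definition input_order :: "(matrix_sym, 'a) interp \<Rightarrow> ('a \<times> 'a) set" where
  "input_order I = {(x, y). [x, y] \<in> I Less}"

fun matrix_allowed :: "(matrix_sym, 'a) interp \<Rightarrow> matrix_sym change_type \<Rightarrow> 'a list \<Rightarrow> bool" where
  "matrix_allowed I (Insert R) [x, y, a] \<longleftrightarrow> (\<nexists>b. [x, y, b] \<in> I MPlus \<union> I MMinus)"
| "matrix_allowed I (Delete R) t \<longleftrightarrow> True"
| "matrix_allowed I (Insert R) t \<longleftrightarrow> False"

text \<open>The descriptions below are proper because at most one triple is present for each \<open>x\<close>, \<open>y\<close>.\<close>

definition entry :: "(matrix_sym, 'a) interp \<Rightarrow> 'a \<Rightarrow> 'a \<Rightarrow> int" where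
  "entry I x y =
     (if \<exists>a. [x, y, a] \<in> I MPlus then int (pos (input_order I) (THE a. [x, y, a] \<in> I MPlus))
      else if \<exists>a. [x, y, a] \<in> I MMinus then - int (pos (input_order I) (THE a. [x, y, a] \<in> I MMinus))
      else 0)"

text \<open>Matrix indices of type \<open>mat\<close> start with 0, hence the shift.\<close>

definition encoded_matrix :: "'a set \<Rightarrow> (matrix_sym, 'a) interp \<Rightarrow> rat mat" where
  "encoded_matrix D I =
     mat (card D) (card D)
       (\<lambda>(i, j). of_int (entry I (elem_at D (input_order I) (i + 1)) (elem_at D (input_order I) (j + 1))))"

definition encoded_rank :: "'a set \<Rightarrow> (matrix_sym, 'a) interp \<Rightarrow> nat" where
  "encoded_rank D I = vec_space.rank (card D) (encoded_matrix D I)"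

definition rank_query :: "'a set \<Rightarrow> (matrix_sym, 'a) interp \<Rightarrow> 'a list set" where
  "rank_query D I =
     (if encoded_rank D I > 0 then {[elem_at D (input_order I) (encoded_rank D I)]} else {})"

definition MatrixRank :: "(matrix_sym, 'a) dyn_problem" where
  "MatrixRank =
     \<lparr>in_arity = matrix_arity,
      changeable = {MPlus, MMinus},
      initial = matrix_initial,
      allowed = matrix_allowed,
      query_arity = 1,
      query = rank_query\<rparr>"

end

theory Submission
  imports Defs "HOL-Real_Asymp.Real_Asymp" "HOL-Number_Theory.Cong"
begin

text \<open>Let \<open>n\<close> be the size of the domain. For every prime \<open>p < n\<^sup>1\<^sup>0\<close> the program maintains matrices \<open>B\<close> and
  \<open>C\<close> modulo \<open>p\<close> such that \<open>C = A B\<close>, the matrix \<open>B\<close> is invertible, and every nonzero column of \<open>C\<close> has a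
  pivot row, that is, a row in which it has the only nonzero entry. The number of nonzero columns
  of \<open>C\<close> is then the rank of \<open>A\<close> modulo \<open>p\<close>. A change of an entry \<open>(a, b)\<close> of \<open>A\<close> adds a multiple of row \<open>b\<close> of
  \<open>B\<close> to row \<open>a\<close> of \<open>C\<close>, after which two rounds of column operations, each with a single pivot column,
  suffice to restore the pivots. No sums occur, so this is first-order definable from arithmetic modulo \<open>p\<close>.

  The rank of \<open>A\<close> is the maximum of the ranks modulo \<open>p\<close>: some regular integer matrix with entries
  bounded by \<open>n\<close> witnesses the rank, and its determinant is at most \<open>n\<^sup>2\<^sup>n\<close> in absolute value, so that some
  prime \<open>p < n\<^sup>1\<^sup>0\<close> does not divide it if \<open>n \<ge> 2\<close>. Both this and the definability of arithmetic on numbers with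
  several digits rest on the fact that a number divisible by \<open>1, \<dots>, 2m\<close> is at least \<open>2\<^sup>m\<close>: a polynomial
  equation between elements of the domain holds iff it holds modulo all small moduli, and
  residues can be computed inside the domain.\<close>

section \<open>Primes not dividing a small number\<close>

text \<open>First-order updates can neither add up unboundedly many terms nor count, which dictates
  the form of the pivots. A changed entry of \<open>A\<close> alters only row \<open>a\<close> of
  \<open>C\<close>. Hence at most one column loses its pivot row, and formerly zero columns become
  nonzero in row \<open>a\<close> only. The first round takes a column supported in row
  \<open>a\<close> alone, if there is one, and clears the rest of row \<open>a\<close> with it; no
  other row is touched. The second round serves the one column that may lack a pivot row; the pivot
  rows of all other columns are 0 in that column and survive. The set of nonzero columns loses at
  most one and gains at most one element, so two inclusion tests replace counting. Residues keep the
  entries of \<open>B\<close> and \<open>C\<close> bounded, so that a fixed number of domain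
  elements can encode them. The rank modulo \<open>p\<close> is never too large, because pivots
  modulo \<open>p\<close> make the corresponding integer columns of \<open>A B\<close> independent
  over the rationals. For \<open>n = 1\<close> no prime lies below \<open>n ^ 10\<close>, and the
  answer is read off the input directly.\<close>

lemma dvd_binomial_mult:
  fixes L :: nat
  assumes "\<And>i. 0 < i \<Longrightarrow> i \<le> n \<Longrightarrow> i dvd L" "0 < k" "k \<le> n"
  shows "k * (n choose k) dvd L"
  using assms(2,3,1)
proof (induction k arbitrary: n rule: nat_induct_non_zero)
  case 1
  then show ?case by simp
next
  case (Suc k)
  then obtain m where m: "n = Suc m" by (cases n) auto
  have km: "k \<le> m" using Suc m by simp
  obtain u where u: "L = k * (m choose k) * u"
    using Suc.IH[of m] Suc.prems km m by (auto elim!: dvdE)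
  obtain w where w: "L = k * (n choose k) * w"
    using Suc.IH[of n] Suc.prems km m by (auto elim!: dvdE)
  have pos: "0 < k * (m choose k)" using Suc km by simp
  have e1: "(n - k) * (n choose k) = n * (m choose k)"
    using binomial_absorb_comp[of n k] m by simp
  have e2: "Suc k * (n choose Suc k) = n * (m choose k)"
    using m Suc_times_binomial_eq[of m k] by (simp add: mult.commute)
  \<comment> \<open>This is the rule of the Leibniz harmonic triangle, scaled by \<open>L\<close>:
    the reciprocal of \<open>Suc k * (n choose Suc k)\<close> is the reciprocal of
    \<open>k * (m choose k)\<close> minus that of \<open>k * (n choose k)\<close>.\<close>
  have "Suc k * (n choose Suc k) * (int u - int w) = int L"
  proof -
    have "int k * (Suc k * (n choose Suc k) * (int u - int w))
        = n * int (k * (m choose k) * u) - (n - k) * int (k * (n choose k) * w)"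
      using e1 e2 by (simp add: algebra_simps flip: of_nat_mult)
    also have "\<dots> = n * int L - (int n - int k) * int L"
      unfolding u[symmetric] w[symmetric] using km m by (simp add: of_nat_diff)
    also have "\<dots> = int k * int L" by (simp add: algebra_simps)
    finally show ?thesis using Suc(1) by simp
  qed
  then have "int (Suc k * (n choose Suc k)) dvd int L"
    by (metis dvd_triv_left of_nat_mult)
  then show ?case by (simp only: of_nat_dvd_iff)
qed

text \<open>The product \<open>m * ((2 * m) choose m)\<close> divides \<open>d\<close>, and the
  central binomial coefficient at least doubles from each \<open>m\<close> to the next.\<close>

lemma two_power_le_if_all_dvd:
  fixes d :: nat
  assumes "\<And>i. 0 < i \<Longrightarrow> i \<le> 2 * m \<Longrightarrow> i dvd d" "0 < d"
  shows "2 ^ m \<le> d"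
proof (cases "m = 0")
  case True
  with assms show ?thesis by simp
next
  case False
  have "2 ^ m \<le> (2 * m) choose m"
  proof (induction m)
    case (Suc m)
    have "Suc m * ((2 * Suc m) choose (Suc m)) = (2 * Suc m) * ((2 * m + 1) choose m)"
      using Suc_times_binomial_eq[of "2 * m + 1" m] by (simp add: mult.commute)
    then have "((2 * Suc m) choose (Suc m)) = 2 * ((2 * m + 1) choose m)"
      by (metis (no_types, lifting) mult.assoc mult.left_commute mult_cancel1 nat.distinct(1))
    moreover have "(2 * m) choose m \<le> (2 * m + 1) choose m"
      by (cases m) auto
    ultimately show ?case using Suc by simp
  qed simp
  also have "\<dots> \<le> m * ((2 * m) choose m)" using False by simp
  also have "\<dots> \<le> d"
    using dvd_binomial_mult[of "2 * m" d m] assms False by (intro dvd_imp_le) auto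
  finally show ?thesis .
qed

text \<open>A number up to \<open>2 ^ e\<close> has at most \<open>e\<close> prime factors, counted
  with multiplicity, and each of them divides \<open>d\<close>.\<close>

lemma dvd_power_if_all_primes_dvd:
  fixes d :: nat
  assumes "\<And>p. prime p \<Longrightarrow> p \<le> N \<Longrightarrow> p dvd d" "0 < k" "k \<le> N" "k \<le> 2 ^ e"
  shows "k dvd d ^ e"
  using assms(2-)
proof (induction e arbitrary: k)
  case (Suc e)
  show ?case
  proof (cases "k = 1")
    case False
    then obtain p where p: "prime p" "p dvd k" by (metis prime_factor_nat)
    then obtain j where j: "k = p * j" by (auto elim: dvdE)
    have p2: "2 \<le> p" using p prime_ge_2_nat by blast
    have "0 < j" using j Suc.prems by (cases j) auto
    have "p \<le> k" using p Suc.prems by (simp add: dvd_imp_le)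
    have "2 * j \<le> k" using j p2 by simp
    then have "j dvd d ^ e" using \<open>0 < j\<close> Suc by auto
    moreover have "p dvd d" using assms(1) p(1) \<open>p \<le> k\<close> Suc.prems by simp
    ultimately show ?thesis using j by (simp add: mult_dvd_mono)
  qed simp
qed simp

text \<open>Otherwise all of 1, ..., N would divide \<open>d ^ (10 * n)\<close>, so that
  \<open>2 ^ (N div 2)\<close> is at most \<open>2 ^ (20 * n ^ 3)\<close>. Since N is about
  \<open>n ^ 10\<close>, this fails; the exponent 10 leaves enough room for it to fail from
  \<open>n = 2\<close> on.\<close>

lemma exists_prime_not_dvd:
  fixes d n :: nat
  assumes "2 \<le> n" "0 < d" "d \<le> n ^ (2 * n)"
  shows "\<exists>p. prime p \<and> p < n ^ 10 \<and> \<not> p dvd d"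
proof (rule ccontr)
  assume contr: "\<not> ?thesis"
  define N where "N = n ^ 10 - 1"
  define m where "m = N div 2"
  have Nn: "N < n ^ 10" using assms(1) by (simp add: N_def)
  have n2: "n \<le> 2 ^ n" by (rule less_imp_le, rule less_exp)
  have N2: "N \<le> 2 ^ (10 * n)"
    using power_mono[OF n2, of 10] Nn by (simp add: power_mult[symmetric] mult.commute)
  have "2 ^ m \<le> d ^ (10 * n)"
  proof (rule two_power_le_if_all_dvd)
    fix i assume i: "0 < i" "i \<le> 2 * m"
    then have "i \<le> N" by (simp add: m_def)
    then show "i dvd d ^ (10 * n)"
      using contr Nn N2 i(1) by (intro dvd_power_if_all_primes_dvd[where N = N]) auto
  qed (use assms in simp)
  also have "\<dots> \<le> (n ^ (2 * n)) ^ (10 * n)" using assms by (intro power_mono) auto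
  also have "\<dots> \<le> ((2 ^ n) ^ (2 * n)) ^ (10 * n)" using n2 by (intro power_mono) auto
  also have "\<dots> = 2 ^ (20 * n ^ 3)"
    by (simp add: power_mult[symmetric] power3_eq_cube ac_simps)
  finally have "m \<le> 20 * n ^ 3" by simp
  then have 1: "n ^ 10 \<le> 40 * n ^ 3 + 2" by (simp add: m_def N_def)
  have "2 ^ 7 \<le> n ^ 7" using assms by (intro power_mono) auto
  then have "128 * n ^ 3 \<le> n ^ 7 * n ^ 3" by (intro mult_right_mono) auto
  then have "128 * n ^ 3 \<le> n ^ 10" by (simp flip: power_add)
  moreover have "2 ^ 3 \<le> n ^ 3" using assms by (intro power_mono) auto
  ultimately show False using 1 by simp
qed

text \<open>Below, \<open>n\<close> is the size of the domain and the moduli \<open>i\<close> are those for which products of residues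
  stay inside the domain.\<close>

lemma exists_modulus_neq:
  "\<exists>n0. \<forall>n\<ge>n0. \<forall>x y. x \<noteq> y \<longrightarrow> x < n ^ K \<longrightarrow> y < n ^ K \<longrightarrow>
     (\<exists>i>0. i * i + i \<le> n \<and> x mod i \<noteq> (y mod i :: nat))"
proof -
  \<comment> \<open>If all moduli 1, ..., 2m are admissible and none separates the numbers, their
    difference is a positive common multiple of them, hence at least \<open>2 ^ m\<close>.\<close>
  have *: "\<exists>i>0. i * i + i \<le> n \<and> x mod i \<noteq> y mod i"
    if n: "n ^ K < 2 ^ m" "(2 * m) * (2 * m) + 2 * m \<le> n" and xy: "x < y" "y < n ^ K" for n m x y :: nat
  proof (rule ccontr)
    assume contr: "\<not> ?thesis"
    have "2 ^ m \<le> y - x"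
    proof (rule two_power_le_if_all_dvd)
      fix i assume i: "0 < i" "i \<le> 2 * m"
      then have "i * i \<le> (2 * m) * (2 * m)" by (intro mult_mono) auto
      then have "i * i + i \<le> n" using i n by linarith
      then have "x mod i = y mod i" using contr i by auto
      then show "i dvd y - x" using mod_eq_dvd_iff_nat[of x y i] xy by simp
    qed (use xy in simp)
    then show False using xy n by linarith
  qed
  \<comment> \<open>The largest \<open>m\<close> for which all moduli 1, ..., 2m are admissible; it
    is of the order of the square root of \<open>n\<close>.\<close>
  define M where "M n = (LEAST m. n < (2 * Suc m) * (2 * Suc m) + 2 * Suc m)" for n :: nat
  have M1: "n < (2 * Suc (M n)) * (2 * Suc (M n)) + 2 * Suc (M n)" for n
    unfolding M_def by (rule LeastI[of _ n]) simp
  have M2: "(2 * M n) * (2 * M n) + 2 * M n \<le> n" for n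
  proof (cases "M n")
    case (Suc m)
    have "\<not> n < (2 * Suc m) * (2 * Suc m) + 2 * Suc m"
      using not_less_Least[of m "\<lambda>m. n < (2 * Suc m) * (2 * Suc m) + 2 * Suc m"] Suc
      unfolding M_def by simp
    then show ?thesis using Suc by simp
  qed simp
  \<comment> \<open>As \<open>n\<close> is at most quadratic in \<open>M n\<close>, its power
    \<open>n ^ K\<close> is polynomial in \<open>M n\<close> and is eventually overtaken by
    \<open>2 ^ M n\<close>.\<close>
  have "eventually (\<lambda>m::nat. real ((6 * (m + 1) * (m + 1)) ^ K) < 2 ^ m) at_top"
    by real_asymp
  then obtain m0 where m0: "\<And>m. m0 \<le> m \<Longrightarrow> (6 * (m + 1) * (m + 1)) ^ K < (2::nat) ^ m"
    unfolding eventually_at_top_linorder by (metis of_nat_less_iff of_nat_numeral of_nat_power)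
  show ?thesis
  proof (rule exI[of _ "(2 * Suc m0) * (2 * Suc m0) + 2 * Suc m0"], intro allI impI)
    fix n x y :: nat
    assume n: "(2 * Suc m0) * (2 * Suc m0) + 2 * Suc m0 \<le> n" and xy: "x \<noteq> y" "x < n ^ K" "y < n ^ K"
    have "m0 \<le> M n"
    proof (rule ccontr)
      assume "\<not> m0 \<le> M n"
      then have "(2 * Suc (M n)) * (2 * Suc (M n)) + 2 * Suc (M n) \<le> (2 * Suc m0) * (2 * Suc m0) + 2 * Suc m0"
        by (intro add_mono mult_mono) auto
      then show False using M1[of n] n by linarith
    qed
    have "n \<le> 6 * (M n + 1) * (M n + 1)" using M1[of n] by (simp add: algebra_simps)
    then have "n ^ K < 2 ^ M n"
      using m0[OF \<open>m0 \<le> M n\<close>] power_mono[of n "6 * (M n + 1) * (M n + 1)" K] by linarith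
    then show "\<exists>i>0. i * i + i \<le> n \<and> x mod i \<noteq> y mod i"
      using *[OF _ M2, of n x y] *[OF _ M2, of n y x] xy by (metis linorder_neqE_nat)
  qed
qed

section \<open>First-order definable predicates\<close>

context
  fixes D :: "'a set" and L
  assumes fin: "finite D" and ord: "strict_order_of D L"
begin

lemma
  shows order_subset: "L \<subseteq> D \<times> D"
    and order_trans: "(x, y) \<in> L \<Longrightarrow> (y, z) \<in> L \<Longrightarrow> (x, z) \<in> L"
    and order_irrefl: "(x, x) \<notin> L"
    and order_total: "x \<in> D \<Longrightarrow> y \<in> D \<Longrightarrow> x \<noteq> y \<Longrightarrow> (x, y) \<in> L \<or> (y, x) \<in> L"
  using ord unfolding strict_order_of_def strict_linear_order_on_def
  by (auto dest: transD simp: irrefl_def total_on_def)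

lemma finite_below: "finite {y. (y, x) \<in> L}"
  by (rule finite_subset[OF _ fin]) (use order_subset in auto)

lemma pos_less: "(x, y) \<in> L \<Longrightarrow> pos L x < pos L y"
  unfolding pos_def
  by (simp, rule psubset_card_mono[OF finite_below]) (use order_trans order_irrefl in blast)

lemma pos_less_iff: "x \<in> D \<Longrightarrow> y \<in> D \<Longrightarrow> pos L x < pos L y \<longleftrightarrow> (x, y) \<in> L"
  using pos_less order_total by (metis less_asym less_irrefl)

lemma bij_betw_pos: "bij_betw (pos L) D {1..card D}"
proof -
  have inj: "inj_on (pos L) D"
    by (rule inj_onI) (metis less_irrefl order_total pos_less)
  have "pos L x \<le> card D" if "x \<in> D" for x
  proof -
    have "{y. (y, x) \<in> L} \<subseteq> D - {x}" using order_subset order_irrefl by auto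
    then have "card {y. (y, x) \<in> L} \<le> card (D - {x})" using fin by (intro card_mono) auto
    moreover have "card D = Suc (card (D - {x}))" using fin that card.remove by fastforce
    ultimately show ?thesis by (simp add: pos_def)
  qed
  then have "pos L ` D \<subseteq> {1..card D}" by (auto simp: pos_def)
  moreover have "card (pos L ` D) = card {1..card D}" using inj by (simp add: card_image)
  ultimately have "pos L ` D = {1..card D}" by (simp add: card_subset_eq)
  with inj show ?thesis by (simp add: bij_betw_def)
qed

lemma elem_at_in: "1 \<le> k \<Longrightarrow> k \<le> card D \<Longrightarrow> elem_at D L k \<in> D"
  unfolding elem_at_def using bij_betw_pos
  by (metis atLeastAtMost_iff bij_betw_apply bij_betw_the_inv_into)

lemma pos_elem_at: "1 \<le> k \<Longrightarrow> k \<le> card D \<Longrightarrow> pos L (elem_at D L k) = k"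
  unfolding elem_at_def using bij_betw_pos f_the_inv_into_f_bij_betw by fastforce

lemma elem_at_pos: "x \<in> D \<Longrightarrow> elem_at D L (pos L x) = x"
  unfolding elem_at_def using bij_betw_pos by (simp add: bij_betw_def the_inv_into_f_f)

lemma pos_bounds: "x \<in> D \<Longrightarrow> 1 \<le> pos L x \<and> pos L x \<le> card D"
  using bij_betw_pos bij_betw_apply by fastforce

end

section \<open>Renaming the variables of a formula\<close>

lemma sat_cong:
  "(\<And>x. x \<in> free_vars \<phi> \<Longrightarrow> v x = w x) \<Longrightarrow> sat D I v \<phi> = sat D I w \<phi>"
proof (induction \<phi> arbitrary: v w)
  case (Atom R xs)
  then have "map v xs = map w xs" by simp
  then show ?case by (simp del: map_eq_conv)
next
  case (Conj \<phi> \<psi>)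
  have "sat D I v \<phi> = sat D I w \<phi>" "sat D I v \<psi> = sat D I w \<psi>"
    using Conj.prems by (intro Conj.IH; simp)+
  then show ?case by simp
next
  case (Disj \<phi> \<psi>)
  have "sat D I v \<phi> = sat D I w \<phi>" "sat D I v \<psi> = sat D I w \<psi>"
    using Disj.prems by (intro Disj.IH; simp)+
  then show ?case by simp
next
  case (Exists x \<phi>)
  have "sat D I (v(x := d)) \<phi> = sat D I (w(x := d)) \<phi>" for d
    using Exists.prems by (intro Exists.IH) simp
  then show ?case by simp
next
  case (Forall x \<phi>)
  have "sat D I (v(x := d)) \<phi> = sat D I (w(x := d)) \<phi>" for d
    using Forall.prems by (intro Forall.IH) simp
  then show ?case by simp
next
  case (Neg \<phi>)
  have "sat D I v \<phi> = sat D I w \<phi>" using Neg.prems by (intro Neg.IH) simp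
  then show ?case by simp
qed simp

text \<open>Capture-avoiding renaming: bound variables are renamed to \<open>m\<close>, \<open>m + 1\<close>, \dots, where all
  new names of free variables are below \<open>m\<close>.\<close>

primrec rename :: "'r fm \<Rightarrow> (nat \<Rightarrow> nat) \<Rightarrow> nat \<Rightarrow> 'r fm" where
  "rename (Equal x y) f m = Equal (f x) (f y)"
| "rename (Atom R xs) f m = Atom R (map f xs)"
| "rename (Neg \<phi>) f m = Neg (rename \<phi> f m)"
| "rename (Conj \<phi> \<psi>) f m = Conj (rename \<phi> f m) (rename \<psi> f m)"
| "rename (Disj \<phi> \<psi>) f m = Disj (rename \<phi> f m) (rename \<psi> f m)"
| "rename (Exists x \<phi>) f m = Exists m (rename \<phi> (f(x := m)) (Suc m))"
| "rename (Forall x \<phi>) f m = Forall m (rename \<phi> (f(x := m)) (Suc m))"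

lemma over_vocab_rename: "over_vocab V ar (rename \<phi> f m) = over_vocab V ar \<phi>"
  by (induction \<phi> arbitrary: f m) auto

lemma free_vars_rename: "free_vars (rename \<phi> f m) \<subseteq> f ` free_vars \<phi>"
proof (induction \<phi> arbitrary: f m)
  case (Exists x \<phi>)
  from Exists[of "f(x := m)" "Suc m"] show ?case unfolding rename.simps free_vars.simps by fastforce
next
  case (Forall x \<phi>)
  from Forall[of "f(x := m)" "Suc m"] show ?case unfolding rename.simps free_vars.simps by fastforce
qed fastforce+

lemma sat_rename:
  "f ` free_vars \<phi> \<subseteq> {..<m} \<Longrightarrow> sat D I v (rename \<phi> f m) = sat D I (v \<circ> f) \<phi>"
proof (induction \<phi> arbitrary: f m v)
  case (Exists x \<phi>)
  have "sat D I (v(m := d)) (rename \<phi> (f(x := m)) (Suc m)) = sat D I ((v \<circ> f)(x := d)) \<phi>" for d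
  proof -
    have "(f(x := m)) ` free_vars \<phi> \<subseteq> {..<Suc m}" using Exists.prems by (auto simp: less_Suc_eq)
    then have "sat D I (v(m := d)) (rename \<phi> (f(x := m)) (Suc m)) = sat D I (v(m := d) \<circ> f(x := m)) \<phi>"
      by (rule Exists.IH)
    also have "\<dots> = sat D I ((v \<circ> f)(x := d)) \<phi>"
      using Exists.prems by (intro sat_cong) auto
    finally show ?thesis .
  qed
  then show ?case by (simp del: comp_apply fun_upd_apply)
next
  case (Forall x \<phi>)
  have "sat D I (v(m := d)) (rename \<phi> (f(x := m)) (Suc m)) = sat D I ((v \<circ> f)(x := d)) \<phi>" for d
  proof -
    have "(f(x := m)) ` free_vars \<phi> \<subseteq> {..<Suc m}" using Forall.prems by (auto simp: less_Suc_eq)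
    then have "sat D I (v(m := d)) (rename \<phi> (f(x := m)) (Suc m)) = sat D I (v(m := d) \<circ> f(x := m)) \<phi>"
      by (rule Forall.IH)
    also have "\<dots> = sat D I ((v \<circ> f)(x := d)) \<phi>"
      using Forall.prems by (intro sat_cong) auto
    finally show ?thesis .
  qed
  then show ?case by (simp del: comp_apply fun_upd_apply)
qed (auto simp: image_Un comp_def)

text \<open>The components \<open>basis_of s p\<close> and \<open>image_of s p\<close> are the matrices \<open>B\<close> and \<open>C\<close> for the prime \<open>p\<close>, and
  \<open>rank_of s p\<close> is the number of nonzero columns of \<open>C\<close>. Elements are numbered from 0 by \<open>el\<close> and \<open>idx\<close>,
  whereas \<open>pos\<close> starts with 1.\<close>

record 'a state =
  dom_of :: "'a set"
  order_of :: "('a \<times> 'a) set"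
  input_of :: "(matrix_sym, 'a) interp"
  aux_of :: "(aux_sym, 'a) interp"
  changed_of :: "'a list"
  basis_of :: "nat \<Rightarrow> nat \<Rightarrow> nat \<Rightarrow> nat"
  image_of :: "nat \<Rightarrow> nat \<Rightarrow> nat \<Rightarrow> nat"
  rank_of :: "nat \<Rightarrow> nat"

abbreviation size_of :: "'a state \<Rightarrow> nat" where
  "size_of s \<equiv> card (dom_of s)"

definition el :: "'a state \<Rightarrow> nat \<Rightarrow> 'a" where
  "el s k = elem_at (dom_of s) (order_of s) (k + 1)"

definition idx :: "'a state \<Rightarrow> 'a \<Rightarrow> nat" where
  "idx s x = pos (order_of s) x - 1"

definition arith :: "'a state \<Rightarrow> bool" where
  "arith s \<longleftrightarrow> finite (dom_of s) \<and> dom_of s \<noteq> {} \<and> strict_order_of (dom_of s) (order_of s) \<and>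
     (\<forall>S\<in>{Order, Plus, Times}. aux_of s S = initial_aux (dom_of s) (order_of s) S) \<and>
     changed_of s \<in> tuples (dom_of s) 3"

context
  fixes s :: "'a state"
  assumes arith: "arith s"
begin

lemma arith_order: "finite (dom_of s)" "strict_order_of (dom_of s) (order_of s)"
  using arith by (auto simp: arith_def)

lemma size_pos: "0 < size_of s"
  using arith by (auto simp: arith_def card_gt_0_iff)

lemma el_in: "k < size_of s \<Longrightarrow> el s k \<in> dom_of s"
  unfolding el_def using elem_at_in[OF arith_order] by simp

lemma pos_el: "k < size_of s \<Longrightarrow> pos (order_of s) (el s k) = k + 1"
  unfolding el_def using pos_elem_at[OF arith_order] by simp

lemma idx_el: "k < size_of s \<Longrightarrow> idx s (el s k) = k"
  unfolding idx_def using pos_el by simp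

lemma el_idx: "x \<in> dom_of s \<Longrightarrow> el s (idx s x) = x"
  unfolding idx_def el_def using pos_bounds[OF arith_order, of x] elem_at_pos[OF arith_order, of x] by simp

lemma idx_less: "x \<in> dom_of s \<Longrightarrow> idx s x < size_of s"
  unfolding idx_def using pos_bounds[OF arith_order, of x] by auto

lemma el_eq_iff: "i < size_of s \<Longrightarrow> j < size_of s \<Longrightarrow> el s i = el s j \<longleftrightarrow> i = j"
  by (metis idx_el)

lemma bex_dom_iff: "(\<exists>d\<in>dom_of s. R d) \<longleftrightarrow> (\<exists>x<size_of s. R (el s x))"
  by (metis el_in el_idx idx_less)

lemma less_atom: "i < size_of s \<Longrightarrow> j < size_of s \<Longrightarrow> [el s i, el s j] \<in> aux_of s Order \<longleftrightarrow> i < j"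
  using arith pos_less_iff[OF arith_order el_in el_in, of i j] pos_el
  by (auto simp: arith_def)

text \<open>\<open>Plus\<close> adds positions, which start with 1, whereas \<open>el\<close> counts
  from 0: the underlying equation is (i + 1) + (j + 1) = k + 1.\<close>

lemma plus_atom:
  "i < size_of s \<Longrightarrow> j < size_of s \<Longrightarrow> k < size_of s \<Longrightarrow>
     [el s i, el s j, el s k] \<in> aux_of s Plus \<longleftrightarrow> i + j + 1 = k"
  using arith pos_el el_in by (auto simp: arith_def)

lemma times_atom:
  "i < size_of s \<Longrightarrow> j < size_of s \<Longrightarrow> k < size_of s \<Longrightarrow>
     [el s i, el s j, el s k] \<in> aux_of s Times \<longleftrightarrow> (i + 1) * (j + 1) = k + 1"
  using arith pos_el el_in by (auto simp: arith_def)

lemma length_changed: "length (changed_of s) = 3"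
  using arith by (auto simp: arith_def tuples_def)

lemma changed_in: "i < 3 \<Longrightarrow> changed_of s ! i \<in> dom_of s"
proof -
  assume "i < 3"
  then have "changed_of s ! i \<in> set (changed_of s)" by (intro nth_mem) (simp add: length_changed)
  moreover have "set (changed_of s) \<subseteq> dom_of s" using arith by (simp add: arith_def tuples_def)
  ultimately show ?thesis by blast
qed

end

section \<open>Definability of predicates on numbered elements\<close>

definition env :: "'a state \<Rightarrow> (nat \<Rightarrow> nat) \<Rightarrow> nat \<Rightarrow> 'a" where
  "env s v i = (if i < 3 then changed_of s ! i else el s (v (i - 3)))"

lemma env_upd: "env s (v(k := x)) = (env s v)(k + 3 := el s x)"
  by (rule ext) (auto simp: env_def)

text \<open>The guard \<open>G\<close> selects the states on which a formula has to be correct, so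
  that an invariant can be supplied later. \<open>P\<close> matters only through its
  vocabulary.\<close>

locale fo =
  fixes P :: "matrix_sym dyn_program" and G :: "'a state \<Rightarrow> bool"
  assumes G_arith: "G s \<Longrightarrow> arith s"
begin

abbreviation wff :: "(matrix_sym + aux_sym) fm \<Rightarrow> bool" where
  "wff \<equiv> over_vocab (UNIV <+> aux_syms P) (case_sum matrix_arity (aux_arity P))"

abbreviation sem :: "'a state \<Rightarrow> (nat \<Rightarrow> nat) \<Rightarrow> (matrix_sym + aux_sym) fm \<Rightarrow> bool" where
  "sem s v \<equiv> sat (dom_of s) (case_sum (input_of s) (aux_of s)) (env s v)"

text \<open>The predicate \<open>Q s v\<close> is expressed by a formula whose variables \<open>0, 1, 2\<close> denote the changed
  tuple, and whose variable \<open>i + 3\<close> denotes the element with number \<open>v i\<close>.\<close>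

definition fodef :: "nat \<Rightarrow> ('a state \<Rightarrow> (nat \<Rightarrow> nat) \<Rightarrow> bool) \<Rightarrow> bool" where
  "fodef k Q \<longleftrightarrow> (\<exists>\<phi>. free_vars \<phi> \<subseteq> {..<k + 3} \<and> wff \<phi> \<and>
     (\<forall>s v. G s \<longrightarrow> (\<forall>i<k. v i < size_of s) \<longrightarrow> sem s v \<phi> = Q s v))"

lemma fodefI:
  assumes "free_vars \<phi> \<subseteq> {..<k + 3}" "wff \<phi>"
    "\<And>s v. G s \<Longrightarrow> \<forall>i<k. v i < size_of s \<Longrightarrow> sem s v \<phi> = Q s v"
  shows "fodef k Q"
  unfolding fodef_def using assms by blast

lemma fodefE:
  assumes "fodef k Q"
  obtains \<phi> where "free_vars \<phi> \<subseteq> {..<k + 3}" "wff \<phi>"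
    "\<And>s v. G s \<Longrightarrow> \<forall>i<k. v i < size_of s \<Longrightarrow> sem s v \<phi> = Q s v"
  using assms unfolding fodef_def by blast

lemma fodef_cong:
  assumes "fodef k Q" "\<And>s v. G s \<Longrightarrow> \<forall>i<k. v i < size_of s \<Longrightarrow> Q s v = R s v"
  shows "fodef k R"
  using assms unfolding fodef_def by metis

lemma fodef_neg: "fodef k Q \<Longrightarrow> fodef k (\<lambda>s v. \<not> Q s v)"
  by (elim fodefE, rule_tac \<phi> = "Neg \<phi>" in fodefI) auto

lemma fodef_conj: "fodef k Q \<Longrightarrow> fodef k R \<Longrightarrow> fodef k (\<lambda>s v. Q s v \<and> R s v)"
  by (elim fodefE, rule_tac \<phi> = "Conj \<phi> \<phi>'" in fodefI) auto

lemma fodef_disj: "fodef k Q \<Longrightarrow> fodef k R \<Longrightarrow> fodef k (\<lambda>s v. Q s v \<or> R s v)"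
  by (elim fodefE, rule_tac \<phi> = "Disj \<phi> \<phi>'" in fodefI) auto

lemma fodef_imp: "fodef k Q \<Longrightarrow> fodef k R \<Longrightarrow> fodef k (\<lambda>s v. Q s v \<longrightarrow> R s v)"
  using fodef_disj[OF fodef_neg] by (rule fodef_cong) auto

lemma fodef_iff: "fodef k Q \<Longrightarrow> fodef k R \<Longrightarrow> fodef k (\<lambda>s v. Q s v \<longleftrightarrow> R s v)"
  using fodef_conj[OF fodef_imp fodef_imp, of k Q R R Q] by (rule fodef_cong) auto

lemma fodef_exists_upd:
  assumes "fodef (Suc k) Q"
  shows "fodef k (\<lambda>s v. \<exists>x<size_of s. Q s (v(k := x)))"
proof -
  from assms obtain \<phi> where \<phi>: "free_vars \<phi> \<subseteq> {..<Suc k + 3}" "wff \<phi>"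
    "\<And>s v. G s \<Longrightarrow> \<forall>i<Suc k. v i < size_of s \<Longrightarrow> sem s v \<phi> = Q s v"
    by (rule fodefE) blast
  show ?thesis
  proof (rule fodefI[of "Exists (k + 3) \<phi>"])
    fix s v assume G: "G s" and v: "\<forall>i<k. v i < size_of s"
    have "sem s v (Exists (k + 3) \<phi>) \<longleftrightarrow> (\<exists>x<size_of s. sem s (v(k := x)) \<phi>)"
      by (simp add: bex_dom_iff[OF G_arith[OF G]] env_upd)
    also have "\<dots> \<longleftrightarrow> (\<exists>x<size_of s. Q s (v(k := x)))"
      using \<phi>(3)[OF G] v by (intro ex_cong1 conj_cong refl) (auto simp: less_Suc_eq)
    finally show "sem s v (Exists (k + 3) \<phi>) = (\<exists>x<size_of s. Q s (v(k := x)))" .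
  qed (use \<phi> in \<open>auto simp: subset_iff less_Suc_eq\<close>)
qed

text \<open>The second premise states semantically that \<open>Q\<close> ignores variable
  \<open>k\<close>, which is about to be bound. In this form, predicates written with ordinary
  quantifiers can be decomposed by introduction rules.\<close>

lemma fodef_ex:
  assumes "fodef (Suc k) (\<lambda>s v. Q s v (v k))" "\<And>s v x y. Q s (v(k := x)) y = Q s v y"
  shows "fodef k (\<lambda>s v. \<exists>x<size_of s. Q s v x)"
  using fodef_exists_upd[OF assms(1)] by (simp add: assms(2))

lemma fodef_all:
  assumes "fodef (Suc k) (\<lambda>s v. Q s v (v k))" "\<And>s v x y. Q s (v(k := x)) y = Q s v y"
  shows "fodef k (\<lambda>s v. \<forall>x<size_of s. Q s v x)"
proof (rule fodef_cong)
  show "fodef k (\<lambda>s v. \<not> (\<exists>x<size_of s. \<not> Q s v x))"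
    by (intro fodef_neg fodef_ex) (auto simp: assms)
qed auto

lemma fodef_rename:
  assumes "fodef r Q" "\<And>i. i < r \<Longrightarrow> f i < k"
  shows "fodef k (\<lambda>s v. Q s (\<lambda>i. v (f i)))"
proof -
  from assms(1) obtain \<phi> where \<phi>: "free_vars \<phi> \<subseteq> {..<r + 3}" "wff \<phi>"
    "\<And>s v. G s \<Longrightarrow> \<forall>i<r. v i < size_of s \<Longrightarrow> sem s v \<phi> = Q s v"
    by (rule fodefE) blast
  define g where "g i = (if i < 3 then i else f (i - 3) + 3)" for i
  have g: "g ` free_vars \<phi> \<subseteq> {..<k + 3}"
    using \<phi>(1) assms(2) by (fastforce simp: g_def)
  show ?thesis
  proof (rule fodefI[of "rename \<phi> g (k + 3)"])
    show "free_vars (rename \<phi> g (k + 3)) \<subseteq> {..<k + 3}"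
      using free_vars_rename g by blast
    show "wff (rename \<phi> g (k + 3))" using \<phi> by (simp add: over_vocab_rename)
    fix s v assume "G s" "\<forall>i<k. v i < size_of s"
    moreover have "env s v \<circ> g = env s (\<lambda>i. v (f i))" by (auto simp: env_def g_def)
    ultimately show "sem s v (rename \<phi> g (k + 3)) = Q s (\<lambda>i. v (f i))"
      unfolding sat_rename[OF g] using \<phi>(3)[of s "\<lambda>i. v (f i)"] assms(2) by simp
  qed
qed

lemma fodef_eq: "i < k \<Longrightarrow> j < k \<Longrightarrow> fodef k (\<lambda>s v. v i = v j)"
  by (rule fodefI[of "Equal (i + 3) (j + 3)"]) (auto simp: env_def el_eq_iff[OF G_arith])

lemma fodef_changed:
  assumes "i < k" "j < 3"
  shows "fodef k (\<lambda>s v. v i = idx s (changed_of s ! j))"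
proof (rule fodefI[of "Equal (i + 3) j"])
  fix s v assume G: "G s" and v: "\<forall>i<k. v i < size_of s"
  have "el s (v i) = changed_of s ! j \<longleftrightarrow> v i = idx s (changed_of s ! j)"
    using idx_el[OF G_arith[OF G]] el_idx[OF G_arith[OF G] changed_in[OF G_arith[OF G] assms(2)]] v assms(1)
    by metis
  then show "sem s v (Equal (i + 3) j) = (v i = idx s (changed_of s ! j))"
    using assms by (simp add: env_def)
qed (use assms in auto)

lemma fodef_const: "fodef k (\<lambda>s v. b)"
proof -
  have 1: "fodef k (\<lambda>s v. True)" by (rule fodefI[of "Equal 0 0"]) auto
  show ?thesis
  proof (cases b)
    case False
    with fodef_neg[OF 1] show ?thesis by simp
  qed (use 1 in simp)
qed

lemma fodef_bex:
  "finite A \<Longrightarrow> (\<And>a. a \<in> A \<Longrightarrow> fodef k (Q a)) \<Longrightarrow> fodef k (\<lambda>s v. \<exists>a\<in>A. Q a s v)"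
  by (induction A rule: finite_induct) (auto simp: fodef_const fodef_disj)

lemma fodef_ball:
  assumes "finite A" "\<And>a. a \<in> A \<Longrightarrow> fodef k (Q a)" 
  shows "fodef k (\<lambda>s v. \<forall>a\<in>A. Q a s v)"
  using fodef_neg[OF fodef_bex[OF assms(1) fodef_neg[OF assms(2)]]] by simp

lemma fodef_less: "i < k \<Longrightarrow> j < k \<Longrightarrow> fodef k (\<lambda>s v. v i < v j)"
  by (rule fodefI[of "Atom (Inr Order) [i + 3, j + 3]"])
    (auto simp: env_def less_atom[OF G_arith] aux_syms_def)

lemma fodef_plus1: "i < k \<Longrightarrow> j < k \<Longrightarrow> l < k \<Longrightarrow> fodef k (\<lambda>s v. v i + v j + 1 = v l)"
  by (rule fodefI[of "Atom (Inr Plus) [i + 3, j + 3, l + 3]"])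
    (auto simp: env_def plus_atom[OF G_arith] aux_syms_def)

lemma fodef_times1: "i < k \<Longrightarrow> j < k \<Longrightarrow> l < k \<Longrightarrow> fodef k (\<lambda>s v. (v i + 1) * (v j + 1) = v l + 1)"
  by (rule fodefI[of "Atom (Inr Times) [i + 3, j + 3, l + 3]"])
    (auto simp: env_def times_atom[OF G_arith] aux_syms_def)

end

section \<open>Polynomial equations are definable\<close>

context fo
begin

text \<open>Polynomials with natural coefficients in the variables and the domain size. They are
  kept as functions because their values may exceed the domain and then are not denoted by any
  element.\<close>

inductive tm :: "nat \<Rightarrow> ('a state \<Rightarrow> (nat \<Rightarrow> nat) \<Rightarrow> nat) \<Rightarrow> bool" for k where
  tm_zero: "tm k (\<lambda>s v. 0)"
| tm_Suc: "tm k t \<Longrightarrow> tm k (\<lambda>s v. Suc (t s v))"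
| tm_var: "i < k \<Longrightarrow> tm k (\<lambda>s v. v i)"
| tm_size: "tm k (\<lambda>s v. size_of s)"
| tm_add: "tm k t \<Longrightarrow> tm k u \<Longrightarrow> tm k (\<lambda>s v. t s v + u s v)"
| tm_mult: "tm k t \<Longrightarrow> tm k u \<Longrightarrow> tm k (\<lambda>s v. t s v * u s v)"

lemma tm_one: "tm k (\<lambda>s v. 1)"
  using tm_Suc[OF tm_zero] by simp

lemma tm_power: "tm k t \<Longrightarrow> tm k (\<lambda>s v. t s v ^ j)"
  by (induction j) (auto intro: tm_one[simplified] tm_mult)

lemma tm_sum: "(\<And>j. j < l \<Longrightarrow> tm k (t j)) \<Longrightarrow> tm k (\<lambda>s v. \<Sum>j<(l::nat). t j s v)"
  by (induction l) (auto intro: tm_zero tm_add)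

lemma tm_local:
  assumes "tm k t" "size_of s = size_of s'" "\<And>i. i < k \<Longrightarrow> v i = w i"
  shows "t s v = t s' w"
  using assms by (induction rule: tm.induct) auto

text \<open>For domains of size at least 2, constant factors are absorbed by raising the
  exponent.\<close>

lemma tm_bound:
  "tm k t \<Longrightarrow> \<exists>K. \<forall>s v. 2 \<le> size_of s \<longrightarrow> (\<forall>i<k. v i < size_of s) \<longrightarrow> t s v < size_of s ^ K"
proof (induction rule: tm.induct)
  case (tm_Suc t)
  then obtain K where K: "\<And>s v. 2 \<le> size_of s \<Longrightarrow> (\<forall>i<k. v i < size_of s) \<Longrightarrow> t s v < size_of s ^ K"
    by blast
  have "Suc (t s v) < size_of s ^ Suc K" if "2 \<le> size_of s" "\<forall>i<k. v i < size_of s" for s v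
  proof -
    have "0 < size_of s ^ K" using that by simp
    then have "Suc (t s v) < 2 * size_of s ^ K" using K[OF that] by linarith
    also have "\<dots> \<le> size_of s * size_of s ^ K" using that by (intro mult_right_mono) auto
    finally show ?thesis by simp
  qed
  then show ?case by blast
next
  case (tm_var i)
  show ?case by (rule exI[of _ 1]) (use tm_var in simp)
next
  case tm_size
  show ?case by (rule exI[of _ 2]) (simp add: power2_eq_square)
next
  case (tm_add t u)
  then obtain K L where
    K: "\<And>s v. 2 \<le> size_of s \<Longrightarrow> (\<forall>i<k. v i < size_of s) \<Longrightarrow> t s v < size_of s ^ K" and
    L: "\<And>s v. 2 \<le> size_of s \<Longrightarrow> (\<forall>i<k. v i < size_of s) \<Longrightarrow> u s v < size_of s ^ L"
    by blast
  have "t s v + u s v < size_of s ^ Suc (max K L)" if a: "2 \<le> size_of s" "\<forall>i<k. v i < size_of s" for s v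
  proof -
    have "size_of s ^ K \<le> size_of s ^ max K L" "size_of s ^ L \<le> size_of s ^ max K L"
      using a by (auto intro!: power_increasing)
    then have "t s v + u s v < 2 * size_of s ^ max K L" using K[OF a] L[OF a] by linarith
    also have "\<dots> \<le> size_of s * size_of s ^ max K L" using a by (intro mult_right_mono) auto
    finally show ?thesis by simp
  qed
  then show ?case by blast
next
  case (tm_mult t u)
  then obtain K L where
    K: "\<And>s v. 2 \<le> size_of s \<Longrightarrow> (\<forall>i<k. v i < size_of s) \<Longrightarrow> t s v < size_of s ^ K" and
    L: "\<And>s v. 2 \<le> size_of s \<Longrightarrow> (\<forall>i<k. v i < size_of s) \<Longrightarrow> u s v < size_of s ^ L"
    by blast
  have "t s v * u s v < size_of s ^ (K + L)" if a: "2 \<le> size_of s" "\<forall>i<k. v i < size_of s" for s v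
    unfolding power_add using K[OF a] L[OF a] by (intro mult_strict_mono') auto
  then show ?case by blast
qed (auto intro: exI[of _ 0])

lemma fodef_zero: "i < k \<Longrightarrow> fodef k (\<lambda>s v. v i = 0)"
proof -
  assume "i < k"
  then have "fodef k (\<lambda>s v. \<not> (\<exists>x<size_of s. x < v i))"
    by (intro fodef_neg fodef_ex fodef_less) (auto simp: less_imp_neq)
  then show ?thesis
  proof (rule fodef_cong)
    fix s :: "'a state" and v :: "nat \<Rightarrow> nat" assume "\<forall>i<k. v i < size_of s"
    with \<open>i < k\<close> have "v i < size_of s" by blast
    then show "(\<not> (\<exists>x<size_of s. x < v i)) = (v i = 0)"
      by (metis gr_zeroI less_nat_zero_code less_trans)
  qed
qed

lemma fodef_succ: "i < k \<Longrightarrow> j < k \<Longrightarrow> fodef k (\<lambda>s v. v i + 1 = v j)"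
proof -
  let ?Q = "\<lambda>(s :: 'a state) v.
      v i < v j \<and> \<not> (\<exists>x<size_of s. v i < x \<and> x < v j)"
  assume ij: "i < k" "j < k"
  then have "fodef k ?Q"
    by (intro fodef_neg fodef_conj fodef_ex fodef_less) (auto simp: less_imp_neq)
  then show ?thesis
  proof (rule fodef_cong)
    fix s :: "'a state" and v :: "nat \<Rightarrow> nat" assume "\<forall>i<k. v i < size_of s"
    with ij have "v i < size_of s" "v j < size_of s" by auto
    then show "?Q s v = (v i + 1 = v j)"
      by (metis Suc_eq_plus1 Suc_lessI less_trans lessI not_less_eq)
  qed
qed

text \<open>Passing to the predecessor of \<open>v i\<close> absorbs the offset of 1 in
  \<open>fodef_plus1\<close>; 0 has no predecessor and is a separate case.\<close>

lemma fodef_plus: "i < k \<Longrightarrow> j < k \<Longrightarrow> l < k \<Longrightarrow> fodef k (\<lambda>s v. v i + v j = v l)"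
proof -
  let ?Q = "\<lambda>(s :: 'a state) v.
      v i = 0 \<and> v j = v l \<or> (\<exists>x<size_of s. x + 1 = v i \<and> x + v j + 1 = v l)"
  assume ij: "i < k" "j < k" "l < k"
  then have "fodef k ?Q"
    by (intro fodef_disj fodef_conj fodef_ex fodef_zero fodef_succ fodef_plus1 fodef_eq)
      (auto simp: less_imp_neq)
  then show ?thesis
  proof (rule fodef_cong)
    fix s :: "'a state" and v :: "nat \<Rightarrow> nat" assume "\<forall>i<k. v i < size_of s"
    with ij have "v i < size_of s" by auto
    then show "?Q s v = (v i + v j = v l)"
      by (cases "v i") auto
  qed
qed

lemma fodef_times: "i < k \<Longrightarrow> j < k \<Longrightarrow> l < k \<Longrightarrow> fodef k (\<lambda>s v. v i * v j = v l)"
proof -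
  let ?Q = "\<lambda>(s :: 'a state) v.
      (v i = 0 \<or> v j = 0) \<and> v l = 0 \<or>
      (\<exists>x<size_of s. \<exists>y<size_of s. \<exists>z<size_of s. x + 1 = v i \<and> y + 1 = v j \<and> z + 1 = v l \<and> (x + 1) * (y + 1) = z + 1)"
  assume ij: "i < k" "j < k" "l < k"
  then have "fodef k ?Q"
    by (intro fodef_disj fodef_conj fodef_ex fodef_zero fodef_succ fodef_times1 fodef_eq)
      (auto simp: less_imp_neq)
  then show ?thesis
  proof (rule fodef_cong)
    fix s :: "'a state" and v :: "nat \<Rightarrow> nat" assume "\<forall>i<k. v i < size_of s"
    with ij have "v i < size_of s" "v j < size_of s" "v l < size_of s" by auto
    then show "?Q s v = (v i * v j = v l)"
      by (cases "v i"; cases "v j"; cases "v l") auto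
  qed
qed

lemma fodef_value: "i < k \<Longrightarrow> fodef k (\<lambda>s v. v i = a)"
proof (induction a arbitrary: i k)
  case (Suc a)
  have "fodef k (\<lambda>s v. \<exists>x<size_of s. x = a \<and> x + 1 = v i)"
    using Suc by (intro fodef_ex fodef_conj Suc.IH fodef_succ) (auto simp: less_imp_neq)
  then show ?case by (rule fodef_cong) (use Suc in \<open>auto dest: Suc_lessD\<close>)
qed (rule fodef_zero)

lemma fodef_last: "i < k \<Longrightarrow> fodef k (\<lambda>s v. v i + 1 = size_of s)"
proof -
  assume i: "i < k"
  then have "fodef k (\<lambda>s v. \<not> (\<exists>x<size_of s. v i < x))"
    by (intro fodef_neg fodef_ex fodef_less) (auto simp: less_imp_neq)
  then show ?thesis
  proof (rule fodef_cong)
    fix s :: "'a state" and v :: "nat \<Rightarrow> nat" assume "\<forall>i<k. v i < size_of s"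
    with i have "v i < size_of s" by auto
    then show "(\<not> (\<exists>x<size_of s. v i < x)) = (v i + 1 = size_of s)"
      by (auto) (metis Suc_lessI lessI)
  qed
qed

lemma fodef_size: "fodef k (\<lambda>s v. size_of s = a)"
proof (cases a)
  case 0
  have "fodef k (\<lambda>s v. False)" by (rule fodef_const)
  then show ?thesis by (rule fodef_cong) (use 0 size_pos[OF G_arith] in auto)
next
  case (Suc b)
  have "fodef k (\<lambda>s v. \<exists>x<size_of s. x = b \<and> x + 1 = size_of s)"
    by (intro fodef_ex fodef_conj fodef_value fodef_last) auto
  then show ?thesis by (rule fodef_cong) (auto simp: Suc)
qed

text \<open>Below a fixed size there are finitely many sizes and valuations, and \<open>Q\<close>
  depends on nothing else; a finite disjunction lists those that satisfy it.\<close>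

lemma fodef_small_size:
  assumes "\<And>s s' v w. size_of s = size_of s' \<Longrightarrow> (\<And>i. i < k \<Longrightarrow> v i = w i) \<Longrightarrow> Q s v = Q s' w"
  shows "fodef k (\<lambda>s v. size_of s < n0 \<and> Q s v)"
proof (rule fodef_cong)
  let ?X = "\<lambda>a :: nat. {xs. set xs \<subseteq> {..<a} \<and> length xs = k}"
  let ?R = "\<lambda>a xs. \<forall>s :: 'a state. size_of s = a \<longrightarrow> Q s ((!) xs)"
  let ?Q = "\<lambda>(s :: 'a state) v.
      \<exists>a\<in>{..<n0}. size_of s = a \<and>
      (\<exists>xs\<in>?X a. ?R a xs \<and> (\<forall>i\<in>{..<k}. v i = xs ! i))"
  have "finite (?X a)" for a by (rule finite_lists_length_eq) simp
  then show "fodef k ?Q"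
    by (intro fodef_bex fodef_conj fodef_size fodef_const fodef_ball fodef_value) auto
  fix s :: "'a state" and v :: "nat \<Rightarrow> nat" assume v: "\<forall>i<k. v i < size_of s"
  have 1: "Q s v \<Longrightarrow> map v [0..<k] \<in> ?X (size_of s) \<and> ?R (size_of s) (map v [0..<k]) \<and> 
      (\<forall>i<k. v i = map v [0..<k] ! i)"
  proof -
    have "Q s' ((!) (map v [0..<k])) = Q s v" if "size_of s' = size_of s" for s'
      by (rule assms) (use that in auto)
    then show "Q s v \<Longrightarrow> map v [0..<k] \<in> ?X (size_of s) \<and> ?R (size_of s) (map v [0..<k]) \<and> 
      (\<forall>i<k. v i = map v [0..<k] ! i)"
      using v by auto
  qed
  have 2: "?R (size_of s) xs \<Longrightarrow> (\<forall>i\<in>{..<k}. v i = xs ! i) \<Longrightarrow> Q s v" for xs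
    using assms[of s s v "(!) xs"] by auto
  show "?Q s v = (size_of s < n0 \<and> Q s v)"
    (is "?l = ?r")
  proof
    assume ?l
    then show ?r using 2 by auto
  next
    assume ?r
    with 1 have "map v [0..<k] \<in> ?X (size_of s)" "?R (size_of s) (map v [0..<k])" 
      "(\<forall>i\<in>{..<k}. v i = map v [0..<k] ! i)" by auto
    with \<open>?r\<close> show ?l by blast
  qed
qed

text \<open>The number \<open>t\<close> may be far larger than the domain; only its residue is an
  element. The bound on \<open>x\<close> guarantees that sums and products of two residues are
  elements as well.\<close>

definition mod_rel :: "'a state \<Rightarrow> nat \<Rightarrow> nat \<Rightarrow> nat \<Rightarrow> bool" where
  "mod_rel s x t r \<longleftrightarrow> 0 < x \<and> x * x + x \<le> size_of s \<and> t mod x = r"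

lemma fodef_mod_domain: "i < k \<Longrightarrow> fodef k (\<lambda>s v. 0 < v i \<and> v i * v i + v i \<le> size_of s)"
proof -
  \<comment> \<open>The domain size is not the number of any element, so the bound is expressed by
    the existence of the element \<open>v i * v i + (v i - 1)\<close>.\<close>
  let ?Q = "\<lambda>(s :: 'a state) v.
      \<exists>y<size_of s. \<exists>z<size_of s. \<exists>w<size_of s. v i * v i = y \<and> z + 1 = v i \<and> y + z = w"
  assume i: "i < k"
  then have "fodef k ?Q"
    by (intro fodef_conj fodef_ex fodef_times fodef_succ fodef_plus) (auto simp: less_imp_neq)
  then show ?thesis
  proof (rule fodef_cong)
    fix s :: "'a state" and v :: "nat \<Rightarrow> nat" assume "\<forall>i<k. v i < size_of s"
    have "(\<exists>y<size_of s. \<exists>z<size_of s. \<exists>w<size_of s. v i * v i = y \<and> z + 1 = v i \<and> y + z = w) \<longleftrightarrow>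
      (\<exists>z. z + 1 = v i \<and> v i * v i + z < size_of s)" (is "?l = ?r")
    proof
      assume ?r
      then obtain z where z: "z + 1 = v i" "v i * v i + z < size_of s" by blast
      then have "z < size_of s" "v i * v i < size_of s" by linarith+
      with z show ?l by blast
    qed blast
    also have "\<dots> \<longleftrightarrow> (0 < v i \<and> v i * v i + v i \<le> size_of s)" by (cases "v i") auto
    finally show "?Q s v = (0 < v i \<and> v i * v i + v i \<le> size_of s)" .
  qed
qed

lemma mod_rel_Suc:
  assumes x: "x < size_of s"
  shows "mod_rel s x (Suc t) r \<longleftrightarrow>
     (\<exists>r1<size_of s. mod_rel s x t r1 \<and> (r1 + 1 = r \<and> r < x \<or> r1 + 1 = x \<and> r = 0))"
proof (cases "0 < x")
  case True
  then have "t mod x < x" by simp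
  then have "t mod x < x" "t mod x < size_of s" using x by auto
  then show ?thesis using True by (auto simp: mod_rel_def mod_Suc intro: Suc_lessI)
qed (auto simp: mod_rel_def)

lemma mod_rel_add:
  assumes "x < size_of s"
  shows "mod_rel s x (t + u) r \<longleftrightarrow>
     (\<exists>a<size_of s. \<exists>b<size_of s. mod_rel s x t a \<and> mod_rel s x u b \<and> r < x \<and>
        (a + b = r \<or> (\<exists>y<size_of s. r + x = y \<and> a + b = y)))"
proof (cases "0 < x \<and> x * x + x \<le> size_of s")
  case True
  define a b where "a = t mod x" and "b = u mod x"
  have ab: "a < x" "b < x" using True by (auto simp: a_def b_def)
  \<comment> \<open>From \<open>x <= x * x\<close>; hence a sum of two residues is still an
    element.\<close>
  have xx: "x + x \<le> size_of s" using True by (metis add_le_mono1 le_trans mult_le_mono1 nat_mult_1 Suc_leI One_nat_def)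
  have "(t + u) mod x = (a + b) mod x" by (simp add: a_def b_def mod_add_eq)
  also have "\<dots> = (if a + b < x then a + b else a + b - x)"
    using ab by (simp add: mod_if)
  finally have *: "(t + u) mod x = (if a + b < x then a + b else a + b - x)" .
  have "mod_rel s x (t + u) r \<longleftrightarrow> r < x \<and> (a + b = r \<or> a + b = r + x)"
    using True * ab by (auto simp: mod_rel_def)
  also have "\<dots> \<longleftrightarrow> (\<exists>a<size_of s. \<exists>b<size_of s. mod_rel s x t a \<and> mod_rel s x u b \<and> r < x \<and>
        (a + b = r \<or> (\<exists>y<size_of s. r + x = y \<and> a + b = y)))"
    using True assms ab xx by (auto simp: mod_rel_def a_def b_def)
  finally show ?thesis .
qed (auto simp: mod_rel_def)

text \<open>The product of two residues is below \<open>x * x\<close>, and the quotient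
  \<open>q\<close> and the multiple \<open>q * x\<close> do not exceed that product, so all numbers
  of the division stay inside the domain.\<close>

lemma mod_rel_mult:
  assumes "x < size_of s"
  shows "mod_rel s x (t * u) r \<longleftrightarrow>
     (\<exists>a<size_of s. \<exists>b<size_of s. mod_rel s x t a \<and> mod_rel s x u b \<and> r < x \<and>
        (\<exists>y<size_of s. \<exists>q<size_of s. \<exists>w<size_of s. a * b = y \<and> q * x = w \<and> w + r = y))"
proof (cases "0 < x \<and> x * x + x \<le> size_of s")
  case True
  define a b where "a = t mod x" and "b = u mod x"
  have ab: "a < x" "b < x" using True by (auto simp: a_def b_def)
  have "a * b < x * x" using ab by (intro mult_strict_mono') auto
  then have abn: "a * b < size_of s" using True by linarith
  have "(t * u) mod x = (a * b) mod x" by (simp add: a_def b_def mod_mult_eq)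
  then have "mod_rel s x (t * u) r \<longleftrightarrow> r < x \<and> (\<exists>q. q * x + r = a * b)"
    using True by (auto simp: mod_rel_def) (metis div_mult_mod_eq mod_less mod_mult_self3 add.commute)+
  also have "\<dots> \<longleftrightarrow> r < x \<and> (\<exists>y<size_of s. \<exists>q<size_of s. \<exists>w<size_of s. a * b = y \<and> q * x = w \<and> w + r = y)"
  proof (intro conj_cong refl iffI)
    assume "\<exists>q. q * x + r = a * b"
    then obtain q where q: "q * x + r = a * b" by blast
    have "q \<le> q * x" using True by simp
    with q abn have "q < size_of s" "q * x < size_of s" by linarith+
    with q abn show "\<exists>y<size_of s. \<exists>q<size_of s. \<exists>w<size_of s. a * b = y \<and> q * x = w \<and> w + r = y" by blast
  qed auto
  also have "\<dots> \<longleftrightarrow> (\<exists>a<size_of s. \<exists>b<size_of s. mod_rel s x t a \<and> mod_rel s x u b \<and> r < x \<and>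
        (\<exists>y<size_of s. \<exists>q<size_of s. \<exists>w<size_of s. a * b = y \<and> q * x = w \<and> w + r = y))"
  proof -
    have "mod_rel s x t a' \<longleftrightarrow> a' = a" "mod_rel s x u b' \<longleftrightarrow> b' = b" for a' b'
      using True by (auto simp: mod_rel_def a_def b_def)
    moreover have "a < size_of s" "b < size_of s" using ab assms by auto
    ultimately show ?thesis by auto
  qed
  finally show ?thesis .
qed (auto simp: mod_rel_def)

lemma fodef_mod_var:
  assumes "i < k" "j < k" "l < k"
  shows "fodef k (\<lambda>s v. mod_rel s (v i) (v l) (v j))"
proof (rule fodef_cong)
  let ?Q = "\<lambda>(s :: 'a state) v.
      (0 < v i \<and> v i * v i + v i \<le> size_of s) \<and>
      (\<exists>q<size_of s. \<exists>u<size_of s. q * v i = u \<and> u + v j = v l \<and> v j < v i)"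
  show "fodef k ?Q"
    by (rule fodef_conj[OF fodef_mod_domain])
      (intro fodef_conj fodef_ex fodef_times fodef_plus fodef_less | use assms in \<open>simp add: less_imp_neq\<close>)+
  fix s :: "'a state" and v :: "nat \<Rightarrow> nat" assume "\<forall>i<k. v i < size_of s"
  with assms have v: "v l < size_of s" by blast
  have "v l mod v i = v j \<longleftrightarrow> (\<exists>q<size_of s. \<exists>u<size_of s. q * v i = u \<and> u + v j = v l \<and> v j < v i)" (is "?l = ?r")
    if i: "0 < v i"
  proof
    assume ?l
    have "v l div v i * v i + v j = v l" using \<open>?l\<close> by (metis div_mult_mod_eq)
    moreover have "v l div v i < size_of s" using v by (meson div_le_dividend le_less_trans)
    moreover have "v j < v i" using \<open>?l\<close> i mod_less_divisor by metis
    moreover have "v l div v i * v i < size_of s" using v by (meson div_times_less_eq_dividend le_less_trans)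
    ultimately show ?r by blast
  next
    assume ?r
    then obtain q where q: "q * v i + v j = v l" "v j < v i" by blast
    from q(1)[symmetric] q(2)
    show ?l by simp
  qed
  then show "?Q s v = mod_rel s (v i) (v l) (v j)"
    by (auto simp: mod_rel_def)
qed

lemma fodef_mod_rel_Suc:
  assumes t: "\<And>k' i j. k \<le> k' \<Longrightarrow> i < k' \<Longrightarrow> j < k' \<Longrightarrow> fodef k' (\<lambda>s v. mod_rel s (v i) (t s v) (v j))"
    and loc: "\<And>m s v x. k \<le> m \<Longrightarrow> t s (v(m := x)) = t s v"
    and k': "k \<le> k'" "i < k'" "j < k'"
  shows "fodef k' (\<lambda>s v. mod_rel s (v i) (Suc (t s v)) (v j))"
proof (rule fodef_cong)
  show "fodef k' (\<lambda>s v. \<exists>r1<size_of s. mod_rel s (v i) (t s v) r1 \<and>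
       (r1 + 1 = v j \<and> v j < v i \<or> r1 + 1 = v i \<and> v j = 0))"
    by (intro fodef_ex fodef_conj fodef_disj t fodef_succ fodef_less fodef_zero)
      (use k' in \<open>simp_all add: loc less_imp_neq\<close>)
qed (use k' in \<open>subst mod_rel_Suc, auto\<close>)

lemma tm_upd: "tm k t \<Longrightarrow> k \<le> m \<Longrightarrow> t s (v(m := x)) = t s v"
  by (erule tm_local) auto

text \<open>Induction on the polynomial, residue by residue. The general \<open>k'\<close> keeps the
  induction hypotheses usable under the quantifiers that the cases of sums and products
  introduce.\<close>

lemma fodef_mod_rel:
  "tm k t \<Longrightarrow> k \<le> k' \<Longrightarrow> i < k' \<Longrightarrow> j < k' \<Longrightarrow> fodef k' (\<lambda>s v. mod_rel s (v i) (t s v) (v j))"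
proof (induction arbitrary: k' i j rule: tm.induct)
  case tm_zero
  have "fodef k' (\<lambda>s v. (0 < v i \<and> v i * v i + v i \<le> size_of s) \<and> v j = 0)"
    by (intro fodef_conj[OF fodef_mod_domain] fodef_zero tm_zero)
  then show ?case by (rule fodef_cong) (auto simp: mod_rel_def)
next
  case (tm_Suc t)
  show ?case by (rule fodef_mod_rel_Suc[of k]) (rule tm_Suc tm_upd[OF tm_Suc.hyps] | assumption)+
next
  case (tm_var l)
  then show ?case by (intro fodef_mod_var) auto
next
  case tm_size
  have "fodef k' (\<lambda>s v. \<exists>x<size_of s. x + 1 = size_of s \<and> mod_rel s (v i) (Suc x) (v j))"
  proof (rule fodef_ex, rule fodef_conj[OF fodef_last])
    show "fodef (Suc k') (\<lambda>s v. mod_rel s (v i) (Suc (v k')) (v j))"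
      by (rule fodef_mod_rel_Suc[of "Suc k'" "\<lambda>s v. v k'"])
        (use tm_size in \<open>auto intro!: fodef_mod_var simp: less_imp_neq\<close>)
  qed (use tm_size in \<open>auto simp: less_imp_neq\<close>)
  then show ?case
    by (rule fodef_cong) (metis G_arith Suc_eq_plus1 Suc_pred' lessI size_pos)
next
  case (tm_add t u)
  note IH = tm_add.IH
  have "fodef k' (\<lambda>s v. \<exists>a<size_of s. \<exists>b<size_of s. mod_rel s (v i) (t s v) a \<and> mod_rel s (v i) (u s v) b \<and>
     v j < v i \<and> (a + b = v j \<or> (\<exists>y<size_of s. v j + v i = y \<and> a + b = y)))"
    by (intro fodef_ex fodef_conj fodef_disj IH fodef_plus fodef_less)
      (use tm_add in \<open>simp_all add: tm_upd less_imp_neq\<close>)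
  then show ?case by (rule fodef_cong) (use tm_add.prems in \<open>subst mod_rel_add, auto\<close>)
next
  case (tm_mult t u)
  note IH = tm_mult.IH
  have "fodef k' (\<lambda>s v. \<exists>a<size_of s. \<exists>b<size_of s. mod_rel s (v i) (t s v) a \<and> mod_rel s (v i) (u s v) b \<and>
     v j < v i \<and> (\<exists>y<size_of s. \<exists>q<size_of s. \<exists>w<size_of s. a * b = y \<and> q * v i = w \<and> w + v j = y))"
    by (intro fodef_ex fodef_conj fodef_disj IH fodef_plus fodef_times fodef_less)
      (use tm_mult in \<open>simp_all add: tm_upd less_imp_neq\<close>)
  then show ?case by (rule fodef_cong) (use tm_mult.prems in \<open>subst mod_rel_mult, auto\<close>)
qed

text \<open>Both values are below a fixed power of the size, so from some size \<open>n0\<close> on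
  admissible moduli separate different values; the smaller sizes are settled by enumeration.\<close>

lemma fodef_tm_eq:
  assumes t: "tm k t" and u: "tm k u"
  shows "fodef k (\<lambda>s v. t s v = u s v)"
proof -
  from tm_bound[OF t] obtain K where
    K: "\<And>s v. 2 \<le> size_of s \<Longrightarrow> (\<forall>i<k. v i < size_of s) \<Longrightarrow> t s v < size_of s ^ K" by blast
  from tm_bound[OF u] obtain L where
    L: "\<And>s v. 2 \<le> size_of s \<Longrightarrow> (\<forall>i<k. v i < size_of s) \<Longrightarrow> u s v < size_of s ^ L" by blast
  obtain n0 where n0: "\<And>n x y. n0 \<le> n \<Longrightarrow> x \<noteq> y \<Longrightarrow> x < n ^ max K L \<Longrightarrow> y < n ^ max K L \<Longrightarrow>
     (\<exists>i>0. i * i + i \<le> n \<and> x mod i \<noteq> (y mod i :: nat))"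
    using exists_modulus_neq by metis
  let ?n = "max n0 2"
  let ?Q = "\<lambda>(s :: 'a state) v.
      (size_of s < ?n \<and> t s v = u s v) \<or> (\<not> (\<exists>a\<in>{..<?n}. size_of s = a) \<and>
      (\<forall>x<size_of s. (0 < x \<and> x * x + x \<le> size_of s) \<longrightarrow>
      (\<exists>r<size_of s. mod_rel s x (t s v) r \<and> mod_rel s x (u s v) r)))"
  have "fodef k ?Q"
  proof (rule fodef_disj, rule fodef_small_size)
    show "(t s v = u s v) = (t s' w = u s' w)" if "size_of s = size_of s'" "\<And>i. i < k \<Longrightarrow> v i = w i" for s s' v w
      using tm_local[OF t that] tm_local[OF u that] by simp
    show "fodef k (\<lambda>s v. (\<not> (\<exists>a\<in>{..<?n}. size_of s = a) \<and>
      (\<forall>x<size_of s. (0 < x \<and> x * x + x \<le> size_of s) \<longrightarrow>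
         (\<exists>r<size_of s. mod_rel s x (t s v) r \<and> mod_rel s x (u s v) r))))"
      by (intro fodef_conj fodef_neg fodef_bex fodef_size fodef_all fodef_imp[OF fodef_mod_domain] fodef_ex
          fodef_mod_rel[OF t] fodef_mod_rel[OF u])
       (simp_all add: tm_upd[OF t] tm_upd[OF u])
  qed
  then show ?thesis
  proof (rule fodef_cong)
    fix s :: "'a state" and v :: "nat \<Rightarrow> nat" assume G: "G s" and v: "\<forall>i<k. v i < size_of s"
    have *: "(\<forall>x<size_of s. (0 < x \<and> x * x + x \<le> size_of s) \<longrightarrow>
         (\<exists>r<size_of s. mod_rel s x (t s v) r \<and> mod_rel s x (u s v) r)) \<longleftrightarrow>
        (\<forall>x>0. x * x + x \<le> size_of s \<longrightarrow> t s v mod x = u s v mod x)" (is "?l = ?r")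
    proof
      assume l: ?l
      show ?r
      proof (intro allI impI)
        fix x :: nat assume x: "0 < x" "x * x + x \<le> size_of s"
        then have "x < size_of s" by (metis add_strict_increasing le_refl less_le_trans mult_pos_pos add.commute)
        then show "t s v mod x = u s v mod x" using l x by (auto simp: mod_rel_def)
      qed
    next
      assume r: ?r
      show ?l
      proof (intro allI impI)
        fix x :: nat assume x: "x < size_of s" "0 < x \<and> x * x + x \<le> size_of s"
        then have "t s v mod x < size_of s" by (meson less_trans mod_less_divisor)
        then show "\<exists>r<size_of s. mod_rel s x (t s v) r \<and> mod_rel s x (u s v) r"
          using r x by (auto simp: mod_rel_def)
      qed
    qed
    have that: "t s v = u s v" if ge: "?n \<le> size_of s" and r: "\<forall>x>0. x * x + x \<le> size_of s \<longrightarrow> t s v mod x = u s v mod x"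
    proof (rule ccontr)
      assume "t s v \<noteq> u s v"
      have "size_of s ^ K \<le> size_of s ^ max K L" "size_of s ^ L \<le> size_of s ^ max K L"
        using ge by (auto intro!: power_increasing)
      then have "t s v < size_of s ^ max K L" "u s v < size_of s ^ max K L"
        using K[OF _ v] L[OF _ v] ge by (auto intro: less_le_trans)
      then show False using n0[of "size_of s" "t s v" "u s v"] \<open>t s v \<noteq> u s v\<close> ge r by auto
    qed
    then show "?Q s v = (t s v = u s v)"
    proof (cases "size_of s < ?n")
      case False
      then have n: "?n \<le> size_of s" "\<not> (\<exists>a\<in>{..<?n}. size_of s = a)" by auto
      have "(\<forall>x>0. x * x + x \<le> size_of s \<longrightarrow> t s v mod x = u s v mod x) \<longleftrightarrow> t s v = u s v"
        by (rule iffI, erule that[OF n(1)], simp)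
      with n False show ?thesis unfolding * by (simp only: simp_thms)
    next
      case True
      then have "\<exists>a\<in>{..<?n}. size_of s = a" by (intro bexI[of _ "size_of s"]) simp_all
      with True show ?thesis by (simp only: simp_thms)
    qed
  qed
qed

end

section \<open>Numbers with several digits\<close>

text \<open>Numbers below \<open>n ^ width\<close>, where \<open>n\<close> is the size of the domain, are represented by \<open>width\<close>
  digits in base \<open>n\<close>, least significant digit first. The \<open>i\<close>-th number of an environment \<open>v\<close> has the
  digits \<open>v (i * width), \<dots>, v (i * width + width - 1)\<close>.\<close>

definition width :: nat where "width = 10" \<comment> \<open>the exponent in \<open>exists_prime_not_dvd\<close>\<close>

definition range_of :: "'a state \<Rightarrow> nat" where
  "range_of s = size_of s ^ width"

definition num :: "'a state \<Rightarrow> (nat \<Rightarrow> nat) \<Rightarrow> nat \<Rightarrow> nat" where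
  "num s v i = (\<Sum>j<width. v (i * width + j) * size_of s ^ j)"

lemma sum_digits:
  fixes n x :: nat
  shows "(\<Sum>j<k. (x div n ^ j mod n) * n ^ j) = x mod n ^ k"
proof (induction k)
  case (Suc k)
  have "x mod n ^ Suc k = n ^ k * (x div n ^ k mod n) + x mod n ^ k"
    by (simp add: mod_mult2_eq mult.commute[of n])
  then show ?case using Suc by (simp add: mult.commute)
qed simp

lemma sum_digits_less:
  fixes n :: nat
  assumes "0 < n" "\<And>j. j < k \<Longrightarrow> d j < n"
  shows "(\<Sum>j<k. d j * n ^ j) < n ^ k"
  using assms(2)
proof (induction k)
  case (Suc k)
  have "(\<Sum>j<k. d j * n ^ j) < n ^ k" using Suc by simp
  moreover have "Suc (d k) * n ^ k \<le> n * n ^ k" using Suc(2)[of k] by (intro mult_right_mono) auto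
  ultimately show ?case by simp
qed simp

lemma num_less: "0 < size_of s \<Longrightarrow> (\<And>j. j < width \<Longrightarrow> v (i * width + j) < size_of s) \<Longrightarrow> num s v i < range_of s"
  unfolding num_def range_of_def by (rule sum_digits_less)

context fo
begin

text \<open>Hides the digits: the closure rules of \<open>fodef\<close> are repeated for whole
  numbers, and later definability proofs use only these.\<close>

definition bdef :: "nat \<Rightarrow> ('a state \<Rightarrow> (nat \<Rightarrow> nat) \<Rightarrow> bool) \<Rightarrow> bool" where
  "bdef k Q \<longleftrightarrow> fodef (k * width) (\<lambda>s v. Q s (num s v))"

lemma index_less: "i < k \<Longrightarrow> j < width \<Longrightarrow> i * width + j < k * width"
  by (metis add.commute less_mult_imp_div_less div_mult_self3 add_less_cancel_left
      mult_Suc Suc_leI mult_le_mono1 less_le_trans)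

lemma num_in_range:
  assumes "G s" "\<forall>i<k * width. v i < size_of s" "i < k"
  shows "num s v i < range_of s"
  using assms index_less by (intro num_less) (auto intro: size_pos[OF G_arith])

lemma bdef_cong:
  assumes "bdef k Q" "\<And>s m. G s \<Longrightarrow> \<forall>i<k. m i < range_of s \<Longrightarrow> Q s m = R s m"
  shows "bdef k R"
  using assms(1) unfolding bdef_def by (rule fodef_cong) (use assms(2) num_in_range in blast)

lemma bdef_neg: "bdef k Q \<Longrightarrow> bdef k (\<lambda>s m. \<not> Q s m)"
  unfolding bdef_def by (rule fodef_neg)

lemma bdef_conj: "bdef k Q \<Longrightarrow> bdef k R \<Longrightarrow> bdef k (\<lambda>s m. Q s m \<and> R s m)"
  unfolding bdef_def by (rule fodef_conj)

lemma bdef_disj: "bdef k Q \<Longrightarrow> bdef k R \<Longrightarrow> bdef k (\<lambda>s m. Q s m \<or> R s m)"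
  unfolding bdef_def by (rule fodef_disj)

lemma bdef_imp: "bdef k Q \<Longrightarrow> bdef k R \<Longrightarrow> bdef k (\<lambda>s m. Q s m \<longrightarrow> R s m)"
  unfolding bdef_def by (rule fodef_imp)

lemma bdef_iff: "bdef k Q \<Longrightarrow> bdef k R \<Longrightarrow> bdef k (\<lambda>s m. Q s m \<longleftrightarrow> R s m)"
  unfolding bdef_def by (rule fodef_iff)

lemma bdef_const: "bdef k (\<lambda>s m. b)"
  unfolding bdef_def by (rule fodef_const)

lemma tm_num: "i < k \<Longrightarrow> tm (k * width) (\<lambda>s v. num s v i)"
  unfolding num_def by (intro tm_sum tm_mult tm_power tm_var tm_size index_less)

lemma tm_mono: "tm k t \<Longrightarrow> k \<le> l \<Longrightarrow> tm l t"
  by (induction rule: tm.induct) (auto intro: tm.intros)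

lemma tm_subst_num: "tm k t \<Longrightarrow> tm (k * width) (\<lambda>s v. t s (num s v))"
  by (induction rule: tm.induct) (auto intro: tm.intros tm_num)

text \<open>A number is itself a polynomial in its digits and the domain size, so
  \<open>fodef_tm_eq\<close> applies directly and no carries have to be handled.\<close>

lemma bdef_eq: "tm k t \<Longrightarrow> tm k u \<Longrightarrow> bdef k (\<lambda>s m. t s m = u s m)"
  unfolding bdef_def by (intro fodef_tm_eq tm_subst_num)

lemma fodef_exists_block:
  "fodef (k + l) Q \<Longrightarrow>
     fodef k (\<lambda>s v. \<exists>w. (\<forall>j<l. w j < size_of s) \<and> Q s (\<lambda>i. if k \<le> i \<and> i < k + l then w (i - k) else v i))"
proof (induction l arbitrary: Q)
  case 0
  have "(\<lambda>i. if k \<le> i \<and> i < k + 0 then w (i - k) else v i) = v" for w v :: "nat \<Rightarrow> nat" by auto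
  with 0 show ?case by simp
next
  case (Suc l)
  from Suc.prems have "fodef (Suc (k + l)) Q" by simp
  from Suc.IH[OF fodef_exists_upd[OF this]] show ?case
  proof (rule fodef_cong)
    fix s :: "'a state" and v :: "nat \<Rightarrow> nat"
    let ?e = "\<lambda>l w i. if k \<le> i \<and> i < k + l then w (i - k) else v i"
    have 1: "(?e l w)(k + l := x) = ?e (Suc l) (w(l := x))" for w x
      by (rule ext) auto
    have 2: "?e (Suc l) w = (?e l w)(k + l := w l)" for w
      by (rule ext) auto
    show "(\<exists>w. (\<forall>j<l. w j < size_of s) \<and> (\<exists>x<size_of s. Q s ((?e l w)(k + l := x)))) =
      (\<exists>w. (\<forall>j<Suc l. w j < size_of s) \<and> Q s (?e (Suc l) w))"
    proof
      assume "\<exists>w. (\<forall>j<l. w j < size_of s) \<and> (\<exists>x<size_of s. Q s ((?e l w)(k + l := x)))"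
      then obtain w x where w: "\<forall>j<l. w j < size_of s" "x < size_of s" "Q s ((?e l w)(k + l := x))" by blast
      then show "\<exists>w. (\<forall>j<Suc l. w j < size_of s) \<and> Q s (?e (Suc l) w)"
        unfolding 1 by (intro exI[of _ "w(l := x)"]) (auto simp: less_Suc_eq)
    next
      assume "\<exists>w. (\<forall>j<Suc l. w j < size_of s) \<and> Q s (?e (Suc l) w)"
      then show "\<exists>w. (\<forall>j<l. w j < size_of s) \<and> (\<exists>x<size_of s. Q s ((?e l w)(k + l := x)))"
        unfolding 2 by (elim exE) (rule_tac x = w in exI, auto simp del: fun_upd_apply)
    qed
  qed
qed

lemma bdef_ex:
  assumes "bdef (Suc k) (\<lambda>s m. Q s m (m k))" "\<And>s m x y. Q s (m(k := x)) y = Q s m y"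
  shows "bdef k (\<lambda>s m. \<exists>x<range_of s. Q s m x)"
  unfolding bdef_def
proof (rule fodef_cong)
  let ?k = "k * width"
  let ?e = "\<lambda>v w i. if ?k \<le> i \<and> i < ?k + width then w (i - ?k) else v i"
  let ?Q = "\<lambda>(s :: 'a state) v.
      \<exists>w. (\<forall>j<width. w j < size_of s) \<and> Q s (num s (?e v w)) (num s (?e v w) k)"
  show "fodef ?k ?Q"
    by (rule fodef_exists_block) (use assms(1) in \<open>simp add: bdef_def add.commute\<close>)
  fix s :: "'a state" and v :: "nat \<Rightarrow> nat" assume G: "G s"
  have *: "num s (?e v w) = (num s v)(k := \<Sum>j<width. w j * size_of s ^ j)" for w
  proof (rule ext)
    fix i
    show "num s (?e v w) i = ((num s v)(k := \<Sum>j<width. w j * size_of s ^ j)) i"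
    proof (cases "i = k")
      case False
      have "\<not> (?k \<le> i * width + j \<and> i * width + j < ?k + width)" if "j < width" for j
      proof
        assume "?k \<le> i * width + j \<and> i * width + j < ?k + width"
        then have "(i * width + j) div width = k" using that
          by (intro div_nat_eqI) (auto simp: algebra_simps)
        then show False using False that by simp
      qed
      then have "num s (?e v w) i = num s v i"
        unfolding num_def by (intro sum.cong refl arg_cong2[where f = "(*)"]) (metis lessThan_iff)+
      with False show ?thesis by simp
    qed (simp add: num_def)
  qed
  show "?Q s v = (\<exists>x<range_of s. Q s (num s v) x)" (is "?l = ?r")
  proof
    assume ?l
    then obtain w where w: "\<forall>j<width. w j < size_of s" "Q s (num s (?e v w)) (num s (?e v w) k)" by blast
    have "(\<Sum>j<width. w j * size_of s ^ j) < range_of s"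
      unfolding range_of_def using w size_pos[OF G_arith[OF G]] by (intro sum_digits_less) auto
    with w(2) show ?r unfolding * assms(2) by auto
  next
    assume ?r
    then obtain x where x: "x < range_of s" "Q s (num s v) x" by blast
    let ?w = "\<lambda>j. x div size_of s ^ j mod size_of s"
    have "(\<Sum>j<width. ?w j * size_of s ^ j) = x"
      using x(1) by (simp add: sum_digits range_of_def)
    then have "Q s (num s (?e v ?w)) (num s (?e v ?w) k)"
      unfolding *[of ?w] assms(2) using x(2) by simp
    moreover have "\<forall>j<width. ?w j < size_of s" using size_pos[OF G_arith[OF G]] by simp
    ultimately show ?l by (intro exI[of _ ?w]) blast
  qed
qed

lemma bdef_all:
  assumes "bdef (Suc k) (\<lambda>s m. Q s m (m k))" "\<And>s m x y. Q s (m(k := x)) y = Q s m y"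
  shows "bdef k (\<lambda>s m. \<forall>x<range_of s. Q s m x)"
proof (rule bdef_cong)
  show "bdef k (\<lambda>s m. \<not> (\<exists>x<range_of s. \<not> Q s m x))"
    by (intro bdef_neg bdef_ex) (auto simp: assms)
qed auto

lemma bdef_rename:
  assumes "bdef r Q" "\<And>i. i < r \<Longrightarrow> f i < k"
  shows "bdef k (\<lambda>s m. Q s (\<lambda>i. m (f i)))"
proof -
  define g where "g t = f (t div width) * width + t mod width" for t
  have "fodef (k * width) (\<lambda>s v. Q s (num s (\<lambda>i. v (g i))))"
  proof (rule fodef_rename[where r = "r * width" and Q = "\<lambda>s v. Q s (num s v)"])
    fix i assume "i < r * width"
    then have "i div width < r" by (simp add: less_mult_imp_div_less)
    then show "g i < k * width"
      unfolding g_def using assms(2) by (intro index_less) (auto simp: width_def)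
  qed (use assms(1) in \<open>simp add: bdef_def\<close>)
  moreover have "num s (\<lambda>i. v (g i)) = (\<lambda>i. num s v (f i))" for s :: "'a state" and v
    by (rule ext) (simp add: num_def g_def)
  ultimately show ?thesis by (simp add: bdef_def)
qed

lemma bdef_rename2: "bdef 2 (\<lambda>s m. Q s (m 0) (m 1)) \<Longrightarrow> i < k \<Longrightarrow> j < k \<Longrightarrow> bdef k (\<lambda>s m. Q s (m i) (m j))"
  by (drule bdef_rename[where f = "(!) [i, j]" and k = k]) (auto simp: less_Suc_eq numeral_eq_Suc)

lemma bdef_rename3:
  "bdef 3 (\<lambda>s m. Q s (m 0) (m 1) (m 2)) \<Longrightarrow> i < k \<Longrightarrow> j < k \<Longrightarrow> l < k \<Longrightarrow> bdef k (\<lambda>s m. Q s (m i) (m j) (m l))"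
  by (drule bdef_rename[where f = "(!) [i, j, l]" and k = k]) (auto simp: less_Suc_eq numeral_eq_Suc)

lemma bdef_rename4:
  "bdef 4 (\<lambda>s m. Q s (m 0) (m 1) (m 2) (m 3)) \<Longrightarrow> i < k \<Longrightarrow> j < k \<Longrightarrow> l < k \<Longrightarrow> q < k \<Longrightarrow>
     bdef k (\<lambda>s m. Q s (m i) (m j) (m l) (m q))"
  by (drule bdef_rename[where f = "(!) [i, j, l, q]" and k = k]) (auto simp: less_Suc_eq numeral_eq_Suc)

lemma size_le_range: "G s \<Longrightarrow> size_of s \<le> range_of s"
  unfolding range_of_def width_def using size_pos[OF G_arith, of s] by (intro self_le_power) auto

text \<open>A slack variable turns the inequality into an equation; the slack is in range because
  \<open>m i\<close> is.\<close>

lemma bdef_less_var: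
  assumes "tm k t" "i < k"
  shows "bdef k (\<lambda>s m. t s m < m i)"
proof (rule bdef_cong)
  show "bdef k (\<lambda>s m. \<exists>x<range_of s. t s m + x + 1 = m i)"
  proof (rule bdef_ex, rule bdef_eq)
    show "tm (Suc k) (\<lambda>s m. t s m + m k + 1)"
      by (intro tm_add tm_one tm_var tm_mono[OF assms(1)]) auto
    show "tm (Suc k) (\<lambda>s m. m i)" using assms by (intro tm_var) auto
    have "(m(k := x)) i = m i" for m :: "nat \<Rightarrow> nat" and x using assms by auto
    then show "(t s (m(k := x)) + y + 1 = (m(k := x)) i) = (t s m + y + 1 = m i)" for s m x y
      by (simp only: tm_upd[OF assms(1) le_refl])
  qed
  fix s :: "'a state" and m :: "nat \<Rightarrow> nat" assume "\<forall>i<k. m i < range_of s"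
  then have "m i < range_of s" using assms by blast
  then show "(\<exists>x<range_of s. t s m + x + 1 = m i) = (t s m < m i)"
  proof (intro iffI)
    assume "t s m < m i"
    with \<open>m i < range_of s\<close> have "t s m + (m i - t s m - 1) + 1 = m i" "m i - t s m - 1 < range_of s"
      by linarith+
    then show "\<exists>x<range_of s. t s m + x + 1 = m i" by blast
  qed auto
qed

lemma bdef_less_size:
  assumes "tm k t"
  shows "bdef k (\<lambda>s m. t s m < size_of s)"
proof (rule bdef_cong)
  show "bdef k (\<lambda>s m. \<exists>x<range_of s. t s m + x + 1 = size_of s)"
  proof (rule bdef_ex, rule bdef_eq)
    show "tm (Suc k) (\<lambda>s m. t s m + m k + 1)"
      by (intro tm_add tm_one tm_var tm_mono[OF assms(1)]) auto
    show "(t s (m(k := x)) + y + 1 = size_of s) = (t s m + y + 1 = size_of s)" for s m x y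
      by (simp only: tm_upd[OF assms(1) le_refl])
  qed (rule tm_size)
  fix s :: "'a state" and m :: "nat \<Rightarrow> nat" assume "G s"
  then show "(\<exists>x<range_of s. t s m + x + 1 = size_of s) = (t s m < size_of s)"
  proof (intro iffI)
    assume "t s m < size_of s"
    with size_le_range[OF \<open>G s\<close>]
    have "t s m + (size_of s - t s m - 1) + 1 = size_of s" "size_of s - t s m - 1 < range_of s"
      by linarith+
    then show "\<exists>x<range_of s. t s m + x + 1 = size_of s" by blast
  qed auto
qed

lemma bdef_changed:
  assumes "i < k" "j < 3"
  shows "bdef k (\<lambda>s m. m i = idx s (changed_of s ! j))"
  unfolding bdef_def
proof (rule fodef_cong)
  let ?Q = "\<lambda>(s :: 'a state) v.
      \<exists>x<size_of s. x = idx s (changed_of s ! j) \<and> num s v i = x"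
  show "fodef (k * width) ?Q"
  proof (rule fodef_ex, rule fodef_conj)
    show "fodef (Suc (k * width)) (\<lambda>s v. num s v i = v (k * width))"
      by (intro fodef_tm_eq tm_var tm_mono[OF tm_num[OF assms(1)]]) auto
    have "num s (v(k * width := x)) i = num s v i" for s :: "'a state" and v x
      using tm_upd[OF tm_num[OF assms(1)], of "k * width" s v x] by simp
    then show "(y = idx s (changed_of s ! j) \<and> num s (v(k * width := x)) i = y) =
       (y = idx s (changed_of s ! j) \<and> num s v i = y)" for s :: "'a state" and v x y
      by simp
  qed (use assms in \<open>auto intro: fodef_changed\<close>)
  show "?Q s v = (num s v i = idx s (changed_of s ! j))"
    if "G s" for s :: "'a state" and v
    using idx_less[OF G_arith changed_in, OF that G_arith[OF that] assms(2)] by auto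
qed

end

section \<open>Column operations modulo a prime\<close>

type_synonym entries = "nat \<Rightarrow> nat \<Rightarrow> nat"

text \<open>A division-free description of - C i0 j / C i0 j0 modulo \<open>p\<close>. The least
  solution is 0 wherever row \<open>i0\<close> is 0 already.\<close>

definition coef :: "nat \<Rightarrow> entries \<Rightarrow> nat \<Rightarrow> nat \<Rightarrow> nat \<Rightarrow> nat" where
  "coef p C i0 j0 j = (LEAST l. p dvd l * C i0 j0 + C i0 j)"

text \<open>The column operations that clear row \<open>i0\<close> of \<open>C\<close> outside column \<open>j0\<close>, applied to \<open>W\<close>.\<close>

definition elim :: "nat \<Rightarrow> entries \<Rightarrow> nat \<Rightarrow> nat \<Rightarrow> entries \<Rightarrow> nat \<Rightarrow> nat \<Rightarrow> nat" where
  "elim p C i0 j0 W i j = (if j = j0 then W i j else (W i j + coef p C i0 j0 j * W i j0) mod p)"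

text \<open>The lexicographic minimum is a canonical pivot position that a first-order formula can
  single out.\<close>

definition first_pair :: "nat \<Rightarrow> (nat \<Rightarrow> nat \<Rightarrow> bool) \<Rightarrow> nat \<Rightarrow> nat \<Rightarrow> bool" where
  "first_pair n S i j \<longleftrightarrow> i < n \<and> j < n \<and> S i j \<and>
     (\<forall>i'<n. \<forall>j'<n. S i' j' \<longrightarrow> i < i' \<or> i = i' \<and> j \<le> j')"

definition pivot :: "nat \<Rightarrow> nat \<Rightarrow> (nat \<Rightarrow> nat \<Rightarrow> bool) \<Rightarrow> entries \<Rightarrow> entries \<Rightarrow> nat \<Rightarrow> nat \<Rightarrow> nat" where
  "pivot n p S C W =
     (if \<exists>i j. first_pair n S i j
      then elim p C (fst (SOME (i, j). first_pair n S i j)) (snd (SOME (i, j). first_pair n S i j)) W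
      else W)"

lemma first_pair_unique: "first_pair n S i j \<Longrightarrow> first_pair n S i' j' \<Longrightarrow> i = i' \<and> j = j'"
  unfolding first_pair_def by (metis le_antisym less_asym less_irrefl)

lemma first_pair_exists:
  assumes "i < n" "j < n" "S i j"
  shows "\<exists>i j. first_pair n S i j"
proof -
  define i0 where "i0 = (LEAST i. i < n \<and> (\<exists>j<n. S i j))"
  have i0: "i0 < n \<and> (\<exists>j<n. S i0 j)" "\<And>i. i < n \<and> (\<exists>j<n. S i j) \<Longrightarrow> i0 \<le> i"
    unfolding i0_def using assms LeastI[of "\<lambda>i. i < n \<and> (\<exists>j<n. S i j)" i] by (auto intro: Least_le)
  define j0 where "j0 = (LEAST j. j < n \<and> S i0 j)"
  from i0 obtain j1 where "j1 < n \<and> S i0 j1" by blast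
  then have j0: "j0 < n \<and> S i0 j0" "\<And>j. j < n \<and> S i0 j \<Longrightarrow> j0 \<le> j"
    unfolding j0_def by (rule LeastI, auto intro: Least_le)
  have "first_pair n S i0 j0"
    unfolding first_pair_def using i0 j0 by (metis le_neq_implies_less)
  then show ?thesis by blast
qed

lemma pivot_first:
  assumes "first_pair n S i j"
  shows "pivot n p S C W = elim p C i j W"
proof -
  have "first_pair n S (fst (SOME (i, j). first_pair n S i j)) (snd (SOME (i, j). first_pair n S i j))"
    using someI[of "\<lambda>(i, j). first_pair n S i j" "(i, j)"] assms by (simp add: case_prod_beta)
  with assms show ?thesis unfolding pivot_def using first_pair_unique by metis
qed

lemma pivot_cases:
  obtains (none) "\<And>i j. i < n \<Longrightarrow> j < n \<Longrightarrow> \<not> S i j" "\<And>C W. pivot n p S C W = W"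
  | (pair) i j where "i < n" "j < n" "S i j" "\<And>C W. pivot n p S C W = elim p C i j W"
proof (cases "\<exists>i j. first_pair n S i j")
  case True
  then obtain i j where "first_pair n S i j" by blast
  with pair pivot_first show ?thesis unfolding first_pair_def by metis
next
  case False
  with none first_pair_exists show ?thesis unfolding pivot_def by metis
qed

definition image_rel :: "nat \<Rightarrow> nat \<Rightarrow> (nat \<Rightarrow> nat \<Rightarrow> int) \<Rightarrow> entries \<Rightarrow> entries \<Rightarrow> bool" where
  "image_rel n p A W V \<longleftrightarrow>
     (\<forall>i<n. \<forall>j<n. [(\<Sum>k<n. A i k * int (W k j)) = int (V i j)] (mod int p))"

text \<open>Invertibility modulo \<open>p\<close> in the guise of surjectivity: column operations
  preserve it by an adjustment of the preimage, without an inverse matrix.\<close>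

definition generating :: "nat \<Rightarrow> nat \<Rightarrow> entries \<Rightarrow> bool" where
  "generating n p W \<longleftrightarrow>
     (\<forall>y. \<exists>x :: nat \<Rightarrow> int. \<forall>i<n. [(\<Sum>j<n. int (W i j) * x j) = y i] (mod int p))"

text \<open>The same elementary matrix multiplies both sides of the matrix equation from the
  right.\<close>

lemma image_rel_elim:
  assumes "image_rel n p A W V" "j0 < n"
  shows "image_rel n p A (elim p C i0 j0 W) (elim p C i0 j0 V)"
  unfolding image_rel_def
proof (intro allI impI)
  fix i j assume ij: "i < n" "j < n"
  have W: "[(\<Sum>k<n. A i k * int (W k j)) = int (V i j)] (mod int p)" if "j < n" for j
    using assms(1) ij that by (simp add: image_rel_def)
  show "[(\<Sum>k<n. A i k * int (elim p C i0 j0 W k j)) = int (elim p C i0 j0 V i j)] (mod int p)"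
  proof (cases "j = j0")
    case False
    let ?l = "int (coef p C i0 j0 j)"
    have "[(\<Sum>k<n. A i k * int (elim p C i0 j0 W k j)) =
        (\<Sum>k<n. A i k * (int (W k j) + ?l * int (W k j0)))] (mod int p)"
      using False by (intro cong_sum cong_mult cong_refl) (simp add: elim_def of_nat_mod cong_def)
    also have "(\<Sum>k<n. A i k * (int (W k j) + ?l * int (W k j0))) =
        (\<Sum>k<n. A i k * int (W k j)) + ?l * (\<Sum>k<n. A i k * int (W k j0))"
      by (simp add: algebra_simps sum.distrib sum_distrib_left)
    also have "[\<dots> = int (V i j) + ?l * int (V i j0)] (mod int p)"
      using W ij assms(2) by (intro cong_add cong_mult cong_refl) auto
    also have "[int (V i j) + ?l * int (V i j0) = int (elim p C i0 j0 V i j)] (mod int p)"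
      using False by (simp add: elim_def of_nat_mod cong_def)
    finally show ?thesis .
  qed (use W ij in \<open>simp add: elim_def\<close>)
qed

lemma generating_elim:
  assumes "generating n p W" "j0 < n"
  shows "generating n p (elim p C i0 j0 W)"
  unfolding generating_def
proof
  fix y :: "nat \<Rightarrow> int"
  from assms(1) obtain x where x: "\<forall>i<n. [(\<Sum>j<n. int (W i j) * x j) = y i] (mod int p)"
    unfolding generating_def by blast
  let ?l = "\<lambda>j. int (coef p C i0 j0 j)"
  \<comment> \<open>Each column \<open>j\<close> now carries \<open>?l j\<close> additional copies
    of column \<open>j0\<close>; coordinate \<open>j0\<close> of the preimage compensates for all of
    them.\<close>
  define x' where "x' = x(j0 := x j0 - (\<Sum>j\<in>{..<n} - {j0}. ?l j * x j))"
  have "[(\<Sum>j<n. int (elim p C i0 j0 W i j) * x' j) = y i] (mod int p)" if "i < n" for i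
  proof -
    have 1: "(\<Sum>j<n. int (elim p C i0 j0 W i j) * x' j) =
        int (W i j0) * x' j0 + (\<Sum>j\<in>{..<n} - {j0}. int (elim p C i0 j0 W i j) * x j)"
      using assms(2) by (subst sum.remove[of _ j0]) (auto simp: elim_def x'_def)
    have 2: "[int (W i j0) * x' j0 + (\<Sum>j\<in>{..<n} - {j0}. int (elim p C i0 j0 W i j) * x j) =
        int (W i j0) * x' j0 +
        (\<Sum>j\<in>{..<n} - {j0}. (int (W i j) + ?l j * int (W i j0)) * x j)] (mod int p)"
      by (intro cong_add cong_sum cong_mult cong_refl) (simp add: elim_def of_nat_mod cong_def)
    have 3: "int (W i j0) * x' j0 + (\<Sum>j\<in>{..<n} - {j0}. (int (W i j) + ?l j * int (W i j0)) * x j) =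
        int (W i j0) * x j0 + (\<Sum>j\<in>{..<n} - {j0}. int (W i j) * x j)"
      by (simp add: x'_def algebra_simps sum.distrib sum_distrib_left)
    have 4: "int (W i j0) * x j0 + (\<Sum>j\<in>{..<n} - {j0}. int (W i j) * x j) = (\<Sum>j<n. int (W i j) * x j)"
      using assms(2) by (subst sum.remove[of _ j0]) auto
    show ?thesis using 2 x that unfolding 1 3 4 by (blast intro: cong_trans)
  qed
  then show "\<exists>x. \<forall>i<n. [(\<Sum>j<n. int (elim p C i0 j0 W i j) * x j) = y i] (mod int p)" by blast
qed

definition is_pivot :: "nat \<Rightarrow> entries \<Rightarrow> nat \<Rightarrow> nat \<Rightarrow> bool" where
  "is_pivot n C i j \<longleftrightarrow> C i j \<noteq> 0 \<and> (\<forall>j'<n. j' \<noteq> j \<longrightarrow> C i j' = 0)"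

definition nonzero_cols :: "nat \<Rightarrow> entries \<Rightarrow> nat set" where
  "nonzero_cols n C = {j. j < n \<and> (\<exists>i<n. C i j \<noteq> 0)}"

text \<open>The set \<open>J\<close> is everything between updates; between the two elimination
  rounds it exempts one column.\<close>

definition pivoted :: "nat \<Rightarrow> entries \<Rightarrow> nat set \<Rightarrow> bool" where
  "pivoted n C J \<longleftrightarrow> (\<forall>j\<in>nonzero_cols n C \<inter> J. \<exists>i<n. is_pivot n C i j)"

definition reduced :: "nat \<Rightarrow> nat \<Rightarrow> entries \<Rightarrow> bool" where
  "reduced n p W \<longleftrightarrow> (\<forall>i<n. \<forall>j<n. W i j < p)"

lemma reduced_elim: "reduced n p W \<Longrightarrow> 0 < p \<Longrightarrow> reduced n p (elim p C i0 j0 W)"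
  by (auto simp: reduced_def elim_def)

lemma reduced_pivot: "reduced n p W \<Longrightarrow> 0 < p \<Longrightarrow> reduced n p (pivot n p S C W)"
  by (cases rule: pivot_cases[where n = n and S = S and p = p]) (auto intro: reduced_elim)

lemma image_rel_pivot:
  "image_rel n p A W V \<Longrightarrow> image_rel n p A (pivot n p S C W) (pivot n p S C V)"
  by (cases rule: pivot_cases[where n = n and S = S and p = p]) (auto intro: image_rel_elim)

lemma generating_pivot: "generating n p W \<Longrightarrow> generating n p (pivot n p S C W)"
  by (cases rule: pivot_cases[where n = n and S = S and p = p]) (auto intro: generating_elim)

lemma coef:
  fixes C :: entries
  assumes "prime p" "C i0 j0 \<noteq> 0" "C i0 j0 < p"
  shows coef_less: "coef p C i0 j0 j < p" and coef_dvd: "p dvd coef p C i0 j0 j * C i0 j0 + C i0 j"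
proof -
  have "coprime (C i0 j0) p"
    using assms by (metis coprime_commute dvd_imp_le not_gr_zero not_le prime_imp_coprime_nat)
  then obtain y where y: "[C i0 j0 * y = 1] (mod p)"
    using cong_solve_coprime_nat[of "C i0 j0" p] by auto
  \<comment> \<open>Here \<open>y\<close> is the inverse of the pivot entry and \<open>p - 1\<close>
    stands for -1.\<close>
  define l where "l = (y * (p - 1) * C i0 j) mod p"
  have p: "0 < p" using assms by (simp add: prime_gt_0_nat)
  have "[l * C i0 j0 + C i0 j = (C i0 j0 * y) * ((p - 1) * C i0 j) + C i0 j] (mod p)"
  proof (intro cong_add cong_refl)
    have "[l * C i0 j0 = (y * (p - 1) * C i0 j) * C i0 j0] (mod p)"
      by (intro cong_mult cong_refl) (simp add: l_def cong_def)
    then show "[l * C i0 j0 = (C i0 j0 * y) * ((p - 1) * C i0 j)] (mod p)" by (simp only: ac_simps)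
  qed
  also have "[(C i0 j0 * y) * ((p - 1) * C i0 j) + C i0 j = 1 * ((p - 1) * C i0 j) + C i0 j] (mod p)"
    by (intro cong_add cong_mult y cong_refl)
  also have "1 * ((p - 1) * C i0 j) + C i0 j = p * C i0 j"
    using p by (cases p) auto
  also have "[p * C i0 j = 0] (mod p)" by (simp add: cong_def)
  finally have l: "p dvd l * C i0 j0 + C i0 j" by (simp add: cong_0_iff)
  then show "p dvd coef p C i0 j0 j * C i0 j0 + C i0 j" unfolding coef_def by (rule LeastI)
  have "coef p C i0 j0 j \<le> l" unfolding coef_def using l by (rule Least_le)
  also have "l < p" using p by (simp add: l_def)
  finally show "coef p C i0 j0 j < p" .
qed

lemma coef_unique:
  fixes C :: entries
  assumes "prime p" "C i0 j0 \<noteq> 0" "C i0 j0 < p" "l < p" "p dvd l * C i0 j0 + C i0 j"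
  shows "l = coef p C i0 j0 j"
proof -
  let ?l = "coef p C i0 j0 j"
  have le: "?l \<le> l" unfolding coef_def using assms(5) by (rule Least_le)
  have "p dvd (l * C i0 j0 + C i0 j) - (?l * C i0 j0 + C i0 j)"
    using assms(5) coef_dvd[where C = C and ?i0.0 = i0 and ?j0.0 = j0, OF assms(1-3)] by (rule dvd_diff_nat)
  then have "p dvd (l - ?l) * C i0 j0" by (simp add: diff_mult_distrib)
  moreover have "\<not> p dvd C i0 j0" using assms by (auto dest: dvd_imp_le)
  ultimately have "p dvd l - ?l" using assms(1) by (simp add: prime_dvd_mult_iff)
  then have "l - ?l = 0" using assms(4) by (metis dvd_imp_le gr0I less_imp_diff_less not_le)
  with le show ?thesis by simp
qed

context
  fixes n p :: nat and C :: entries and i0 j0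
  assumes p: "prime p" and red: "reduced n p C" and ij0: "i0 < n" "j0 < n" "C i0 j0 \<noteq> 0"
begin

lemma elim_col: "elim p C i0 j0 C i j0 = C i j0"
  by (simp add: elim_def)

lemma elim_row: "j < n \<Longrightarrow> j \<noteq> j0 \<Longrightarrow> elim p C i0 j0 C i0 j = 0"
  using coef_dvd[where C = C and ?i0.0 = i0 and ?j0.0 = j0 and j = j, OF p ij0(3)] red ij0 by (simp add: elim_def reduced_def add.commute)

text \<open>Only multiples of column \<open>j0\<close> are added. In particular, the pivot row of
  any other column is 0 there and survives.\<close>

lemma elim_other_row: "i < n \<Longrightarrow> j < n \<Longrightarrow> C i j0 = 0 \<Longrightarrow> elim p C i0 j0 C i j = C i j"
  using red by (simp add: elim_def reduced_def)

lemma elim_other_col: "i < n \<Longrightarrow> j < n \<Longrightarrow> C i0 j = 0 \<Longrightarrow> elim p C i0 j0 C i j = C i j"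
  using red by (simp add: elim_def reduced_def coef_def)

end

text \<open>A column supported in row \<open>a\<close> alone can be added to the others without
  disturbing any other row.\<close>

definition sel_row :: "nat \<Rightarrow> nat \<Rightarrow> entries \<Rightarrow> nat \<Rightarrow> nat \<Rightarrow> bool" where
  "sel_row n a C i j \<longleftrightarrow> i = a \<and> C i j \<noteq> 0 \<and> (\<forall>i'<n. i' \<noteq> a \<longrightarrow> C i' j = 0)"

text \<open>The universally quantified part expresses that column \<open>j\<close> has no pivot row;
  any of its nonzero entries may then serve as the new pivot.\<close>

definition sel_col :: "nat \<Rightarrow> entries \<Rightarrow> nat \<Rightarrow> nat \<Rightarrow> bool" where
  "sel_col n C i j \<longleftrightarrow> C i j \<noteq> 0 \<and> (\<forall>i'<n. C i' j \<noteq> 0 \<longrightarrow> (\<exists>j'<n. j' \<noteq> j \<and> C i' j' \<noteq> 0))"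

lemma is_pivot_cong: "(\<And>j. j < n \<Longrightarrow> C i j = C' i j) \<Longrightarrow> j < n \<Longrightarrow> is_pivot n C i j = is_pivot n C' i j"
  by (simp add: is_pivot_def)

lemma is_pivot_nonzero: "is_pivot n C i j \<Longrightarrow> i < n \<Longrightarrow> j < n \<Longrightarrow> j \<in> nonzero_cols n C"
  by (auto simp: is_pivot_def nonzero_cols_def)

text \<open>The exceptional \<open>k\<close> is the column whose pivot row was \<open>a\<close>, if
  any; all other pivot rows are unchanged. The column \<open>z\<close> used for clearing obtains
  pivot row \<open>a\<close>. Every other column that was zero in \<open>C\<close> could be nonzero
  in row \<open>a\<close> only, and is zero again after the clearing.\<close>

lemma pivot_sel_row:
  assumes p: "prime p" and red: "reduced n p C1" and piv: "pivoted n C UNIV"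
    and C1: "\<And>i j. i < n \<Longrightarrow> j < n \<Longrightarrow> i \<noteq> a \<Longrightarrow> C1 i j = C i j"
  defines "C2 \<equiv> pivot n p (sel_row n a C1) C1 C1"
  shows "\<exists>k z. pivoted n C2 (- {k}) \<and> nonzero_cols n C \<subseteq> insert k (nonzero_cols n C2) \<and>
     nonzero_cols n C2 \<subseteq> insert z (nonzero_cols n C)"
proof -
  obtain k where k: "\<And>k'. k' < n \<Longrightarrow> is_pivot n C a k' \<Longrightarrow> k' = k"
    by (metis is_pivot_def)
  have pivot: "\<exists>i<n. i \<noteq> a \<and> is_pivot n C i j" if "j \<in> nonzero_cols n C" "j \<noteq> k" for j
    using piv k that unfolding pivoted_def nonzero_cols_def by auto
  obtain z where rows: "\<And>i j. i < n \<Longrightarrow> j < n \<Longrightarrow> i \<noteq> a \<Longrightarrow> C2 i j = C i j"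
    and row: "\<And>j. j < n \<Longrightarrow> j \<notin> nonzero_cols n C \<Longrightarrow> j \<noteq> z \<Longrightarrow> a < n \<Longrightarrow> C2 a j = 0"
    and z: "z < n \<Longrightarrow> is_pivot n C2 a z" and az: "z < n \<Longrightarrow> a < n"
  proof (cases rule: pivot_cases[where n = n and S = "sel_row n a C1" and p = p])
    case none
    show ?thesis
    \<comment> \<open>The index \<open>n\<close> is outside the matrix and plays \<open>z\<close>
      when no column is selected.\<close>
    proof (rule that[of n])
      show "C2 a j = 0" if "j < n" "j \<notin> nonzero_cols n C" "a < n" for j
        using none(1)[of a j] that C1 unfolding C2_def none(2) sel_row_def nonzero_cols_def by auto
    qed (use C1 in \<open>auto simp: C2_def none(2)\<close>)
  next
    case (pair i z)
    then have i: "i = a" "a < n" and nz: "C1 a z \<noteq> 0" and col: "\<And>i. i < n \<Longrightarrow> i \<noteq> a \<Longrightarrow> C1 i z = 0"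
      by (auto simp: sel_row_def)
    have C2: "C2 = elim p C1 a z C1" using pair by (simp add: C2_def i)
    note el = elim_col[OF p red i(2) pair(2) nz] elim_row[OF p red i(2) pair(2) nz]
      elim_other_row[OF p red i(2) pair(2) nz]
    show ?thesis
      by (rule that[of z]) (use i nz col pair(2) C1 in \<open>auto simp: C2 el is_pivot_def\<close>)
  qed
  have pivot2: "\<exists>i<n. is_pivot n C2 i j" if j: "j \<in> nonzero_cols n C" "j \<noteq> k" for j
  proof -
    from pivot[OF j] obtain i where "i < n" "i \<noteq> a" "is_pivot n C i j" by blast
    then show ?thesis using rows j is_pivot_cong[of n C2 i C j] by (auto simp: nonzero_cols_def)
  qed
  have sub: "nonzero_cols n C2 \<subseteq> insert z (nonzero_cols n C)"
  proof
    fix j assume j: "j \<in> nonzero_cols n C2"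
    show "j \<in> insert z (nonzero_cols n C)"
    proof (rule ccontr)
      assume "\<not> ?thesis"
      then have "C2 i j = 0" if "i < n" for i
        using that rows[of i j] row[of j] j by (cases "i = a") (auto simp: nonzero_cols_def)
      with j show False by (auto simp: nonzero_cols_def)
    qed
  qed
  show ?thesis
  proof (intro exI conjI)
    show "pivoted n C2 (- {k})"
      unfolding pivoted_def
    proof
      fix j assume j: "j \<in> nonzero_cols n C2 \<inter> - {k}"
      show "\<exists>i<n. is_pivot n C2 i j"
      proof (cases "j = z")
        case True
        with j have "z < n" by (simp add: nonzero_cols_def)
        with z az True show ?thesis by blast
      qed (use j sub pivot2 in auto)
    qed
    show "nonzero_cols n C \<subseteq> insert k (nonzero_cols n C2)"
    proof
      fix j assume j: "j \<in> nonzero_cols n C"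
      then have "j < n" by (simp add: nonzero_cols_def)
      with j pivot2 is_pivot_nonzero show "j \<in> insert k (nonzero_cols n C2)" by blast
    qed
  qed (rule sub)
qed

text \<open>A selected column has no pivot row, so it must be \<open>k\<close>. Elimination makes
  the selected row its pivot row and leaves the pivot rows of the other columns alone. Zero columns
  get multiplier 0 and stay zero, so the set of nonzero columns is unchanged.\<close>

lemma pivot_sel_col:
  assumes p: "prime p" and red: "reduced n p C" and piv: "pivoted n C (- {k})"
  defines "C' \<equiv> pivot n p (sel_col n C) C C"
  shows "pivoted n C' UNIV \<and> nonzero_cols n C' = nonzero_cols n C"
proof (cases rule: pivot_cases[where n = n and S = "sel_col n C" and p = p])
  case none
  have "\<exists>i<n. is_pivot n C i j" if "j \<in> nonzero_cols n C" for j
  proof -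
    from that obtain i where i: "i < n" "j < n" "C i j \<noteq> 0" by (auto simp: nonzero_cols_def)
    with none(1)[of i j] obtain i' where "i' < n" "C i' j \<noteq> 0" "\<forall>j'<n. j' \<noteq> j \<longrightarrow> C i' j' = 0"
      unfolding sel_col_def by blast
    then show ?thesis unfolding is_pivot_def by blast
  qed
  then show ?thesis by (simp add: C'_def none(2) pivoted_def)
next
  case (pair i0 j0)
  then have nz: "C i0 j0 \<noteq> 0" and no: "\<And>i. i < n \<Longrightarrow> \<not> is_pivot n C i j0"
    by (auto simp: sel_col_def is_pivot_def)
  have C': "C' = elim p C i0 j0 C" using pair by (simp add: C'_def)
  note el = elim_col[OF p red pair(1,2) nz] elim_row[OF p red pair(1,2) nz]
    elim_other_row[OF p red pair(1,2) nz] elim_other_col[OF p red pair(1,2) nz]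
  have j0: "j0 = k"
    using piv no pair nz unfolding pivoted_def nonzero_cols_def by auto
  have piv0: "is_pivot n C' i0 j0"
    using pair(1,2) nz by (auto simp: C' is_pivot_def el)
  have zero: "j \<notin> nonzero_cols n C'" if "j < n" "j \<notin> nonzero_cols n C" for j
    using that el(4) pair(1) by (auto simp: nonzero_cols_def C')
  have other: "\<exists>i<n. is_pivot n C' i j" if "j \<in> nonzero_cols n C" "j \<noteq> j0" for j
  proof -
    from piv that j0 obtain i where i: "i < n" "is_pivot n C i j" unfolding pivoted_def by blast
    then have "C i j0 = 0" using pair(2) that by (simp add: is_pivot_def)
    then have "is_pivot n C' i j"
      using i is_pivot_cong[of n C' i C j] el(3) that by (auto simp: C' nonzero_cols_def)
    with i show ?thesis by blast
  qed
  have "nonzero_cols n C' \<subseteq> nonzero_cols n C"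
    using zero unfolding nonzero_cols_def by blast
  moreover have "j0 \<in> nonzero_cols n C'"
    using piv0 pair(1,2) is_pivot_nonzero by blast
  then have "nonzero_cols n C \<subseteq> nonzero_cols n C'"
  proof (intro subsetI)
    fix j assume j: "j \<in> nonzero_cols n C"
    then have "j < n" by (simp add: nonzero_cols_def)
    with j other is_pivot_nonzero \<open>j0 \<in> nonzero_cols n C'\<close> show "j \<in> nonzero_cols n C'" by blast
  qed
  ultimately show ?thesis
    using other piv0 pair(1) unfolding pivoted_def by auto
qed

text \<open>\<open>X\<close> loses at most \<open>k\<close> and gains at most \<open>z\<close>. The
  new cardinality thus follows from the old one by two inclusion tests, which are first-order,
  unlike counting.\<close>

lemma card_change:
  assumes "finite X" "finite Y" "X \<subseteq> insert k Y" "Y \<subseteq> insert z X"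
  shows "card Y = (if Y \<subseteq> X then (if X \<subseteq> Y then card X else card X - 1)
                   else (if X \<subseteq> Y then card X + 1 else card X))"
proof -
  have 1: "X = insert k (X \<inter> Y) \<and> k \<notin> X \<inter> Y" if "\<not> X \<subseteq> Y" using assms that by blast
  have 2: "Y = insert z (X \<inter> Y) \<and> z \<notin> X \<inter> Y" if "\<not> Y \<subseteq> X" using assms that by blast
  define c where "c = card (X \<inter> Y)"
  have "card X = Suc c" if "\<not> X \<subseteq> Y"
    unfolding c_def using 1[OF that] assms(1) by (metis card_insert_disjoint finite_Int)
  moreover have "card Y = Suc c" if "\<not> Y \<subseteq> X"
    unfolding c_def using 2[OF that] assms(1) by (metis card_insert_disjoint finite_Int)
  moreover have "card X = c" if "X \<subseteq> Y" unfolding c_def using that by (simp add: Int_absorb2)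
  moreover have "card Y = c" if "Y \<subseteq> X" unfolding c_def using that by (simp add: Int_absorb1)
  ultimately show ?thesis by simp
qed

text \<open>If entry (a, b) of \<open>A\<close> grows by \<open>d\<close>, then row \<open>a\<close>
  of the product \<open>A B\<close> grows by \<open>d\<close> times row \<open>b\<close> of
  \<open>B\<close>, and no other row changes.\<close>

definition add_row :: "nat \<Rightarrow> nat \<Rightarrow> nat \<Rightarrow> nat \<Rightarrow> entries \<Rightarrow> entries \<Rightarrow> nat \<Rightarrow> nat \<Rightarrow> nat" where
  "add_row p a b d B C i j = (if i = a then (C i j + d * B b j) mod p else C i j)"

lemma image_rel_add_row:
  assumes "image_rel n p A B C" "b < n" "[int d = d'] (mod int p)"
    "\<And>i j. i < n \<Longrightarrow> j < n \<Longrightarrow> A' i j = A i j + (if i = a \<and> j = b then d' else 0)"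
  shows "image_rel n p A' B (add_row p a b d B C)"
  unfolding image_rel_def
proof (intro allI impI)
  fix i j assume ij: "i < n" "j < n"
  have "(\<Sum>k<n. A' i k * int (B k j)) =
      (\<Sum>k<n. A i k * int (B k j)) + (\<Sum>k<n. if k = b then (if i = a then d' * int (B k j) else 0) else 0)"
    unfolding sum.distrib[symmetric] using assms(4) ij by (intro sum.cong) (auto simp: algebra_simps)
  also have "\<dots> = (\<Sum>k<n. A i k * int (B k j)) + (if i = a then d' * int (B b j) else 0)"
    using assms(2) by (simp add: sum.delta)
  also have "[\<dots> = int (C i j) + (if i = a then int d * int (B b j) else 0)] (mod int p)"
    using assms(1,3) ij by (intro cong_add) (auto simp: image_rel_def intro: cong_mult cong_sym)
  also have "[int (C i j) + (if i = a then int d * int (B b j) else 0) = int (add_row p a b d B C i j)] (mod int p)"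
    by (simp add: add_row_def of_nat_mod cong_def)
  finally show "[(\<Sum>k<n. A' i k * int (B k j)) = int (add_row p a b d B C i j)] (mod int p)" .
qed

section \<open>The rank modulo a prime\<close>

lemma (in vec_space) card_le_rank:
  assumes M: "M \<in> carrier_mat n nc" and S: "S \<subseteq> span (set (cols M))" and li: "lin_indpt S"
  shows "card S \<le> rank M"
proof -
  have c: "set (cols M) \<subseteq> carrier_vec n" using M cols_dim by blast
  have sub: "submodule class_ring (span (set (cols M))) V" using c by (simp add: span_is_submodule)
  interpret W: vectorspace class_ring "span_vs (set (cols M))"
    using span_is_subspace[THEN subspace_is_vs, of "set (cols M)"] c by simp
  have "W.lin_indpt S" using span_li_not_depend(2)[OF S sub] li by simp
  with S have "card S \<le> W.dim" using fin_dim_span_cols[OF M] by (intro W.li_le_dim(2)) auto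
  then show ?thesis by (simp add: rank_def)
qed

text \<open>Basis extension: a maximal independent set between \<open>U\<close> and its union with
  the unit vectors spans the whole space.\<close>

lemma (in vec_space) indpt_extend_units:
  assumes U: "U \<subseteq> carrier_vec n" "finite U" "lin_indpt U"
  obtains X where "U \<subseteq> X" "X \<subseteq> U \<union> set (unit_vecs n)" "finite X" "lin_indpt X" "card X = n"
proof -
  let ?S = "U \<union> set (unit_vecs n)"
  have S: "?S \<subseteq> carrier_vec n" using U unit_vecs_carrier by auto
  obtain X where X: "finite X" "maximal X (\<lambda>T. T \<subseteq> ?S \<and> lin_indpt T)" "U \<subseteq> X"
    using maximal_exists_superset[of ?S "\<lambda>T. T \<subseteq> ?S \<and> lin_indpt T" U] U by auto
  have "carrier_vec n = span (set (unit_vecs n))" by (simp add: span_unit_vecs_is_carrier)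
  also have "\<dots> \<subseteq> span ?S" by (rule span_is_monotone) auto
  finally have "span ?S = carrier_vec n" using span_closed[OF S] by auto
  then have "span_vs ?S = V" by simp
  with dim_span[OF _ _ X(2)] S U have "card X = n" using dim_is_n by simp
  with X show ?thesis using that unfolding maximal_def by blast
qed

lemma det_zero_col:
  fixes P :: "'b :: comm_ring_1 mat"
  assumes P: "P \<in> carrier_mat n n" and m: "m < n" "\<And>i. i < n \<Longrightarrow> P $$ (i, m) = 0"
  shows "det P = 0"
  unfolding det_col[OF P]
proof (intro sum.neutral ballI)
  fix q assume "q \<in> {q. q permutes {0..<n}}"
  then have "q m < n" using permutes_in_image[of q "{0..<n}" m] m by simp
  then have "(\<Prod>j<n. P $$ (q j, j)) = 0" using m by (intro prod_zero) auto
  then show "signof q * (\<Prod>j<n. P $$ (q j, j)) = 0" by simp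
qed

lemma cong_det:
  fixes P Q :: "int mat"
  assumes "P \<in> carrier_mat n n" "Q \<in> carrier_mat n n"
    "\<And>i j. i < n \<Longrightarrow> j < n \<Longrightarrow> [P $$ (i, j) = Q $$ (i, j)] (mod k)"
  shows "[det P = det Q] (mod k)"
  unfolding det_def'[OF assms(1)] det_def'[OF assms(2)]
proof (intro cong_sum cong_mult cong_prod cong_refl)
  fix q i assume "q \<in> {q. q permutes {0..<n}}" "i \<in> {0..<n}"
  then have "q i < n" "i < n" using permutes_in_image[of q "{0..<n}" i] by auto
  then show "[P $$ (i, q i) = Q $$ (i, q i)] (mod k)" using assms(3) by blast
qed

text \<open>The Leibniz formula has n! summands of absolute value at most \<open>n ^ n\<close>, and
  n! is at most \<open>n ^ n\<close>.\<close>

lemma abs_det_le: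
  fixes P :: "int mat"
  assumes P: "P \<in> carrier_mat n n" and b: "\<And>i j. i < n \<Longrightarrow> j < n \<Longrightarrow> \<bar>P $$ (i, j)\<bar> \<le> int n"
  shows "\<bar>det P\<bar> \<le> int (n ^ (2 * n))"
proof -
  have "\<bar>det P\<bar> \<le> (\<Sum>q | q permutes {0..<n}. \<bar>signof q * (\<Prod>i = 0..<n. P $$ (i, q i))\<bar>)"
    unfolding det_def'[OF P] by (rule sum_abs)
  also have "\<dots> \<le> (\<Sum>q | q permutes {0..<n}. int n ^ n)"
  proof (rule sum_mono)
    fix q assume "q \<in> {q. q permutes {0..<n}}"
    then have q: "q i < n" if "i < n" for i using permutes_in_image[of q "{0..<n}" i] that by auto
    have "\<bar>signof q * (\<Prod>i = 0..<n. P $$ (i, q i))\<bar> = (\<Prod>i = 0..<n. \<bar>P $$ (i, q i)\<bar>)"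
      by (simp add: abs_mult abs_prod sign_def)
    also have "\<dots> \<le> (\<Prod>i = 0..<n. int n)" using b q by (intro prod_mono) auto
    finally show "\<bar>signof q * (\<Prod>i = 0..<n. P $$ (i, q i))\<bar> \<le> int n ^ n" by simp
  qed
  also have "\<dots> = fact n * int n ^ n" by (simp add: card_permutations)
  also have "\<dots> \<le> int (n ^ n) * int n ^ n"
    using fact_le_power[where 'a = int] by (intro mult_right_mono) auto
  also have "\<dots> = int (n ^ (2 * n))" by (simp add: mult_2 power_add)
  finally show ?thesis .
qed

definition rat_mat :: "nat \<Rightarrow> (nat \<Rightarrow> nat \<Rightarrow> int) \<Rightarrow> rat mat" where
  "rat_mat n A = mat n n (\<lambda>(i, j). of_int (A i j))"

lemma rat_mat_carrier: "rat_mat n A \<in> carrier_mat n n"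
  by (simp add: rat_mat_def)

text \<open>Infinite descent: after division of all coefficients by \<open>p ^ e\<close> the
  relation persists, and in the row \<open>i\<close> belonging to \<open>j\<close> all other
  summands are divisible by \<open>p\<close>, so the quotient of \<open>x j\<close> is too. A number
  divisible by all powers of \<open>p\<close> is 0.\<close>

lemma int_relation_trivial:
  fixes w :: "'i \<Rightarrow> 'j \<Rightarrow> int" and p :: int
  assumes p: "prime p" and J: "finite J"
    and rel: "\<And>i. i \<in> I \<Longrightarrow> (\<Sum>j\<in>J. x j * w i j) = 0"
    and piv: "\<And>j. j \<in> J \<Longrightarrow> \<exists>i\<in>I. \<not> p dvd w i j \<and> (\<forall>j'\<in>J. j' \<noteq> j \<longrightarrow> p dvd w i j')"
    and j: "j \<in> J"
  shows "x j = 0"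
proof -
  have "\<forall>j\<in>J. p ^ e dvd x j" for e
  proof (induction e)
    case (Suc e)
    then obtain y where y: "\<And>j. j \<in> J \<Longrightarrow> x j = p ^ e * y j" unfolding dvd_def by metis
    have 0: "(\<Sum>j\<in>J. y j * w i j) = 0" if "i \<in> I" for i
    proof -
      have "p ^ e * (\<Sum>j\<in>J. y j * w i j) = (\<Sum>j\<in>J. x j * w i j)"
        unfolding sum_distrib_left by (intro sum.cong) (auto simp: y)
      with rel[OF that] p show ?thesis by auto
    qed
    show ?case
    proof
      fix j assume j: "j \<in> J"
      with piv obtain i where i: "i \<in> I" "\<not> p dvd w i j" "\<And>j'. j' \<in> J \<Longrightarrow> j' \<noteq> j \<Longrightarrow> p dvd w i j'" by blast
      have "y j * w i j = - (\<Sum>j\<in>J - {j}. y j * w i j)"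
        using 0[OF i(1)] sum.remove[OF J j, of "\<lambda>j. y j * w i j"] by simp
      moreover have "p dvd (\<Sum>j\<in>J - {j}. y j * w i j)" using i by (intro dvd_sum) auto
      ultimately have "p dvd y j * w i j" by simp
      then have "p dvd y j" using i p by (simp add: prime_dvd_mult_iff)
      then show "p ^ Suc e dvd x j" using y[OF j] by (simp add: mult_dvd_mono)
    qed
  qed simp
  then have *: "p ^ e dvd x j" for e using j by blast
  show ?thesis
  proof (rule ccontr)
    assume x: "x j \<noteq> 0"
    have p2: "2 \<le> p" using p by (simp add: prime_ge_2_int)
    have "\<bar>x j\<bar> < 2 ^ nat \<bar>x j\<bar>" using less_exp[of "nat \<bar>x j\<bar>"]
      by (metis abs_ge_zero nat_eq_iff2 of_nat_less_iff of_nat_numeral of_nat_power int_nat_eq)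
    also have "\<dots> \<le> p ^ nat \<bar>x j\<bar>" using p2 by (intro power_mono) auto
    finally show False using dvd_imp_le_int[OF x *[of "nat \<bar>x j\<bar>"]] p2 by simp
  qed
qed

lemma rat_relation_trivial:
  fixes w :: "'i \<Rightarrow> 'j \<Rightarrow> int" and p :: int and x :: "'j \<Rightarrow> rat"
  assumes p: "prime p" and J: "finite J"
    and rel: "\<And>i. i \<in> I \<Longrightarrow> (\<Sum>j\<in>J. x j * of_int (w i j)) = 0"
    and piv: "\<And>j. j \<in> J \<Longrightarrow> \<exists>i\<in>I. \<not> p dvd w i j \<and> (\<forall>j'\<in>J. j' \<noteq> j \<longrightarrow> p dvd w i j')"
    and j: "j \<in> J"
  shows "x j = 0"
proof -
  define d where "d j = snd (quotient_of (x j))" for j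
  \<comment> \<open>This is \<open>x j\<close> times the product of all denominators, which reduces
    the claim to integer coefficients.\<close>
  define y where "y j = fst (quotient_of (x j)) * (\<Prod>j'\<in>J - {j}. d j')" for j
  have d: "0 < d j" for j by (simp add: d_def quotient_of_denom_pos')
  have y: "of_int (y j) = x j * of_int (\<Prod>j\<in>J. d j)" if "j \<in> J" for j
  proof -
    have "x j = of_int (fst (quotient_of (x j))) / of_int (d j)"
      unfolding d_def by (metis prod.collapse quotient_of_div)
    then have "x j * of_int (d j) = of_int (fst (quotient_of (x j)))" using d[of j] by (metis less_irrefl nonzero_divide_eq_eq of_int_eq_0_iff)
    then show ?thesis
      unfolding y_def prod.remove[OF J that] by (simp add: mult.assoc[symmetric])
  qed
  have "y j = 0"
  proof (rule int_relation_trivial[OF p J _ piv j])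
    fix i assume i: "i \<in> I"
    have "(of_int (\<Sum>j\<in>J. y j * w i j) :: rat) = (\<Sum>j\<in>J. x j * of_int (w i j)) * of_int (\<Prod>j\<in>J. d j)"
      unfolding sum_distrib_right of_int_sum of_int_mult by (intro sum.cong) (simp_all add: y ac_simps)
    then have "(of_int (\<Sum>j\<in>J. y j * w i j) :: rat) = of_int 0" using rel[OF i] by simp
    then show "(\<Sum>j\<in>J. y j * w i j) = 0" by (simp only: of_int_eq_iff)
  qed
  then show ?thesis using y[OF j] d by (simp add: prod_zero_iff[OF J]) (metis less_irrefl)
qed

text \<open>The columns of \<open>A B\<close>, computed over the integers without reduction, lie in
  the rational column space of \<open>A\<close>. Their residues are the columns of \<open>C\<close>,
  whose pivots rule out any nontrivial rational relation.\<close>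

lemma card_nonzero_cols_le_rank:
  assumes p: "prime p" and red: "reduced n p C" and img: "image_rel n p A B C"
    and piv: "pivoted n C UNIV"
  shows "card (nonzero_cols n C) \<le> vec_space.rank n (rat_mat n A)"
proof -
  interpret vec_space "TYPE(rat)" n .
  let ?J = "nonzero_cols n C" and ?M = "rat_mat n A"
  define w where "w i j = (\<Sum>k<n. A i k * int (B k j))" for i j
  define W where "W j = vec n (\<lambda>i. of_int (w i j) :: rat)" for j
  have J: "finite ?J" "\<And>j. j \<in> ?J \<Longrightarrow> j < n" by (auto simp: nonzero_cols_def)
  have dvd: "int p dvd w i j \<longleftrightarrow> C i j = 0" if "i < n" "j < n" for i j
  proof -
    have "[w i j = int (C i j)] (mod int p)" using img that by (simp add: image_rel_def w_def)
    then have "int p dvd w i j \<longleftrightarrow> int p dvd int (C i j)" by (rule cong_dvd_iff)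
    also have "\<dots> \<longleftrightarrow> C i j = 0" using red that unfolding reduced_def
      by (metis dvd_0_right int_dvd_int_iff nat_dvd_not_less neq0_conv)
    finally show ?thesis .
  qed
  have pivs: "\<exists>i\<in>{..<n}. \<not> int p dvd w i j \<and> (\<forall>j'\<in>?J. j' \<noteq> j \<longrightarrow> int p dvd w i j')" if j: "j \<in> ?J" for j
  proof -
    from piv j obtain i where "i < n" "is_pivot n C i j" unfolding pivoted_def by blast
    then show ?thesis using dvd J j by (intro bexI[of _ i]) (auto simp: is_pivot_def)
  qed
  have inj: "inj_on W ?J"
  proof (rule inj_onI, rule ccontr)
    fix j j' assume j: "j \<in> ?J" "j' \<in> ?J" "W j = W j'" "j \<noteq> j'"
    from pivs[OF j(1)] j obtain i where i: "i < n" "\<not> int p dvd w i j" "int p dvd w i j'" by auto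
    from j(3) have "W j $ i = W j' $ i" by simp
    with i show False by (simp add: W_def)
  qed
  have span: "W ` ?J \<subseteq> span (set (cols ?M))"
  proof
    fix v assume "v \<in> W ` ?J"
    then obtain j where j: "j \<in> ?J" "v = W j" by blast
    have "?M *\<^sub>v vec n (\<lambda>k. of_nat (B k j)) = W j"
      by (rule eq_vecI) (auto simp: rat_mat_def W_def w_def scalar_prod_def atLeast0LessThan)
    then have "v \<in> col_space ?M"
      unfolding col_space_eq[OF rat_mat_carrier] j by (auto simp: rat_mat_def W_def)
    then show "v \<in> span (set (cols ?M))" by (simp add: col_space_def)
  qed
  have c: "W ` ?J \<subseteq> carrier_vec n" by (auto simp: W_def)
  have "lin_indpt (W ` ?J)"
  proof
    assume "lin_dep (W ` ?J)"
    then obtain a v where a: "lincomb a (W ` ?J) = 0\<^sub>v n" "v \<in> W ` ?J" "a v \<noteq> 0"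
      using finite_lin_dep[of "W ` ?J"] J c by auto
    then obtain j where j: "j \<in> ?J" "v = W j" by blast
    have "a (W j) = 0"
    proof (rule rat_relation_trivial[where x = "\<lambda>j. a (W j)" and J = ?J and I = "{..<n}" and p = "int p"])
      fix i assume i: "i \<in> {..<n}"
      have "(\<Sum>j\<in>?J. a (W j) * of_int (w i j)) = (\<Sum>j\<in>?J. a (W j) * W j $ i)"
        using i by (simp add: W_def)
      also have "\<dots> = (\<Sum>v\<in>W ` ?J. a v * v $ i)" by (simp add: sum.reindex[OF inj])
      also have "\<dots> = lincomb a (W ` ?J) $ i" using lincomb_index[of i "W ` ?J" a] i c by simp
      also have "\<dots> = 0" using a i by simp
      finally show "(\<Sum>j\<in>?J. a (W j) * of_int (w i j)) = 0" .
    qed (use p J pivs j in auto)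
    with a j show False by simp
  qed
  from card_le_rank[OF rat_mat_carrier span this] show ?thesis by (simp add: card_image[OF inj])
qed

text \<open>Independent columns of the matrix are extended by unit vectors to a regular integer matrix. If a
  prime does not divide its determinant, then the columns stay independent modulo that prime.\<close>

lemma rank_le_card_nonzero_cols:
  assumes bound: "\<And>i j. i < n \<Longrightarrow> j < n \<Longrightarrow> \<bar>A i j\<bar> \<le> int n" and n: "0 < n"
  shows "\<exists>d>0. d \<le> n ^ (2 * n) \<and>
     (\<forall>p B C. prime p \<longrightarrow> \<not> p dvd d \<longrightarrow> image_rel n p A B C \<longrightarrow> generating n p B \<longrightarrow>
        vec_space.rank n (rat_mat n A) \<le> card (nonzero_cols n C))"
proof -
  interpret vec_space "TYPE(rat)" n .
  let ?M = "rat_mat n A"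
  have cM: "set (cols ?M) \<subseteq> carrier_vec n" by (metis rat_mat_carrier cols_dim carrier_matD(1))
  obtain U where U: "finite U" "maximal U (\<lambda>T. T \<subseteq> set (cols ?M) \<and> lin_indpt T)"
    using maximal_exists_superset[of "set (cols ?M)" "\<lambda>T. T \<subseteq> set (cols ?M) \<and> lin_indpt T" "{}"]
      subset_li_is_li[of "set (unit_vecs n)" "{}"] unit_vecs_basis unfolding basis_def by auto
  have rank: "rank ?M = card U" by (rule rank_card_indpt[OF rat_mat_carrier U(2)])
  have Uc: "U \<subseteq> set (cols ?M)" "lin_indpt U" using U(2) unfolding maximal_def by auto
  obtain X where X: "U \<subseteq> X" "X \<subseteq> U \<union> set (unit_vecs n)" "finite X" "lin_indpt X" "card X = n"
    using indpt_extend_units[of U] Uc cM U by blast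
  obtain vs where vs: "set vs = X" "distinct vs" using finite_distinct_list[OF X(3)] by blast
  have len: "length vs = n" using vs X distinct_card by fastforce
  \<comment> \<open>The positions filled with added unit vectors; the remaining ones hold columns of
    the matrix.\<close>
  define T where "T = {t. t < n \<and> vs ! t \<notin> U}"
  have nth: "vs ! t \<in> X" if "t < n" for t using that vs len nth_mem by blast
  have "\<exists>c<n. vs ! t = col ?M c" if "t < n" "t \<notin> T" for t
  proof -
    have "vs ! t \<in> set (cols ?M)" using that Uc by (auto simp: T_def)
    then show ?thesis by (auto simp: in_set_conv_nth rat_mat_def)
  qed
  then obtain g where g: "\<And>t. t < n \<Longrightarrow> t \<notin> T \<Longrightarrow> g t < n \<and> vs ! t = col ?M (g t)" by metis
  have "\<exists>c<n. vs ! t = unit_vec n c" if "t \<in> T" for t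
  proof -
    have "vs ! t \<in> set (unit_vecs n)" using that X(2) nth by (auto simp: T_def)
    then show ?thesis by (auto simp: unit_vecs_def)
  qed
  then obtain h where h: "\<And>t. t \<in> T \<Longrightarrow> h t < n \<and> vs ! t = unit_vec n (h t)" by metis
  \<comment> \<open>The basis as an integer matrix; its determinant is the number \<open>d\<close>
    that is sought.\<close>
  define N where "N = mat n n (\<lambda>(i, t). if t \<in> T then of_bool (i = h t) else A i (g t))"
  have Nc: "N \<in> carrier_mat n n" by (simp add: N_def)
  have N: "map_mat of_int N = mat_of_cols n vs"
  proof (rule eq_matI)
    fix i t assume "i < dim_row (mat_of_cols n vs)" "t < dim_col (mat_of_cols n vs)"
    then have it: "i < n" "t < n" using len by auto
    then have "mat_of_cols n vs $$ (i, t) = vs ! t $ i" using len by (simp add: mat_of_cols_index)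
    also have "\<dots> = of_int (N $$ (i, t))"
      using it g[of t] h[of t] by (cases "t \<in> T") (auto simp: N_def rat_mat_def unit_vec_def)
    finally show "map_mat of_int N $$ (i, t) = mat_of_cols n vs $$ (i, t)" using it Nc by simp
  qed (use Nc len in auto)
  have vsc: "set vs \<subseteq> carrier_vec n" using vs X(2) Uc cM unit_vecs_carrier by blast
  have "cols (mat_of_cols n vs) = vs" using vsc by (rule cols_mat_of_cols)
  moreover have mc: "mat_of_cols n vs \<in> carrier_mat n n" using len by auto
  ultimately have "rank (mat_of_cols n vs) = n"
    using lin_indpt_full_rank[OF mc] vs X(4) by simp
  then have "det (mat_of_cols n vs) \<noteq> 0" using det_rank_iff[OF mc] by simp
  then have det: "det N \<noteq> 0" unfolding N[symmetric] by simp
  show ?thesis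
  proof (intro exI conjI allI impI)
    show "0 < nat \<bar>det N\<bar>" using det by simp
    have "\<bar>N $$ (i, j)\<bar> \<le> int n" if "i < n" "j < n" for i j
      using that bound[of i "g j"] g[of j] n by (cases "j \<in> T") (auto simp: N_def)
    from abs_det_le[OF Nc this] show "nat \<bar>det N\<bar> \<le> n ^ (2 * n)" by (simp add: nat_le_iff)
    fix p B C assume p: "prime p" "\<not> p dvd nat \<bar>det N\<bar>" and img: "image_rel n p A B C" and gen: "generating n p B"
    show "rank ?M \<le> card (nonzero_cols n C)"
    proof (rule ccontr)
      assume less: "\<not> rank ?M \<le> card (nonzero_cols n C)"
      let ?J = "nonzero_cols n C"
      have J: "finite ?J" "\<And>j. j \<in> ?J \<Longrightarrow> j < n" by (auto simp: nonzero_cols_def)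
      have T: "finite T" by (simp add: T_def)
      have "card ({..<n} - T) = card U"
      proof (rule bij_betw_same_card[of "(!) vs"], unfold bij_betw_def, intro conjI)
        show "inj_on ((!) vs) ({..<n} - T)" using vs len by (auto intro!: inj_on_nth)
        show "(!) vs ` ({..<n} - T) = U"
        proof
          show "U \<subseteq> (!) vs ` ({..<n} - T)"
          proof
            fix u assume u: "u \<in> U"
            then obtain t where "t < n" "vs ! t = u" using X(1) vs len by (metis in_set_conv_nth subsetD)
            with u show "u \<in> (!) vs ` ({..<n} - T)" by (auto simp: T_def)
          qed
        qed (auto simp: T_def)
      qed
      moreover have "card ({..<n} - T) = n - card T" by (subst card_Diff_subset) (auto simp: T_def)
      moreover have "card T \<le> n" using card_mono[of "{..<n}" T] by (auto simp: T_def)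
      \<comment> \<open>Exactly rank many of the \<open>n\<close> basis vectors are columns of the
        matrix, so \<open>T\<close> has \<open>n\<close> minus the rank elements, and
        \<open>C\<close> is assumed to have fewer nonzero columns than the rank.\<close>
      ultimately have m: "card (?J <+> T) < n" using less rank by (simp add: card_Plus J T)
      let ?m = "card (?J <+> T)"
      obtain f where f: "bij_betw f {0..<?m} (?J <+> T)"
        using ex_bij_betw_nat_finite[OF finite_Plus[OF J(1) T]] by blast
      \<comment> \<open>Column \<open>c\<close> of an inverse of \<open>B\<close> modulo
        \<open>p\<close>; it yields \<open>A\<close> as \<open>C\<close> times this inverse, hence
        every column of \<open>A\<close> from the nonzero columns of \<open>C\<close>.\<close>
      define x where "x c = (SOME x. \<forall>i<n. [(\<Sum>j<n. int (B i j) * x j) = of_bool (i = c)] (mod int p))" for c :: nat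
      have x: "[(\<Sum>j<n. int (B i j) * x c j) = of_bool (i = c)] (mod int p)" if "i < n" for i c
        using gen[unfolded generating_def, THEN spec, of "\<lambda>i. of_bool (i = c)", THEN someI_ex] that
        unfolding x_def by blast
      have Ax: "[A i c = (\<Sum>j\<in>?J. int (C i j) * x c j)] (mod int p)" if ic: "i < n" "c < n" for i c
      proof -
        have 1: "A i c = (\<Sum>k<n. A i k * of_bool (k = c))"
          using ic by (simp add: of_bool_def if_distrib sum.delta cong: if_cong)
        have 2: "[(\<Sum>k<n. A i k * (\<Sum>j<n. int (B k j) * x c j)) = (\<Sum>k<n. A i k * of_bool (k = c))] (mod int p)"
          using x by (intro cong_sum cong_mult cong_refl) auto
        have 3: "(\<Sum>k<n. A i k * (\<Sum>j<n. int (B k j) * x c j)) = (\<Sum>j<n. (\<Sum>k<n. A i k * int (B k j)) * x c j)"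
          unfolding sum_distrib_left sum_distrib_right by (subst sum.swap) (simp add: ac_simps)
        have 4: "[(\<Sum>j<n. (\<Sum>k<n. A i k * int (B k j)) * x c j) = (\<Sum>j<n. int (C i j) * x c j)] (mod int p)"
          using img ic by (intro cong_sum cong_mult cong_refl) (auto simp: image_rel_def)
        have 5: "(\<Sum>j<n. int (C i j) * x c j) = (\<Sum>j\<in>?J. int (C i j) * x c j)"
          using ic by (intro sum.mono_neutral_right) (auto simp: nonzero_cols_def)
        have "[A i c = (\<Sum>k<n. A i k * (\<Sum>j<n. int (B k j) * x c j))] (mod int p)"
          unfolding 1 by (rule cong_sym[OF 2])
        from cong_trans[OF this[unfolded 3] 4] show ?thesis unfolding 5 .
      qed
      \<comment> \<open>Modulo \<open>p\<close>, the columns of \<open>N\<close> are combinations of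
        fewer than \<open>n\<close> vectors: the nonzero columns of \<open>C\<close> and the added
        unit vectors. \<open>P\<close> holds these vectors and \<open>Q\<close> the coefficients.
        Padding with zeros makes them square, and a zero column of \<open>P\<close> forces the
        determinant of the product to be 0.\<close>
      define P where "P = mat n n (\<lambda>(i, l). if l < ?m then (case f l of Inl j \<Rightarrow> int (C i j) | Inr t \<Rightarrow> N $$ (i, t)) else 0)"
      define Q where "Q = mat n n (\<lambda>(l, t). if l < ?m then
         (case f l of Inl j \<Rightarrow> (if t \<in> T then 0 else x (g t) j) | Inr t' \<Rightarrow> of_bool (t = t')) else 0)"
      have PQc: "P \<in> carrier_mat n n" "Q \<in> carrier_mat n n" by (auto simp: P_def Q_def)
      have "[N $$ (i, t) = (P * Q) $$ (i, t)] (mod int p)" if it: "i < n" "t < n" for i t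
      proof -
        let ?F = "\<lambda>k. (case k of Inl j \<Rightarrow> int (C i j) | Inr t \<Rightarrow> N $$ (i, t)) *
            (case k of Inl j \<Rightarrow> (if t \<in> T then 0 else x (g t) j) | Inr t' \<Rightarrow> of_bool (t = t'))"
        have "(P * Q) $$ (i, t) = (\<Sum>l\<in>{0..<n}. P $$ (i, l) * Q $$ (l, t))"
          using it PQc by (simp add: scalar_prod_def)
        also have "\<dots> = (\<Sum>l\<in>{0..<?m}. ?F (f l))"
          using it m by (intro sum.mono_neutral_cong_right) (auto simp: P_def Q_def)
        also have "\<dots> = (\<Sum>k\<in>?J <+> T. ?F k)" by (rule sum.reindex_bij_betw[OF f])
        also have "\<dots> = (\<Sum>j\<in>?J. int (C i j) * (if t \<in> T then 0 else x (g t) j)) + (\<Sum>t'\<in>T. N $$ (i, t') * of_bool (t = t'))"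
          by (subst sum.Plus) (auto simp: J T)
        also have "(\<Sum>t'\<in>T. N $$ (i, t') * of_bool (t = t')) = (if t \<in> T then N $$ (i, t) else 0)"
          using T by (simp add: of_bool_def if_distrib sum.delta cong: if_cong)
        finally have PQ: "(P * Q) $$ (i, t) = (\<Sum>j\<in>?J. int (C i j) * (if t \<in> T then 0 else x (g t) j)) +
           (if t \<in> T then N $$ (i, t) else 0)" .
        show ?thesis
        proof (cases "t \<in> T")
          case False
          then show ?thesis using Ax[of i "g t"] g[of t] it unfolding PQ by (simp add: N_def)
        qed (simp add: PQ)
      qed
      then have "[det N = det (P * Q)] (mod int p)" using PQc Nc by (intro cong_det) auto
      also have "det (P * Q) = 0"
        unfolding det_mult[OF PQc] using det_zero_col[OF PQc(1) m] m by (simp add: P_def)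
      finally have "int p dvd det N" by (simp add: cong_0_iff)
      then have "int p dvd int (nat \<bar>det N\<bar>)" by simp
      then show False using p(2) int_dvd_int_iff by blast
    qed
  qed
qed

section \<open>The dynamic program\<close>

definition rel :: "'a state \<Rightarrow> nat \<Rightarrow> ((nat \<Rightarrow> nat) \<Rightarrow> bool) \<Rightarrow> 'a list set" where
  "rel s k Q = {b \<in> tuples (dom_of s) (k * width). Q (num s (\<lambda>t. idx s (b ! t)))}"

text \<open>The auxiliary relations are empty initially, so a family of matrices is stored as its difference
  to the family of initial matrices \<open>F0\<close>.\<close>

definition stored :: "nat \<Rightarrow> entries \<Rightarrow> (nat \<Rightarrow> nat \<Rightarrow> nat \<Rightarrow> nat) \<Rightarrow> (nat \<Rightarrow> nat) \<Rightarrow> bool" where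
  "stored n F0 F m \<longleftrightarrow> prime (m 0) \<and> m 1 < n \<and> m 2 < n \<and> m 3 < m 0 \<and>
     (m 3 = F (m 0) (m 1) (m 2)) \<noteq> (m 3 = F0 (m 1) (m 2))"

text \<open>A rank is stored as an initial segment, so that the empty initial relation represents
  rank 0.\<close>

definition below_rank :: "(nat \<Rightarrow> nat) \<Rightarrow> (nat \<Rightarrow> nat) \<Rightarrow> bool" where
  "below_rank R m \<longleftrightarrow> prime (m 0) \<and> m 1 < R (m 0)"

definition unit_entries :: entries where
  "unit_entries i j = of_bool (i = j)"

definition null_entries :: entries where
  "null_entries i j = 0"

definition int_matrix :: "'a state \<Rightarrow> nat \<Rightarrow> nat \<Rightarrow> int" where
  "int_matrix s i j = entry (input_of s) (el s i) (el s j)"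

definition input_ok :: "'a set \<Rightarrow> ('a \<times> 'a) set \<Rightarrow> (matrix_sym, 'a) interp \<Rightarrow> bool" where
  "input_ok D L I \<longleftrightarrow> I Less = {[x, y] | x y. (x, y) \<in> L} \<and>
     I MPlus \<union> I MMinus \<subseteq> tuples D 3 \<and> I MPlus \<inter> I MMinus = {} \<and>
     (\<forall>x y a a'. [x, y, a] \<in> I MPlus \<union> I MMinus \<longrightarrow> [x, y, a'] \<in> I MPlus \<union> I MMinus \<longrightarrow> a = a')"

definition mod_ok :: "nat \<Rightarrow> (nat \<Rightarrow> nat \<Rightarrow> int) \<Rightarrow> nat \<Rightarrow> entries \<Rightarrow> entries \<Rightarrow> nat \<Rightarrow> bool" where
  "mod_ok n A p B C r \<longleftrightarrow> reduced n p B \<and> reduced n p C \<and> image_rel n p A B C \<and> generating n p B \<and>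
     pivoted n C UNIV \<and> r = card (nonzero_cols n C)"

text \<open>The invariant ties the matrices and ranks, which formulas cannot see, to the auxiliary
  relations that store them. The answer \<open>Aux 3\<close> is recomputed from the ranks at each
  change.\<close>

definition ok :: "'a state \<Rightarrow> bool" where
  "ok s \<longleftrightarrow> finite (dom_of s) \<and> dom_of s \<noteq> {} \<and> strict_order_of (dom_of s) (order_of s) \<and>
     (\<forall>S\<in>{Order, Plus, Times}. aux_of s S = initial_aux (dom_of s) (order_of s) S) \<and>
     aux_of s (Aux 0) = rel s 4 (stored (size_of s) unit_entries (basis_of s)) \<and>
     aux_of s (Aux 1) = rel s 4 (stored (size_of s) null_entries (image_of s)) \<and>
     aux_of s (Aux 2) = rel s 2 (below_rank (rank_of s)) \<and>
     input_ok (dom_of s) (order_of s) (input_of s) \<and>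
     (\<forall>p. prime p \<longrightarrow> p < range_of s \<longrightarrow>
        mod_ok (size_of s) (int_matrix s) p (basis_of s p) (image_of s p) (rank_of s p))"

text \<open>Only the vocabulary is fixed here; the update formulas are filled in once they are known
  to exist. The matrix relations hold prime, row, column and value, the rank relation prime and
  number.\<close>

definition rank_program :: "matrix_sym dyn_program" where
  "rank_program = \<lparr>aux_arities = [4 * width, 4 * width, 2 * width, 1], update = (\<lambda>_ _. undefined), answer = Aux 3\<rparr>"

definition ready :: "matrix_sym change_type \<Rightarrow> 'a state \<Rightarrow> bool" where
  "ready \<delta> s \<longleftrightarrow> ok s \<and> changed_of s \<in> tuples (dom_of s) 3 \<and> matrix_allowed (input_of s) \<delta> (changed_of s)"

definition row_of :: "'a state \<Rightarrow> nat" where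
  "row_of s = idx s (changed_of s ! 0)"

definition col_of :: "'a state \<Rightarrow> nat" where
  "col_of s = idx s (changed_of s ! 1)"

definition val_of :: "'a state \<Rightarrow> nat" where
  "val_of s = idx s (changed_of s ! 2) + 1"

text \<open>Allowed insertions hit an entry that is 0. A deletion may name a triple that is absent,
  and then changes nothing.\<close>

fun entry_change :: "matrix_sym change_type \<Rightarrow> 'a state \<Rightarrow> int" where
  "entry_change (Insert MPlus) s = int (val_of s)"
| "entry_change (Insert MMinus) s = - int (val_of s)"
| "entry_change (Delete MPlus) s = (if changed_of s \<in> input_of s MPlus then - int (val_of s) else 0)"
| "entry_change (Delete MMinus) s = (if changed_of s \<in> input_of s MMinus then int (val_of s) else 0)"
| "entry_change _ s = 0"

definition residue_change :: "matrix_sym change_type \<Rightarrow> 'a state \<Rightarrow> nat \<Rightarrow> nat" where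
  "residue_change \<delta> s p = nat (entry_change \<delta> s mod int p)"

text \<open>The suffixes count the stages of one update: 1 after the change of row \<open>a\<close>,
  2 and 3 after the first and second elimination round. The basis is not affected by the first
  stage.\<close>

definition image1 where
  "image1 \<delta> s p = add_row p (row_of s) (col_of s) (residue_change \<delta> s p) (basis_of s p) (image_of s p)"

definition sel1 where
  "sel1 \<delta> s p = sel_row (size_of s) (row_of s) (image1 \<delta> s p)"

definition image2 where
  "image2 \<delta> s p = pivot (size_of s) p (sel1 \<delta> s p) (image1 \<delta> s p) (image1 \<delta> s p)"

definition basis2 where
  "basis2 \<delta> s p = pivot (size_of s) p (sel1 \<delta> s p) (image1 \<delta> s p) (basis_of s p)"

definition sel2 where
  "sel2 \<delta> s p = sel_col (size_of s) (image2 \<delta> s p)"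

definition image3 where
  "image3 \<delta> s p = pivot (size_of s) p (sel2 \<delta> s p) (image2 \<delta> s p) (image2 \<delta> s p)"

definition basis3 where
  "basis3 \<delta> s p = pivot (size_of s) p (sel2 \<delta> s p) (image2 \<delta> s p) (basis2 \<delta> s p)"

definition rank3 where
  "rank3 \<delta> s p =
     (let X = nonzero_cols (size_of s) (image_of s p); Y = nonzero_cols (size_of s) (image3 \<delta> s p)
      in if Y \<subseteq> X then (if X \<subseteq> Y then rank_of s p else rank_of s p - 1)
         else (if X \<subseteq> Y then rank_of s p + 1 else rank_of s p))"

text \<open>Over one element there is a single triple. After a deletion the entry is nonzero iff the
  other relation contains that triple; after an allowed insertion it is always nonzero.\<close>

fun singleton_answer :: "matrix_sym change_type \<Rightarrow> 'a state \<Rightarrow> bool" where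
  "singleton_answer (Delete MPlus) s = (changed_of s \<in> input_of s MMinus)"
| "singleton_answer (Delete MMinus) s = (changed_of s \<in> input_of s MPlus)"
| "singleton_answer _ s = True"

text \<open>If the domain has a single element, there is no prime below \<open>range_of s = 1\<close>.\<close>

definition is_answer :: "matrix_sym change_type \<Rightarrow> 'a state \<Rightarrow> nat \<Rightarrow> bool" where
  "is_answer \<delta> s r \<longleftrightarrow>
     (if size_of s = 1 then singleton_answer \<delta> s
      else (\<exists>p<range_of s. prime p \<and> r < rank3 \<delta> s p) \<and>
        (\<forall>r'<range_of s. r < r' \<longrightarrow> \<not> (\<exists>p<range_of s. prime p \<and> r' < rank3 \<delta> s p)))"

text \<open>The parameter \<open>ty\<close> only fixes the type of the elements.\<close>

locale change =
  fixes \<delta> :: "matrix_sym change_type" and ty :: "'a itself"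
  assumes changed_sym: "changed_sym \<delta> \<noteq> Less"

sublocale change \<subseteq> fo rank_program "ready \<delta> :: 'a state \<Rightarrow> bool"
  by unfold_locales (auto simp: ready_def ok_def arith_def)

context change
begin

lemmas bdef_logic = bdef_neg bdef_conj bdef_disj bdef_imp bdef_ex bdef_all bdef_eq bdef_less_var bdef_less_size
lemmas tm_intros = tm_zero tm_one tm_var tm_size tm_add tm_mult

lemma ready_mod_ok:
  "ready \<delta> s \<Longrightarrow> prime p \<Longrightarrow> p < range_of s \<Longrightarrow>
     mod_ok (size_of s) (int_matrix s) p (basis_of s p) (image_of s p) (rank_of s p)"
  by (simp add: ready_def ok_def)

lemma bdef_input:
  assumes "R \<noteq> Less"
  shows "bdef k (\<lambda>s m. changed_of s \<in> input_of s R)"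
  unfolding bdef_def
proof (rule fodefI[of "Atom (Inl R) [0, 1, 2]"])
  fix s :: "'a state" and v :: "nat \<Rightarrow> nat" assume "ready \<delta> s"
  then have "length (changed_of s) = 3" by (rule length_changed[OF G_arith])
  then obtain x y z where "changed_of s = [x, y, z]"
    by (auto simp: numeral_3_eq_3 length_Suc_conv)
  then have "map (env s v) [0, 1, 2] = changed_of s" by (simp add: env_def)
  then show "sem s v (Atom (Inl R) [0, 1, 2]) = (changed_of s \<in> input_of s R)"
    by (simp del: list.map)
qed (use assms in \<open>cases R; auto\<close>)+

lemma bdef_aux:
  assumes q: "q < 3" "aux_arities rank_program ! q = k * width"
    and aux: "\<And>s :: 'a state. ready \<delta> s \<Longrightarrow> aux_of s (Aux q) = rel s k (Q s)"
    and Q: "\<And>(s :: 'a state) m m'. (\<And>i. i < k \<Longrightarrow> m i = m' i) \<Longrightarrow> Q s m = Q s m'"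
  shows "bdef k Q"
  unfolding bdef_def
proof (rule fodefI[of "Atom (Inr (Aux q)) [3..<3 + k * width]"])
  show "wff (Atom (Inr (Aux q)) [3..<3 + k * width])"
    using q by (auto simp: aux_syms_def rank_program_def)
  fix s :: "'a state" and v :: "nat \<Rightarrow> nat"
  assume G: "ready \<delta> s" and v: "\<forall>i<k * width. v i < size_of s"
  have map: "map (env s v) [3..<3 + k * width] = map (\<lambda>i. el s (v i)) [0..<k * width]"
    by (rule nth_equalityI) (auto simp: env_def)
  let ?b = "map (\<lambda>i. el s (v i)) [0..<k * width]"
  have "idx s (?b ! t) = v t" if "t < k * width" for t
    using that v idx_el[OF G_arith[OF G]] by simp
  then have "num s (\<lambda>t. idx s (?b ! t)) i = num s v i" if "i < k" for i
    unfolding num_def using that index_less by (intro sum.cong refl) auto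
  then have "Q s (num s (\<lambda>t. idx s (?b ! t))) = Q s (num s v)" by (rule Q)
  moreover have "?b \<in> tuples (dom_of s) (k * width)"
    using v el_in[OF G_arith[OF G]] by (auto simp: tuples_def)
  ultimately show "sem s v (Atom (Inr (Aux q)) [3..<3 + k * width]) = Q s (num s v)"
    unfolding sat.simps map by (simp add: aux[OF G] rel_def)
qed auto

lemma bdef_row_of: "i < k \<Longrightarrow> bdef k (\<lambda>s m. m i = row_of s)"
  unfolding row_of_def by (rule bdef_changed) auto

lemma bdef_col_of: "i < k \<Longrightarrow> bdef k (\<lambda>s m. m i = col_of s)"
  unfolding col_of_def by (rule bdef_changed) auto

lemma bdef_val_idx: "i < k \<Longrightarrow> bdef k (\<lambda>s m. m i = idx s (changed_of s ! 2))"
  by (rule bdef_changed) auto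

lemma bdef_prime: 
  assumes "i < k"
  shows "bdef k (\<lambda>(s :: 'a state) m. prime (m i))"
proof -
  let ?Q = "\<lambda>(s :: 'a state) m.
      1 < m 0 \<and> (\<forall>x<range_of s. \<forall>y<range_of s. x * y = m 0 \<longrightarrow> x = 1 \<or> y = 1)"
  have "bdef 1 ?Q"
    by (intro bdef_logic tm_intros) auto
  then have "bdef 1 (\<lambda>(s :: 'a state) m. prime (m 0))"
  proof (rule bdef_cong)
    fix s :: "'a state" and m :: "nat \<Rightarrow> nat" assume "\<forall>i<1. m i < range_of s"
    then have m: "m 0 < range_of s" by simp
    show "?Q s m = prime (m 0)"
    proof
      assume l: "1 < m 0 \<and> (\<forall>x<range_of s. \<forall>y<range_of s. x * y = m 0 \<longrightarrow> x = 1 \<or> y = 1)"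
      show "prime (m 0)"
        unfolding prime_nat_iff
      proof (intro conjI allI impI)
        fix x assume "x dvd m 0"
        then obtain y where y: "m 0 = x * y" by (auto elim: dvdE)
        with l have "x \<noteq> 0" "y \<noteq> 0" by (metis mult_is_0 not_less_zero)+
        then have "x \<le> m 0" "y \<le> m 0" using y by auto
        with l m y show "x = 1 \<or> x = m 0" by (metis le_less_trans mult.right_neutral)
      qed (use l in simp)
    next
      assume "prime (m 0)"
      then show "1 < m 0 \<and> (\<forall>x<range_of s. \<forall>y<range_of s. x * y = m 0 \<longrightarrow> x = 1 \<or> y = 1)"
        by (metis prime_gt_1_nat prime_product)
    qed
  qed
  then show ?thesis using bdef_rename[of 1 "\<lambda>(s :: 'a state) m. prime (m 0)" "\<lambda>_. i" k] assms by simp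
qed

section \<open>Definability of the updated matrices\<close>

definition val_rel :: "('a state \<Rightarrow> nat \<Rightarrow> nat \<Rightarrow> nat \<Rightarrow> nat) \<Rightarrow> 'a state \<Rightarrow> nat \<Rightarrow> nat \<Rightarrow> nat \<Rightarrow> nat \<Rightarrow> bool" where
  "val_rel F s p i j x \<longleftrightarrow> prime p \<and> i < size_of s \<and> j < size_of s \<and> x = F s p i j"

text \<open>The bound by \<open>p\<close> ensures that each entry is a number over which formulas
  can quantify.\<close>

definition dfun :: "('a state \<Rightarrow> nat \<Rightarrow> nat \<Rightarrow> nat \<Rightarrow> nat) \<Rightarrow> bool" where
  "dfun F \<longleftrightarrow> bdef 4 (\<lambda>(s :: 'a state) m. val_rel F s (m 0) (m 1) (m 2) (m 3)) \<and>
     (\<forall>(s :: 'a state) p. ready \<delta> s \<longrightarrow> prime p \<longrightarrow> p < range_of s \<longrightarrow> reduced (size_of s) p (F s p))"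

lemma bdef_val_rel:
  "dfun F \<Longrightarrow> a < k \<Longrightarrow> b < k \<Longrightarrow> c < k \<Longrightarrow> d < k \<Longrightarrow> bdef k (\<lambda>s m. val_rel F s (m a) (m b) (m c) (m d))"
  unfolding dfun_def by (rule bdef_rename4[where Q = "val_rel F"]) auto

lemma dfun_less:
  "dfun F \<Longrightarrow> ready \<delta> s \<Longrightarrow> prime p \<Longrightarrow> p < range_of s \<Longrightarrow> i < size_of s \<Longrightarrow> j < size_of s \<Longrightarrow> F s p i j < p"
  unfolding dfun_def reduced_def by blast

text \<open>Taking the symmetric difference with the graph of \<open>F0\<close> a second time
  recovers the graph of \<open>F\<close>.\<close>

lemma dfun_stored:
  assumes q: "q < 3" "aux_arities rank_program ! q = 4 * width"
    and aux: "\<And>s :: 'a state. ready \<delta> s \<Longrightarrow> aux_of s (Aux q) = rel s 4 (stored (size_of s) F0 (F s))"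
    and F0: "bdef 4 (\<lambda>s m. m 3 = F0 (m 1) (m 2))"
    and red: "\<And>(s :: 'a state) p. ready \<delta> s \<Longrightarrow> prime p \<Longrightarrow> p < range_of s \<Longrightarrow> reduced (size_of s) p (F s p)"
  shows "dfun F"
  unfolding dfun_def
proof (intro conjI allI impI)
  have st: "bdef 4 (\<lambda>s. stored (size_of s) F0 (F s))"
    using q aux by (rule bdef_aux) (simp_all add: stored_def)
  have "bdef 4 (\<lambda>s m. prime (m 0) \<and> m 1 < size_of s \<and> m 2 < size_of s \<and> m 3 < m 0 \<and>
     (stored (size_of s) F0 (F s) m \<longleftrightarrow> \<not> m 3 = F0 (m 1) (m 2)))"
    by (intro bdef_logic bdef_prime bdef_iff st F0 tm_intros) auto
  then show "bdef 4 (\<lambda>s m. val_rel F s (m 0) (m 1) (m 2) (m 3))"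
  proof (rule bdef_cong)
    fix s :: "'a state" and m :: "nat \<Rightarrow> nat" assume G: "ready \<delta> s" and "\<forall>i<4. m i < range_of s"
    then have "m 0 < range_of s" by simp
    with red[OF G, of "m 0"] show "(prime (m 0) \<and> m 1 < size_of s \<and> m 2 < size_of s \<and> m 3 < m 0 \<and>
     (stored (size_of s) F0 (F s) m \<longleftrightarrow> \<not> m 3 = F0 (m 1) (m 2))) = val_rel F s (m 0) (m 1) (m 2) (m 3)"
      by (auto simp: val_rel_def stored_def reduced_def)
  qed
qed (rule red)

lemma bdef_unit_entries: "bdef 4 (\<lambda>s m. m 3 = unit_entries (m 1) (m 2))"
proof (rule bdef_cong)
  show "bdef 4 (\<lambda>s m. m 1 = m 2 \<and> m 3 = 1 \<or> m 1 \<noteq> m 2 \<and> m 3 = 0)"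
    by (intro bdef_logic tm_intros) auto
qed (auto simp: unit_entries_def)

lemma bdef_null_entries: "bdef 4 (\<lambda>s m. m 3 = null_entries (m 1) (m 2))"
  unfolding null_entries_def by (intro bdef_logic tm_intros) auto

lemma dfun_basis: "dfun basis_of"
  by (rule dfun_stored[where q = 0, OF _ _ _ bdef_unit_entries])
    (use ready_mod_ok in \<open>auto simp: ready_def ok_def rank_program_def mod_ok_def\<close>)

lemma dfun_image: "dfun image_of"
  by (rule dfun_stored[where q = 1, OF _ _ _ bdef_null_entries])
    (use ready_mod_ok in \<open>auto simp: ready_def ok_def rank_program_def mod_ok_def\<close>)

text \<open>Congruence by an explicit quotient. Since the quotient must be in range, this is
  faithful only for \<open>t\<close> below \<open>p * range_of s\<close>.\<close>

definition mod_eq :: "'a state \<Rightarrow> nat \<Rightarrow> nat \<Rightarrow> nat \<Rightarrow> bool" where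
  "mod_eq s p t x \<longleftrightarrow> (\<exists>q<range_of s. t = p * q + x)"

lemma bdef_mod_eq: "tm k t \<Longrightarrow> i < k \<Longrightarrow> tm k u \<Longrightarrow> bdef k (\<lambda>s m. mod_eq s (m i) (t s m) (u s m))"
  unfolding mod_eq_def
proof (rule bdef_ex, rule bdef_eq)
  assume t: "tm k t" and i: "i < k" and u: "tm k u"
  show "tm (Suc k) (\<lambda>s m. m i * m k + u s m)"
    using i u by (intro tm_intros tm_mono[OF u]) auto
  show "tm (Suc k) (\<lambda>s v. t s v)" by (rule tm_mono[OF t]) auto
  have "(m(k := x)) i = m i" for m :: "nat \<Rightarrow> nat" and x using i by auto
  then show "(t s (m(k := x)) = (m(k := x)) i * y + u s (m(k := x))) = (t s m = m i * y + u s m)"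
    for s :: "'a state" and m x y
    by (simp only: tm_upd[OF t le_refl] tm_upd[OF u le_refl])
qed

lemma mod_eq_iff:
  assumes "prime p" "p < range_of s" "t < p * range_of s"
  shows "mod_eq s p t x \<longleftrightarrow> x \<le> t \<and> p dvd t - x"
proof
  assume "x \<le> t \<and> p dvd t - x"
  then obtain q where q: "t = p * q + x" by (auto elim!: dvdE) (metis le_add_diff_inverse2)
  then have "p * q < p * range_of s" using assms by linarith
  with q show "mod_eq s p t x" by (auto simp: mod_eq_def)
qed (auto simp: mod_eq_def)

text \<open>The expression is at most (p - 1) (p - 1) + (p - 1) = p (p - 1), so its quotient by
  \<open>p\<close> is in range.\<close>

lemma mod_eq_add_mult:
  assumes "prime p" "p < range_of s" "a < p" "b < p" "c < p"
  shows "x < p \<and> mod_eq s p (a + b * c) x \<longleftrightarrow> x = (a + b * c) mod p"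
proof -
  have "b * c \<le> (p - 1) * (p - 1)" using assms by (intro mult_mono) auto
  moreover have "(p - 1) * (p - 1) + (p - 1) = p * (p - 1)" using assms by (cases p) auto
  moreover have "p * (p - 1) < p * range_of s" using assms by (intro mult_strict_left_mono) auto
  ultimately have "a + b * c < p * range_of s" using assms by linarith
  note * = mod_eq_iff[OF assms(1,2) this]
  show ?thesis
  proof
    assume x: "x < p \<and> mod_eq s p (a + b * c) x"
    then have "(a + b * c) mod p = x mod p" using * mod_eq_dvd_iff_nat[of x "a + b * c" p] by auto
    with x show "x = (a + b * c) mod p" by simp
  next
    assume x: "x = (a + b * c) mod p"
    then have "x < p" using assms by simp
    moreover have "x \<le> a + b * c" "p dvd a + b * c - x" unfolding x by (rule mod_less_eq_dividend, rule dvd_minus_mod)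
    ultimately show "x < p \<and> mod_eq s p (a + b * c) x" using * by blast
  qed
qed

end

context change
begin

definition residue_rel :: "'a state \<Rightarrow> nat \<Rightarrow> nat \<Rightarrow> bool" where
  "residue_rel s p x \<longleftrightarrow> prime p \<and> x = residue_change \<delta> s p"

lemma val_of_le:
  fixes s :: "'a state"
  assumes "ready \<delta> s"
  shows "val_of s \<le> size_of s"
  unfolding val_of_def using idx_less[OF G_arith changed_in, OF assms G_arith[OF assms], of 2] by simp

text \<open>A negative value needs no subtraction: its residue is the \<open>x < p\<close> for which
  \<open>p\<close> divides \<open>val_of s + x\<close>.\<close>

lemma mod_eq_val:
  assumes G: "ready \<delta> s" and p: "prime p" "p < range_of s"
  shows "x < p \<and> mod_eq s p (val_of s) x \<longleftrightarrow> x = nat (int (val_of s) mod int p)"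
    and "x < p \<and> mod_eq s p (val_of s + x) 0 \<longleftrightarrow> x = nat (- int (val_of s) mod int p)"
proof -
  have p2: "2 \<le> p" using p prime_ge_2_nat by blast
  have "2 * range_of s \<le> p * range_of s" using p2 by (rule mult_le_mono1)
  then have b: "val_of s + p < p * range_of s"
    using val_of_le[OF G] size_le_range[OF G] p by linarith
  have 1: "x < p \<and> mod_eq s p (val_of s) x \<longleftrightarrow> x = val_of s mod p"
  proof
    assume "x < p \<and> mod_eq s p (val_of s) x"
    then show "x = val_of s mod p"
      using mod_eq_iff[OF p, of "val_of s" x] b mod_eq_dvd_iff_nat[of x "val_of s" p] by auto
  next
    assume x: "x = val_of s mod p"
    have "x < p" "x \<le> val_of s" "p dvd val_of s - x"
      unfolding x using p2 by (auto intro: mod_less_eq_dividend dvd_minus_mod)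
    then show "x < p \<and> mod_eq s p (val_of s) x" using mod_eq_iff[OF p, of "val_of s" x] b by auto
  qed
  have "nat (int (val_of s) mod int p) = val_of s mod p" by (simp flip: of_nat_mod)
  with 1 show "x < p \<and> mod_eq s p (val_of s) x \<longleftrightarrow> x = nat (int (val_of s) mod int p)" by simp
  show "x < p \<and> mod_eq s p (val_of s + x) 0 \<longleftrightarrow> x = nat (- int (val_of s) mod int p)"
  proof
    assume x: "x < p \<and> mod_eq s p (val_of s + x) 0"
    then have "p dvd val_of s + x" using mod_eq_iff[OF p, of "val_of s + x" 0] b by simp
    then have "int p dvd int (val_of s + x)" by (simp only: of_nat_dvd_iff)
    then have "int p dvd int x - (- int (val_of s))" by (simp add: add.commute)
    then have "int x mod int p = - int (val_of s) mod int p" by (simp only: mod_eq_dvd_iff)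
    with x show "x = nat (- int (val_of s) mod int p)" by (metis mod_less nat_int zmod_int)
  next
    assume x: "x = nat (- int (val_of s) mod int p)"
    have x': "int x = - int (val_of s) mod int p" unfolding x using p2 by simp
    moreover have "- int (val_of s) mod int p < int p" using p2 by simp
    ultimately have "x < p" by simp
    have "int x mod int p = - int (val_of s) mod int p" unfolding x' by simp
    then have "int p dvd int x - (- int (val_of s))" by (simp only: mod_eq_dvd_iff)
    then have "int p dvd int (val_of s + x)" by (simp add: add.commute)
    then have "p dvd val_of s + x" by (simp only: of_nat_dvd_iff)
    with \<open>x < p\<close> show "x < p \<and> mod_eq s p (val_of s + x) 0"
      using mod_eq_iff[OF p, of "val_of s + x" 0] b by simp
  qed
qed

text \<open>On a one-element domain \<open>val_of s\<close> equals \<open>range_of s\<close> and is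
  not in range, so formulas quantify over its predecessor.\<close>

lemma ex_val_iff:
  fixes s :: "'a state"
  assumes G: "ready \<delta> s"
  shows "(\<exists>u<range_of s. u = idx s (changed_of s ! 2) \<and> R (u + 1)) \<longleftrightarrow> R (val_of s)"
proof -
  have "idx s (changed_of s ! 2) < range_of s"
    using idx_less[OF G_arith changed_in, OF G G_arith[OF G], of 2] size_le_range[OF G] by simp
  then show ?thesis by (auto simp: val_of_def)
qed

lemma bdef_residue2: "bdef 2 (\<lambda>s m. residue_rel s (m 0) (m 1))"
proof -
  let ?pos = "\<lambda>s m. m 1 < m 0 \<and> (\<exists>u<range_of s. u = idx s (changed_of s ! 2) \<and> mod_eq s (m 0) (u + 1) (m 1))"
  let ?neg = "\<lambda>s m. m 1 < m 0 \<and> (\<exists>u<range_of s. u = idx s (changed_of s ! 2) \<and> mod_eq s (m 0) (u + 1 + m 1) 0)"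
  have pos: "bdef 2 ?pos"
    by (intro bdef_logic bdef_val_idx bdef_mod_eq tm_intros) auto
  have neg: "bdef 2 ?neg"
    by (intro bdef_logic bdef_val_idx bdef_mod_eq tm_intros) auto
  have pos_iff: "?pos s m \<longleftrightarrow> m 1 = nat (int (val_of s) mod int (m 0))"
    and neg_iff: "?neg s m \<longleftrightarrow> m 1 = nat (- int (val_of s) mod int (m 0))"
    if "ready \<delta> s" "\<forall>i<2. m i < range_of s" "prime (m 0)" for s :: "'a state" and m :: "nat \<Rightarrow> nat"
    using ex_val_iff[OF that(1), of "\<lambda>u. mod_eq s (m 0) u (m 1)"]
      ex_val_iff[OF that(1), of "\<lambda>u. mod_eq s (m 0) (u + m 1) 0"] mod_eq_val[OF that(1,3), of "m 1"] that(2)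
    by simp_all
  have zero: "bdef 2 (\<lambda>s m. m 1 = 0)" by (intro bdef_logic tm_intros) auto
  consider "\<delta> = Insert MPlus" | "\<delta> = Insert MMinus" | "\<delta> = Delete MPlus" | "\<delta> = Delete MMinus"
  proof -
    have "changed_sym \<delta> = MPlus \<or> changed_sym \<delta> = MMinus" using changed_sym by (cases "changed_sym \<delta>") auto
    then show ?thesis using that by (cases \<delta>) auto
  qed
  then show ?thesis
  proof cases
    case 1
    then have ec: "entry_change \<delta> s = int (val_of s)" for s :: "'a state" by simp
    have "bdef 2 (\<lambda>s m. prime (m 0) \<and> ?pos s m)" by (intro bdef_conj[OF bdef_prime] pos) auto
    then show ?thesis by (rule bdef_cong) (use pos_iff in \<open>auto simp: residue_rel_def residue_change_def ec\<close>)
  next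
    case 2
    then have ec: "entry_change \<delta> s = - int (val_of s)" for s :: "'a state" by simp
    have "bdef 2 (\<lambda>s m. prime (m 0) \<and> ?neg s m)" by (intro bdef_conj[OF bdef_prime] neg) auto
    then show ?thesis by (rule bdef_cong) (use neg_iff in \<open>auto simp: residue_rel_def residue_change_def ec\<close>)
  next
    case 3
    then have ec: "entry_change \<delta> s = (if changed_of s \<in> input_of s MPlus then - int (val_of s) else 0)"
      for s :: "'a state" by simp
    have "bdef 2 (\<lambda>s m. prime (m 0) \<and>
       ((changed_of s \<in> input_of s MPlus \<and> ?neg s m) \<or> (\<not> changed_of s \<in> input_of s MPlus \<and> m 1 = 0)))"
      by (intro bdef_conj[OF bdef_prime] bdef_disj bdef_conj[OF bdef_input neg]
          bdef_conj[OF bdef_neg[OF bdef_input] zero]) auto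
    then show ?thesis by (rule bdef_cong) (use neg_iff in \<open>auto simp: residue_rel_def residue_change_def ec\<close>)
  next
    case 4
    then have ec: "entry_change \<delta> s = (if changed_of s \<in> input_of s MMinus then int (val_of s) else 0)"
      for s :: "'a state" by simp
    have "bdef 2 (\<lambda>s m. prime (m 0) \<and>
       ((changed_of s \<in> input_of s MMinus \<and> ?pos s m) \<or> (\<not> changed_of s \<in> input_of s MMinus \<and> m 1 = 0)))"
      by (intro bdef_conj[OF bdef_prime] bdef_disj bdef_conj[OF bdef_input pos]
          bdef_conj[OF bdef_neg[OF bdef_input] zero]) auto
    then show ?thesis by (rule bdef_cong) (use pos_iff in \<open>auto simp: residue_rel_def residue_change_def ec\<close>)
  qed
qed

lemma bdef_residue: "i < k \<Longrightarrow> j < k \<Longrightarrow> bdef k (\<lambda>s m. residue_rel s (m i) (m j))"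
  by (rule bdef_rename2[where Q = residue_rel, OF bdef_residue2])

lemma residue_change_less: "0 < p \<Longrightarrow> residue_change \<delta> s p < p"
  by (simp add: residue_change_def nat_less_iff)

lemma ex_val_rel_iff:
  assumes "dfun F" "ready \<delta> s" "p < range_of s"
  shows "(\<exists>x<range_of s. val_rel F s p i j x \<and> R x) \<longleftrightarrow>
    prime p \<and> i < size_of s \<and> j < size_of s \<and> R (F s p i j)"
  using dfun_less[OF assms(1,2) _ assms(3), of i j] assms(3) unfolding val_rel_def
  by (auto intro: less_trans)

lemma dfun_image1: "dfun (image1 \<delta>)"
  unfolding dfun_def
proof (intro conjI allI impI)
  let ?Q = "\<lambda>(s :: 'a state) m.
      prime (m 0) \<and> m 1 < size_of s \<and> m 2 < size_of s \<and>
      (m 1 = row_of s \<and>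
      (\<exists>x<range_of s. val_rel image_of s (m 0) (m 1) (m 2) x \<and>
      (\<exists>b<range_of s. b = col_of s \<and> 
      (\<exists>y<range_of s. val_rel basis_of s (m 0) b (m 2) y \<and>
      (\<exists>d<range_of s. residue_rel s (m 0) d \<and> m 3 < m 0 \<and> mod_eq s (m 0) (x + d * y) (m 3)))))
      \<or> m 1 \<noteq> row_of s \<and> val_rel image_of s (m 0) (m 1) (m 2) (m 3))"
  have "bdef 4 ?Q"
    by (intro bdef_logic bdef_prime bdef_row_of bdef_col_of bdef_residue bdef_mod_eq
        bdef_val_rel[OF dfun_image] bdef_val_rel[OF dfun_basis] tm_intros) auto
  then show "bdef 4 (\<lambda>s m. val_rel (image1 \<delta>) s (m 0) (m 1) (m 2) (m 3))"
  proof (rule bdef_cong)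
    fix s :: "'a state" and m :: "nat \<Rightarrow> nat" assume G: "ready \<delta> s" and "\<forall>i<4. m i < range_of s"
    then have p: "m 0 < range_of s" by simp
    have c: "col_of s < size_of s" 
      unfolding col_of_def using idx_less[OF G_arith changed_in, OF G G_arith[OF G], of 1] by simp
    then have cr: "col_of s < range_of s" using size_le_range[OF G] by simp
    have res: "(\<exists>d<range_of s. residue_rel s (m 0) d \<and> R d) \<longleftrightarrow> prime (m 0) \<and> R (residue_change \<delta> s (m 0))" for R
      using residue_change_less[of "m 0" s] p by (auto simp: residue_rel_def prime_gt_0_nat intro: less_trans)
    have col: "(\<exists>b<range_of s. b = col_of s \<and> R b) \<longleftrightarrow> R (col_of s)" for R using cr by blast
    have "(m 3 < m 0 \<and> mod_eq s (m 0) (image_of s (m 0) (m 1) (m 2) +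
          residue_change \<delta> s (m 0) * basis_of s (m 0) (col_of s) (m 2)) (m 3)) \<longleftrightarrow>
       m 3 = (image_of s (m 0) (m 1) (m 2) + residue_change \<delta> s (m 0) * basis_of s (m 0) (col_of s) (m 2)) mod m 0"
      if "prime (m 0)" "m 1 < size_of s" "m 2 < size_of s"
      using that p c G dfun_less[OF dfun_image, of s "m 0"] dfun_less[OF dfun_basis, of s "m 0"]
        residue_change_less[of "m 0" s]
      by (intro mod_eq_add_mult) (auto simp: prime_gt_0_nat)
    then show "?Q s m = val_rel (image1 \<delta>) s (m 0) (m 1) (m 2) (m 3)"
      unfolding ex_val_rel_iff[OF dfun_image G p] ex_val_rel_iff[OF dfun_basis G p] res col
      using c by (auto simp: val_rel_def image1_def add_row_def)
  qed
next
  fix s :: "'a state" and p assume "ready \<delta> s" "prime p" "p < range_of s"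
  with dfun_image show "reduced (size_of s) p (image1 \<delta> s p)"
    unfolding dfun_def reduced_def image1_def add_row_def by (auto simp: prime_gt_0_nat)
qed

definition pair_rel :: "('a state \<Rightarrow> nat \<Rightarrow> nat \<Rightarrow> nat \<Rightarrow> bool) \<Rightarrow> 'a state \<Rightarrow> nat \<Rightarrow> nat \<Rightarrow> nat \<Rightarrow> bool" where
  "pair_rel S s p i j \<longleftrightarrow> prime p \<and> i < size_of s \<and> j < size_of s \<and> S s p i j"

definition dsel :: "('a state \<Rightarrow> nat \<Rightarrow> nat \<Rightarrow> nat \<Rightarrow> bool) \<Rightarrow> bool" where
  "dsel S \<longleftrightarrow> bdef 3 (\<lambda>s m. pair_rel S s (m 0) (m 1) (m 2))"

lemma bdef_pair_rel:
  "dsel S \<Longrightarrow> a < k \<Longrightarrow> b < k \<Longrightarrow> c < k \<Longrightarrow> bdef k (\<lambda>s m. pair_rel S s (m a) (m b) (m c))"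
  unfolding dsel_def by (rule bdef_rename3[where Q = "pair_rel S"])

lemma dsel_nonzero:
  assumes "dfun F"
  shows "dsel (\<lambda>s p i j. F s p i j \<noteq> 0)"
  unfolding dsel_def
proof (rule bdef_cong)
  let ?Q = "\<lambda>(s :: 'a state) m.
      \<exists>x<range_of s. val_rel F s (m 0) (m 1) (m 2) x \<and> x \<noteq> 0"
  show "bdef 3 ?Q"
    by (intro bdef_logic bdef_val_rel[OF assms] tm_intros) auto
  show "?Q s m = pair_rel (\<lambda>s p i j. F s p i j \<noteq> 0) s (m 0) (m 1) (m 2)"
    if "ready \<delta> s" "\<forall>i<3. m i < range_of s" for s :: "'a state" and m :: "nat \<Rightarrow> nat"
    using ex_val_rel_iff[OF assms that(1), of "m 0" "m 1" "m 2" "\<lambda>x. x \<noteq> 0"] that by (simp add: pair_rel_def)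
qed

lemma dsel_first_pair:
  assumes "dsel S"
  shows "dsel (\<lambda>s p. first_pair (size_of s) (S s p))"
  unfolding dsel_def
proof (rule bdef_cong)
  let ?Q = "\<lambda>(s :: 'a state) m.
      pair_rel S s (m 0) (m 1) (m 2) \<and>
      (\<forall>i<range_of s. \<forall>j<range_of s. pair_rel S s (m 0) i j \<longrightarrow> m 1 < i \<or> m 1 = i \<and> \<not> j < m 2)"
  show "bdef 3 ?Q"
    by (intro bdef_logic bdef_pair_rel[OF assms] tm_intros) auto
  show "?Q s m = pair_rel (\<lambda>s p. first_pair (size_of s) (S s p)) s (m 0) (m 1) (m 2)"
    if "ready \<delta> s" for s :: "'a state" and m :: "nat \<Rightarrow> nat"
    using size_le_range[OF that] unfolding pair_rel_def first_pair_def not_less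
    by (meson less_le_trans)
qed

text \<open>The multiplier is guessed, not computed: by \<open>coef_unique\<close> it is the only
  \<open>l < p\<close> such that \<open>p\<close> divides \<open>l * c + d\<close>. Each new entry
  then depends on boundedly many old ones. The last premise makes the pivot entry
  invertible.\<close>

lemma dfun_pivot:
  assumes C: "dfun C" and W: "dfun W" and S: "dsel S"
    and nz: "\<And>s p i j. S s p i j \<Longrightarrow> C s p i j \<noteq> 0"
  shows "dfun (\<lambda>s p. pivot (size_of s) p (S s p) (C s p) (W s p))"
  unfolding dfun_def
proof (intro conjI allI impI)
  let ?S = "\<lambda>s p. first_pair (size_of s) (S s p)"
  note S' = dsel_first_pair[OF S]
  let ?Q = "\<lambda>s m.
     (\<exists>i<range_of s. \<exists>j<range_of s. pair_rel ?S s (m 0) i j \<and>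
        (m 2 = j \<and> val_rel W s (m 0) (m 1) (m 2) (m 3) \<or>
         m 2 \<noteq> j \<and>
         (\<exists>c<range_of s. val_rel C s (m 0) i j c \<and>
         (\<exists>d<range_of s. val_rel C s (m 0) i (m 2) d \<and>
         (\<exists>x<range_of s. val_rel W s (m 0) (m 1) (m 2) x \<and>
         (\<exists>y<range_of s. val_rel W s (m 0) (m 1) j y \<and>
         (\<exists>l<range_of s. l < m 0 \<and> mod_eq s (m 0) (l * c + d) 0 \<and>
            m 3 < m 0 \<and> mod_eq s (m 0) (x + l * y) (m 3))))))))
     \<or> \<not> (\<exists>i<range_of s. \<exists>j<range_of s. pair_rel ?S s (m 0) i j) \<and> val_rel W s (m 0) (m 1) (m 2) (m 3)"
  have "bdef 4 ?Q"
    by (intro bdef_logic bdef_pair_rel[OF S'] bdef_val_rel[OF C] bdef_val_rel[OF W] bdef_mod_eq tm_intros) auto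
  then show "bdef 4 (\<lambda>s m. val_rel (\<lambda>s p. pivot (size_of s) p (S s p) (C s p) (W s p)) s (m 0) (m 1) (m 2) (m 3))"
  proof (rule bdef_cong)
    fix s :: "'a state" and m :: "nat \<Rightarrow> nat" assume G: "ready \<delta> s" and "\<forall>i<4. m i < range_of s"
    then have p: "m 0 < range_of s" by simp
    note ex = ex_val_rel_iff[OF C G p] ex_val_rel_iff[OF W G p]
    show "?Q s m = val_rel (\<lambda>s p. pivot (size_of s) p (S s p) (C s p) (W s p)) s (m 0) (m 1) (m 2) (m 3)"
    proof (cases "prime (m 0) \<and> (\<exists>i j. first_pair (size_of s) (S s (m 0)) i j)")
      case True
      then obtain i j where ij: "first_pair (size_of s) (S s (m 0)) i j" and pr: "prime (m 0)" by blast
      then have ij': "i < size_of s" "j < size_of s" "C s (m 0) i j \<noteq> 0"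
        using nz[of s "m 0" i j] unfolding first_pair_def by blast+
      then have ijr: "i < range_of s" "j < range_of s" using size_le_range[OF G] by auto
      have pair: "pair_rel ?S s (m 0) i' j' \<longleftrightarrow> i' = i \<and> j' = j" for i' j'
        unfolding pair_rel_def using first_pair_unique[OF ij, of i' j'] ij pr ij'(1,2) by metis
      have q: "(\<exists>i'<range_of s. \<exists>j'<range_of s. pair_rel ?S s (m 0) i' j' \<and> R i' j') \<longleftrightarrow> R i j" for R
        unfolding pair using ijr by blast
      have q0: "\<exists>i'<range_of s. \<exists>j'<range_of s. pair_rel ?S s (m 0) i' j'"
        unfolding pair using ijr by blast
      have "C s (m 0) i j < m 0" using dfun_less[OF C G pr p ij'(1,2)] .
      note co = coef_less[where C = "C s (m 0)" and ?i0.0 = i and ?j0.0 = j, OF pr ij'(3) this]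
        coef_dvd[where C = "C s (m 0)" and ?i0.0 = i and ?j0.0 = j, OF pr ij'(3) this]
        coef_unique[where C = "C s (m 0)" and ?i0.0 = i and ?j0.0 = j, OF pr ij'(3) this]
      let ?l = "coef (m 0) (C s (m 0)) i j (m 2)"
      have l: "(l < m 0 \<and> mod_eq s (m 0) (l * C s (m 0) i j + C s (m 0) i (m 2)) 0) \<longleftrightarrow> l = ?l"
        if "m 2 < size_of s" for l
      proof (cases "l < m 0")
        case True
        \<comment> \<open>Divisibility is the instance of \<open>mod_eq_add_mult\<close> with
          residue 0.\<close>
        have "0 < m 0 \<and> mod_eq s (m 0) (C s (m 0) i (m 2) + l * C s (m 0) i j) 0 \<longleftrightarrow>
           0 = (C s (m 0) i (m 2) + l * C s (m 0) i j) mod m 0"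
          using True dfun_less[OF C G pr p] ij' that by (intro mod_eq_add_mult pr p) auto
        then have "mod_eq s (m 0) (l * C s (m 0) i j + C s (m 0) i (m 2)) 0 \<longleftrightarrow>
           m 0 dvd l * C s (m 0) i j + C s (m 0) i (m 2)"
          using pr by (auto simp: prime_gt_0_nat add.commute dvd_eq_mod_eq_0)
        then show ?thesis using True co by auto
      qed (use co in auto)
      have v: "(m 3 < m 0 \<and> mod_eq s (m 0) (W s (m 0) (m 1) (m 2) + ?l * W s (m 0) (m 1) j) (m 3)) \<longleftrightarrow>
          m 3 = (W s (m 0) (m 1) (m 2) + ?l * W s (m 0) (m 1) j) mod m 0"
        if "m 1 < size_of s" "m 2 < size_of s"
        using that dfun_less[OF W G pr p] co ij' by (intro mod_eq_add_mult pr p) auto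
      have lr: "?l < range_of s" using co(1)[of "m 2"] p by simp
      have *: "(\<exists>l<range_of s. l < m 0 \<and> mod_eq s (m 0) (l * C s (m 0) i j + C s (m 0) i (m 2)) 0 \<and>
            m 3 < m 0 \<and> mod_eq s (m 0) (W s (m 0) (m 1) (m 2) + l * W s (m 0) (m 1) j) (m 3)) \<longleftrightarrow>
          m 3 = (W s (m 0) (m 1) (m 2) + ?l * W s (m 0) (m 1) j) mod m 0"
        if "m 1 < size_of s" "m 2 < size_of s"
        using l[OF that(2)] v[OF that] lr by metis
      show ?thesis
        unfolding q ex using q0 * ij' pr
        by (cases "m 2 = j") (auto simp: val_rel_def pivot_first[OF ij] elim_def)
    next
      case False
      then have "\<not> pair_rel ?S s (m 0) i j" for i j by (auto simp: pair_rel_def)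
      moreover have "pivot (size_of s) (m 0) (S s (m 0)) (C s (m 0)) (W s (m 0)) = W s (m 0)" if "prime (m 0)"
        using False that by (simp add: pivot_def)
      ultimately show ?thesis by (auto simp: val_rel_def)
    qed
  qed
next
  fix s :: "'a state" and p assume "ready \<delta> s" "prime p" "p < range_of s"
  with W show "reduced (size_of s) p (pivot (size_of s) p (S s p) (C s p) (W s p))"
    unfolding dfun_def by (intro reduced_pivot) (auto simp: prime_gt_0_nat)
qed

lemma dsel_sel1: "dsel (sel1 \<delta>)"
  unfolding dsel_def
proof (rule bdef_cong)
  let ?N = "\<lambda>s p i j. image1 \<delta> s p i j \<noteq> 0"
  let ?Q = "\<lambda>(s :: 'a state) m.
      m 1 = row_of s \<and> pair_rel ?N s (m 0) (m 1) (m 2) \<and>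
      (\<forall>i<range_of s. i \<noteq> m 1 \<longrightarrow> \<not> pair_rel ?N s (m 0) i (m 2))"
  show "bdef 3 ?Q"
    by (intro bdef_logic bdef_row_of bdef_pair_rel[OF dsel_nonzero[OF dfun_image1]] tm_intros) auto
  show "?Q s m = pair_rel (sel1 \<delta>) s (m 0) (m 1) (m 2)" if "ready \<delta> s" for s :: "'a state" and m :: "nat \<Rightarrow> nat"
    using size_le_range[OF that] unfolding pair_rel_def sel1_def sel_row_def
    by (auto intro: less_le_trans)
qed

lemma dfun_image2: "dfun (image2 \<delta>)"
  unfolding image2_def
  by (rule dfun_pivot[OF dfun_image1 dfun_image1 dsel_sel1]) (simp add: sel1_def sel_row_def)

lemma dfun_basis2: "dfun (basis2 \<delta>)"
  unfolding basis2_def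
  by (rule dfun_pivot[OF dfun_image1 dfun_basis dsel_sel1]) (simp add: sel1_def sel_row_def)

lemma dsel_sel2: "dsel (sel2 \<delta>)"
  unfolding dsel_def
proof (rule bdef_cong)
  let ?N = "\<lambda>s p i j. image2 \<delta> s p i j \<noteq> 0"
  let ?Q = "\<lambda>(s :: 'a state) m.
      pair_rel ?N s (m 0) (m 1) (m 2) \<and>
      (\<forall>i<range_of s. pair_rel ?N s (m 0) i (m 2) \<longrightarrow>
      (\<exists>j<range_of s. j \<noteq> m 2 \<and> pair_rel ?N s (m 0) i j))"
  show "bdef 3 ?Q"
    by (intro bdef_logic bdef_pair_rel[OF dsel_nonzero[OF dfun_image2]] tm_intros) auto
  show "?Q s m = pair_rel (sel2 \<delta>) s (m 0) (m 1) (m 2)" if "ready \<delta> s" for s :: "'a state" and m :: "nat \<Rightarrow> nat"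
    using size_le_range[OF that] unfolding pair_rel_def sel2_def sel_col_def
    by (meson less_le_trans)
qed

lemma dfun_image3: "dfun (image3 \<delta>)"
  unfolding image3_def
  by (rule dfun_pivot[OF dfun_image2 dfun_image2 dsel_sel2]) (simp add: sel2_def sel_col_def)

lemma dfun_basis3: "dfun (basis3 \<delta>)"
  unfolding basis3_def
  by (rule dfun_pivot[OF dfun_image2 dfun_basis2 dsel_sel2]) (simp add: sel2_def sel_col_def)

end

primrec new_aux :: "matrix_sym change_type \<Rightarrow> 'a state \<Rightarrow> aux_sym \<Rightarrow> 'a list set" where
  "new_aux \<delta> s Order = aux_of s Order"
| "new_aux \<delta> s Plus = aux_of s Plus"
| "new_aux \<delta> s Times = aux_of s Times"
| "new_aux \<delta> s (Aux q) =
     (if q = 0 then rel s 4 (stored (size_of s) unit_entries (basis3 \<delta> s))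
      else if q = 1 then rel s 4 (stored (size_of s) null_entries (image3 \<delta> s))
      else if q = 2 then rel s 2 (below_rank (rank3 \<delta> s))
      else {[el s r] | r. r < size_of s \<and> is_answer \<delta> s r})"

lemma rank_le_size: "mod_ok n A p B C r \<Longrightarrow> r \<le> n"
  unfolding mod_ok_def nonzero_cols_def using card_mono[of "{..<n}" "{j. j < n \<and> (\<exists>i<n. C i j \<noteq> 0)}"] by auto

context change
begin

section \<open>Definability of the rank and of the answer; existence of update formulas\<close>

definition subset_rel :: "('a state \<Rightarrow> nat \<Rightarrow> nat \<Rightarrow> nat \<Rightarrow> nat) \<Rightarrow> ('a state \<Rightarrow> nat \<Rightarrow> nat \<Rightarrow> nat \<Rightarrow> nat) \<Rightarrow> 'a state \<Rightarrow> nat \<Rightarrow> bool" where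
  "subset_rel F F' s p \<longleftrightarrow> prime p \<and> nonzero_cols (size_of s) (F s p) \<subseteq> nonzero_cols (size_of s) (F' s p)"

lemma bdef_subset_rel:
  assumes "dfun F" "dfun F'" "a < k"
  shows "bdef k (\<lambda>s m. subset_rel F F' s (m a))"
proof -
  let ?N = "\<lambda>F s p i j. F s p i j \<noteq> 0"
  let ?Q = "\<lambda>(s :: 'a state) m.
      prime (m 0) \<and>
      (\<forall>j<range_of s. (\<exists>i<range_of s. pair_rel (?N F) s (m 0) i j) \<longrightarrow> (\<exists>i<range_of s. pair_rel (?N F') s (m 0) i j))"
  have "bdef 1 ?Q"
    by (intro bdef_logic bdef_prime bdef_pair_rel[OF dsel_nonzero[OF assms(1)]]
        bdef_pair_rel[OF dsel_nonzero[OF assms(2)]] tm_intros) auto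
  then have "bdef 1 (\<lambda>s m. subset_rel F F' s (m 0))"
  proof (rule bdef_cong)
    show "?Q s m = subset_rel F F' s (m 0)" if "ready \<delta> s" for s :: "'a state" and m :: "nat \<Rightarrow> nat"
    proof -
      have 1: "(\<exists>i<range_of s. pair_rel (?N F) s (m 0) i j) \<longleftrightarrow> prime (m 0) \<and> j \<in> nonzero_cols (size_of s) (F s (m 0))" for F j
        using size_le_range[OF that] unfolding pair_rel_def nonzero_cols_def
        by (auto intro: less_le_trans)
      have 2: "j < range_of s" if "j \<in> nonzero_cols (size_of s) (F s (m 0))" for j
        using that size_le_range[OF \<open>ready \<delta> s\<close>] by (simp add: nonzero_cols_def)
      show ?thesis unfolding subset_rel_def 1 using 2 by (auto simp: subset_iff)
    qed
  qed
  then show ?thesis using bdef_rename[of 1 "\<lambda>s m. subset_rel F F' s (m 0)" "\<lambda>_. a" k] assms(3) by simp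
qed

definition rank_rel :: "('a state \<Rightarrow> nat \<Rightarrow> nat) \<Rightarrow> 'a state \<Rightarrow> nat \<Rightarrow> nat \<Rightarrow> bool" where
  "rank_rel R s p r \<longleftrightarrow> prime p \<and> r < R s p"

lemma bdef_rank_of: "a < k \<Longrightarrow> b < k \<Longrightarrow> bdef k (\<lambda>s m. rank_rel rank_of s (m a) (m b))"
proof (rule bdef_rename2[where Q = "rank_rel rank_of"])
  have "bdef 2 (\<lambda>s. below_rank (rank_of s))"
    by (rule bdef_aux[of 2]) (simp_all add: ready_def ok_def rank_program_def below_rank_def)
  then show "bdef 2 (\<lambda>s m. rank_rel rank_of s (m 0) (m 1))"
    by (simp add: below_rank_def[abs_def] rank_rel_def[abs_def])
qed

lemma bdef_rank3: "a < k \<Longrightarrow> b < k \<Longrightarrow> bdef k (\<lambda>s m. rank_rel (rank3 \<delta>) s (m a) (m b))"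
proof (rule bdef_rename2[where Q = "rank_rel (rank3 \<delta>)"])
  let ?XY = "subset_rel image_of (image3 \<delta>)" and ?YX = "subset_rel (image3 \<delta>) image_of"
  \<comment> \<open>Equal or incomparable column sets leave the rank unchanged. Otherwise the
    initial segment is shifted: r < R - 1 means r + 1 < R, and r < R + 1 means r = 0 or r - 1 <
    R.\<close>
  let ?Q = "\<lambda>(s :: 'a state) m.
      prime (m 0) \<and>
      ((?XY s (m 0) \<longleftrightarrow> ?YX s (m 0)) \<and> rank_rel rank_of s (m 0) (m 1) \<or>
      ?YX s (m 0) \<and> \<not> ?XY s (m 0) \<and> (\<exists>r<range_of s. m 1 + 1 = r \<and> rank_rel rank_of s (m 0) r) \<or>
      \<not> ?YX s (m 0) \<and> ?XY s (m 0) \<and> (m 1 = 0 \<or> (\<exists>r<range_of s. r + 1 = m 1 \<and> rank_rel rank_of s (m 0) r)))"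
  have "bdef 2 ?Q"
    by (intro bdef_logic bdef_prime bdef_iff bdef_rank_of bdef_subset_rel[OF dfun_image dfun_image3]
        bdef_subset_rel[OF dfun_image3 dfun_image] tm_intros) auto
  then show "bdef 2 (\<lambda>s m. rank_rel (rank3 \<delta>) s (m 0) (m 1))"
  proof (rule bdef_cong)
    fix s :: "'a state" and m :: "nat \<Rightarrow> nat" assume G: "ready \<delta> s" and m: "\<forall>i<2. m i < range_of s"
    have 1: "(\<exists>r<range_of s. m 1 + 1 = r \<and> rank_rel rank_of s (m 0) r) \<longleftrightarrow> m 1 + 1 < rank_of s (m 0)"
      if "prime (m 0)"
    proof -
      have "m 0 < range_of s" using m by simp
      from rank_le_size[OF ready_mod_ok[OF G that this]] size_le_range[OF G]
      show ?thesis using that by (auto simp: rank_rel_def)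
    qed
    have 2: "(m 1 = 0 \<or> (\<exists>r<range_of s. r + 1 = m 1 \<and> rank_rel rank_of s (m 0) r)) \<longleftrightarrow> m 1 < rank_of s (m 0) + 1"
      if "prime (m 0)"
    proof -
      have "m 1 < range_of s" using m by simp
      then show ?thesis using that by (cases "m 1") (auto simp: rank_rel_def)
    qed
    show "?Q s m = rank_rel (rank3 \<delta>) s (m 0) (m 1)"
    proof (cases "prime (m 0)")
      case True
      define X Y where "X = nonzero_cols (size_of s) (image_of s (m 0))"
        and "Y = nonzero_cols (size_of s) (image3 \<delta> s (m 0))"
      have s: "?XY s (m 0) \<longleftrightarrow> X \<subseteq> Y" "?YX s (m 0) \<longleftrightarrow> Y \<subseteq> X"
        using True by (auto simp: subset_rel_def X_def Y_def)
      show ?thesis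
        unfolding s 1[OF True] 2[OF True] using True
        by (cases "X \<subseteq> Y"; cases "Y \<subseteq> X") (auto simp: rank_rel_def rank3_def Let_def X_def[symmetric] Y_def[symmetric])
    qed (simp add: rank_rel_def)
  qed
qed

lemma bdef_singleton_answer: "bdef k (\<lambda>s m. singleton_answer \<delta> s)"
proof (cases \<delta>)
  case (Insert R)
  have "bdef k (\<lambda>s m. True)" by (rule bdef_const)
  then show ?thesis by (rule bdef_cong) (simp add: Insert)
next
  case (Delete R)
  then have "R = MPlus \<or> R = MMinus" using changed_sym by (cases R) auto
  moreover have "bdef k (\<lambda>s m. changed_of s \<in> input_of s MPlus)" "bdef k (\<lambda>s m. changed_of s \<in> input_of s MMinus)"
    by (intro bdef_input; simp)+
  ultimately show ?thesis
    by (elim disjE) (rule bdef_cong, assumption, simp add: Delete)+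
qed

lemma bdef_is_answer: "bdef 1 (\<lambda>s m. is_answer \<delta> s (m 0))"
proof (rule bdef_cong)
  show "bdef 1 (\<lambda>s m. size_of s = 1 \<and> singleton_answer \<delta> s \<or> size_of s \<noteq> 1 \<and>
     (\<exists>p<range_of s. rank_rel (rank3 \<delta>) s p (m 0)) \<and>
     (\<forall>r<range_of s. m 0 < r \<longrightarrow> \<not> (\<exists>p<range_of s. rank_rel (rank3 \<delta>) s p r)))"
    by (intro bdef_logic bdef_singleton_answer bdef_rank3 tm_intros) auto
qed (auto simp: is_answer_def rank_rel_def)

text \<open>The answer is a relation on elements, so the number \<open>m 0\<close> is replaced by a single digit.\<close>

lemma fodef_is_answer: "fodef 1 (\<lambda>s v. is_answer \<delta> s (v 0))"
proof -
  \<comment> \<open>The lowest digit becomes variable 0; all higher digits become variable 1, which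
    is then required to be 0.\<close>
  let ?f = "\<lambda>t. if t = 0 then 0 else 1 :: nat"
  let ?Q = "\<lambda>(s :: 'a state) v.
      \<exists>x<size_of s. x = 0 \<and> is_answer \<delta> s (num s (\<lambda>t. if t = 0 then v 0 else x) 0)"
  have "fodef (1 * width) (\<lambda>s v. is_answer \<delta> s (num s v 0))"
    using bdef_is_answer by (simp only: bdef_def)
  then have "fodef 2 (\<lambda>s v. is_answer \<delta> s (num s (\<lambda>t. v (?f t)) 0))"
    by (rule fodef_rename[where Q = "\<lambda>s v. is_answer \<delta> s (num s v 0)"]) auto
  then have "fodef 1 ?Q"
    by (intro fodef_ex fodef_conj fodef_zero) (simp_all add: numeral_2_eq_2 if_distrib cong: if_cong)
  then show ?thesis
  proof (rule fodef_cong)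
    fix s :: "'a state" and v :: "nat \<Rightarrow> nat" assume G: "ready \<delta> s"
    have "num s (\<lambda>t. if t = 0 then v 0 else 0) 0 = (\<Sum>j<width. if j = 0 then v 0 else 0)"
      unfolding num_def by (intro sum.cong) auto
    also have "\<dots> = v 0" by (simp add: width_def)
    finally show "?Q s v = is_answer \<delta> s (v 0)"
      using size_pos[OF G_arith[OF G]] by auto
  qed
qed

definition updates :: "aux_sym \<Rightarrow> (matrix_sym + aux_sym) fm \<Rightarrow> bool" where
  "updates S \<phi> \<longleftrightarrow> free_vars \<phi> \<subseteq> {..<3 + aux_arity rank_program S} \<and> wff \<phi> \<and>
     (\<forall>(s :: 'a state) b. ready \<delta> s \<longrightarrow> b \<in> tuples (dom_of s) (aux_arity rank_program S) \<longrightarrow>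
        sat (dom_of s) (case_sum (input_of s) (aux_of s)) (\<lambda>i. (changed_of s @ b) ! i) \<phi> = (b \<in> new_aux \<delta> s S))"

lemma fodef_updates:
  assumes "fodef (aux_arity rank_program S) Q"
    and "\<And>(s :: 'a state) b. ready \<delta> s \<Longrightarrow> b \<in> tuples (dom_of s) (aux_arity rank_program S) \<Longrightarrow>
       Q s (\<lambda>t. idx s (b ! t)) = (b \<in> new_aux \<delta> s S)"
  shows "\<exists>\<phi>. updates S \<phi>"
proof -
  let ?k = "aux_arity rank_program S"
  obtain \<phi> where \<phi>: "free_vars \<phi> \<subseteq> {..<?k + 3}" "wff \<phi>"
    "\<And>s v. ready \<delta> s \<Longrightarrow> \<forall>i<?k. v i < size_of s \<Longrightarrow> sem s v \<phi> = Q s v"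
    using assms(1) by (rule fodefE) blast
  have "sat (dom_of s) (case_sum (input_of s) (aux_of s)) (\<lambda>i. (changed_of s @ b) ! i) \<phi> = (b \<in> new_aux \<delta> s S)"
    if G: "ready \<delta> s" and b: "b \<in> tuples (dom_of s) ?k" for s :: "'a state" and b
  proof -
    have bi: "b ! i \<in> dom_of s" if "i < ?k" for i using b that by (auto simp: tuples_def)
    have "sat (dom_of s) (case_sum (input_of s) (aux_of s)) (\<lambda>i. (changed_of s @ b) ! i) \<phi> =
      sem s (\<lambda>t. idx s (b ! t)) \<phi>"
    proof (rule sat_cong)
      fix i assume "i \<in> free_vars \<phi>"
      then have "i < ?k + 3" using \<phi>(1) by auto
      then show "(changed_of s @ b) ! i = env s (\<lambda>t. idx s (b ! t)) i"
        using length_changed[OF G_arith[OF G]] el_idx[OF G_arith[OF G] bi[of "i - 3"]]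
        by (auto simp: env_def nth_append)
    qed
    also have "\<dots> = (b \<in> new_aux \<delta> s S)"
      using \<phi>(3)[OF G, of "\<lambda>t. idx s (b ! t)"] assms(2)[OF G b] idx_less[OF G_arith[OF G] bi] by simp
    finally show ?thesis .
  qed
  with \<phi>(1,2) show ?thesis unfolding updates_def by (metis add.commute)
qed

lemma bdef_updates:
  assumes "bdef k (\<lambda>s. Q s)" "aux_arity rank_program S = k * width"
    and "\<And>s :: 'a state. ready \<delta> s \<Longrightarrow> new_aux \<delta> s S = rel s k (Q s)"
  shows "\<exists>\<phi>. updates S \<phi>"
  by (rule fodef_updates[where Q = "\<lambda>s v. Q s (num s v)"]) (use assms in \<open>simp_all add: bdef_def rel_def\<close>)

lemma exists_updates:
  assumes "S \<in> aux_syms rank_program"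
  shows "\<exists>\<phi>. updates S \<phi>"
proof -
  have arith: "\<exists>\<phi>. updates S \<phi>" if S: "S \<in> {Order, Plus, Times}"
  proof -
    let ?k = "aux_arity rank_program S"
    have "updates S (Atom (Inr S) [3..<3 + ?k])"
      unfolding updates_def
    proof (intro conjI allI impI)
      fix s :: "'a state" and b assume G: "ready \<delta> s" and b: "b \<in> tuples (dom_of s) ?k"
      have "map ((!) (changed_of s @ b)) [3..<3 + ?k] = b"
        using b length_changed[OF G_arith[OF G]]
        by (intro nth_equalityI) (auto simp: tuples_def nth_append)
      then show "sat (dom_of s) (case_sum (input_of s) (aux_of s)) ((!) (changed_of s @ b))
         (Atom (Inr S) [3..<3 + ?k]) = (b \<in> new_aux \<delta> s S)"
        unfolding sat.simps using S by auto
    qed (use S in \<open>auto simp: aux_syms_def\<close>)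
    then show ?thesis by blast
  qed
  have mats: "bdef 4 (\<lambda>s. stored (size_of s) E (F s))"
    if F: "dfun F" and E: "bdef 4 (\<lambda>s m. m 3 = E (m 1) (m 2))" for F E
  proof -
    have "bdef 4 (\<lambda>s m. prime (m 0) \<and> m 1 < size_of s \<and> m 2 < size_of s \<and> m 3 < m 0 \<and>
       \<not> (val_rel F s (m 0) (m 1) (m 2) (m 3) \<longleftrightarrow> m 3 = E (m 1) (m 2)))"
      by (intro bdef_logic bdef_prime bdef_iff bdef_val_rel[OF F] E tm_intros) auto
    then show ?thesis by (rule bdef_cong) (auto simp: stored_def val_rel_def)
  qed
  have 0: "\<exists>\<phi>. updates (Aux 0) \<phi>"
    by (intro bdef_updates[OF mats[OF dfun_basis3 bdef_unit_entries]]) (simp_all add: rank_program_def)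
  have 1: "\<exists>\<phi>. updates (Aux 1) \<phi>"
    by (intro bdef_updates[OF mats[OF dfun_image3 bdef_null_entries]]) (simp_all add: rank_program_def)
  have "bdef 2 (\<lambda>s. below_rank (rank3 \<delta> s))"
    using bdef_rank3[of 0 2 1] by (simp add: below_rank_def[abs_def] rank_rel_def[abs_def])
  then have 2: "\<exists>\<phi>. updates (Aux 2) \<phi>"
    by (rule bdef_updates) (simp_all add: rank_program_def)
  have 3: "\<exists>\<phi>. updates (Aux 3) \<phi>"
  proof (rule fodef_updates)
    show "fodef (aux_arity rank_program (Aux 3)) (\<lambda>s v. is_answer \<delta> s (v 0))"
      using fodef_is_answer by (simp add: rank_program_def)
    fix s :: "'a state" and b assume G: "ready \<delta> s" and "b \<in> tuples (dom_of s) (aux_arity rank_program (Aux 3))"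
    then obtain x where x: "b = [x]" "x \<in> dom_of s"
      by (auto simp: tuples_def rank_program_def length_Suc_conv)
    show "is_answer \<delta> s (idx s (b ! 0)) = (b \<in> new_aux \<delta> s (Aux 3))"
      using x el_idx[OF G_arith[OF G] x(2)] idx_less[OF G_arith[OF G] x(2)] idx_el[OF G_arith[OF G]]
      by (auto intro: exI[of _ "idx s x"])
  qed
  have "S \<in> {Order, Plus, Times} \<or> (\<exists>q<4. S = Aux q)"
    using assms by (auto simp: aux_syms_def rank_program_def)
  then show ?thesis using arith 0 1 2 3 by (auto simp: numeral_eq_Suc less_Suc_eq)
qed

end

section \<open>Correctness\<close>

lemma input_order: "input_ok D L I \<Longrightarrow> input_order I = L"
  by (auto simp: input_ok_def input_order_def)

lemma input_pair_unique:
  "input_ok D L I \<Longrightarrow> [x, y, a] \<in> I MPlus \<union> I MMinus \<Longrightarrow> [x, y, a'] \<in> I MPlus \<union> I MMinus \<Longrightarrow> a' = a"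
  unfolding input_ok_def by blast

lemma entry_plus:
  assumes "input_ok D L I" "[x, y, a] \<in> I MPlus"
  shows "entry I x y = int (pos L a)"
proof -
  have "(THE a. [x, y, a] \<in> I MPlus) = a"
    using assms input_pair_unique[OF assms(1)] by (intro the_equality) blast+
  then show ?thesis using assms by (auto simp: entry_def input_order)
qed

lemma entry_minus:
  assumes "input_ok D L I" "[x, y, a] \<in> I MMinus"
  shows "entry I x y = - int (pos L a)"
proof -
  have "(THE a. [x, y, a] \<in> I MMinus) = a"
    using assms input_pair_unique[OF assms(1)] by (intro the_equality) blast+
  moreover have "[x, y, b] \<notin> I MPlus" for b
    using assms input_pair_unique[OF assms(1), of x y a b] unfolding input_ok_def by blast
  ultimately show ?thesis using assms by (auto simp: entry_def input_order)
qed

lemma entry_none: "(\<And>a. [x, y, a] \<notin> I MPlus \<union> I MMinus) \<Longrightarrow> entry I x y = 0"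
  by (auto simp: entry_def)

lemma entry_cong:
  "I Less = I' Less \<Longrightarrow> (\<And>a. [x, y, a] \<in> I MPlus \<longleftrightarrow> [x, y, a] \<in> I' MPlus) \<Longrightarrow>
   (\<And>a. [x, y, a] \<in> I MMinus \<longleftrightarrow> [x, y, a] \<in> I' MMinus) \<Longrightarrow> entry I x y = entry I' x y"
  by (simp add: entry_def input_order_def)

lemma input_ok_change:
  assumes I: "input_ok D L I" and \<delta>: "changed_sym \<delta> \<noteq> Less" and t: "t \<in> tuples D 3"
    and al: "matrix_allowed I \<delta> t"
  shows "input_ok D L (apply_change \<delta> t I)"
proof (cases \<delta>)
  case (Insert R)
  obtain x y a where t': "t = [x, y, a]"
    using t by (auto simp: tuples_def numeral_3_eq_3 length_Suc_conv)
  have no: "\<And>b. [x, y, b] \<notin> I MPlus" "\<And>b. [x, y, b] \<notin> I MMinus"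
    using al Insert t' by auto
  have "R = MPlus \<or> R = MMinus" using \<delta> Insert by (cases R) auto
  then show ?thesis
    using I no t unfolding input_ok_def Insert t' by (elim disjE) (auto; blast)+
next
  case (Delete R)
  have "R = MPlus \<or> R = MMinus" using \<delta> Delete by (cases R) auto
  then show ?thesis
    using I unfolding input_ok_def Delete by (elim disjE) (auto; blast)+
qed

lemma entry_apply_change:
  assumes I: "input_ok (dom_of s) (order_of s) (input_of s)" and \<delta>: "changed_sym \<delta> \<noteq> Less"
    and t: "changed_of s \<in> tuples (dom_of s) 3" and al: "matrix_allowed (input_of s) \<delta> (changed_of s)"
  shows "entry (apply_change \<delta> (changed_of s) (input_of s)) x y =
     entry (input_of s) x y + (if x = changed_of s ! 0 \<and> y = changed_of s ! 1 then entry_change \<delta> s else 0)"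
proof -
  obtain x0 y0 a where t': "changed_of s = [x0, y0, a]"
    using t by (auto simp: tuples_def numeral_3_eq_3 length_Suc_conv)
  let ?I = "input_of s" and ?I' = "apply_change \<delta> (changed_of s) (input_of s)"
  have I': "input_ok (dom_of s) (order_of s) ?I'" by (rule input_ok_change[OF I \<delta> t al])
  have val: "int (val_of s) = int (pos (order_of s) a)"
    by (simp add: val_of_def idx_def t' pos_def)
  consider "\<delta> = Insert MPlus" | "\<delta> = Insert MMinus" | "\<delta> = Delete MPlus" | "\<delta> = Delete MMinus"
  proof -
    have "changed_sym \<delta> = MPlus \<or> changed_sym \<delta> = MMinus" using \<delta> by (cases "changed_sym \<delta>") auto
    then show ?thesis using that by (cases \<delta>) auto
  qed
  note cases = this
  show ?thesis
  proof (cases "x = x0 \<and> y = y0")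
    case False
    have "entry ?I' x y = entry ?I x y"
      by (rule cases; intro entry_cong) (use False in \<open>auto simp: t'\<close>)
    then show ?thesis using False by (auto simp: t')
  next
    case True
    have "entry ?I' x0 y0 = entry ?I x0 y0 + entry_change \<delta> s"
      using cases
    proof cases
      case 1
      then have "entry ?I x0 y0 = 0" using al by (intro entry_none) (auto simp: t')
      moreover have "entry ?I' x0 y0 = int (pos (order_of s) a)"
        by (rule entry_plus[OF I']) (simp add: 1 t')
      ultimately show ?thesis by (simp add: 1 val)
    next
      case 2
      then have "entry ?I x0 y0 = 0" using al by (intro entry_none) (auto simp: t')
      moreover have "entry ?I' x0 y0 = - int (pos (order_of s) a)"
        by (rule entry_minus[OF I']) (simp add: 2 t')
      ultimately show ?thesis by (simp add: 2 val)
    next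
      case 3
      show ?thesis
      proof (cases "changed_of s \<in> ?I MPlus")
        case True
        then have "entry ?I x0 y0 = int (pos (order_of s) a)" by (intro entry_plus[OF I]) (simp add: t')
        \<comment> \<open>The deleted triple was the only one for this entry in both relations
          together.\<close>
        moreover have "entry ?I' x0 y0 = 0"
        proof -
          have "b = a" if "[x0, y0, b] \<in> ?I MPlus" for b
            using input_pair_unique[OF I, of x0 y0 a b] that True t' by auto
          moreover have "b = a" if "[x0, y0, b] \<in> ?I MMinus" for b
            using input_pair_unique[OF I, of x0 y0 a b] that True t' by auto
          moreover have "[x0, y0, a] \<notin> ?I MMinus" using True I t' unfolding input_ok_def by auto
          ultimately show ?thesis by (intro entry_none) (auto simp: 3 t')
        qed
        ultimately show ?thesis using True by (simp add: 3 val)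
      qed (simp add: 3)
    next
      case 4
      show ?thesis
      proof (cases "changed_of s \<in> ?I MMinus")
        case True
        then have "entry ?I x0 y0 = - int (pos (order_of s) a)" by (intro entry_minus[OF I]) (simp add: t')
        moreover have "entry ?I' x0 y0 = 0"
        proof -
          have "b = a" if "[x0, y0, b] \<in> ?I MPlus" for b
            using input_pair_unique[OF I, of x0 y0 a b] that True t' by auto
          moreover have "b = a" if "[x0, y0, b] \<in> ?I MMinus" for b
            using input_pair_unique[OF I, of x0 y0 a b] that True t' by auto
          moreover have "[x0, y0, a] \<notin> ?I MPlus" using True I t' unfolding input_ok_def by auto
          ultimately show ?thesis by (intro entry_none) (auto simp: 4 t')
        qed
        ultimately show ?thesis using True by (simp add: 4 val)
      qed (simp add: 4)
    qed
    then show ?thesis using True by (simp add: t')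
  qed
qed

text \<open>The row addition turns \<open>A B = C\<close> into the equation for the new matrix, and
  the column operations preserve both it and the generating property. The two rounds restore the
  pivots, and \<open>card_change\<close> justifies the rank update.\<close>

lemma mod_ok_step:
  assumes p: "prime p" and ok: "mod_ok (size_of s) A p (basis_of s p) (image_of s p) (rank_of s p)"
    and c: "col_of s < size_of s"
    and A': "\<And>i j. i < size_of s \<Longrightarrow> j < size_of s \<Longrightarrow>
       A' i j = A i j + (if i = row_of s \<and> j = col_of s then entry_change \<delta> s else 0)"
  shows "mod_ok (size_of s) A' p (basis3 \<delta> s p) (image3 \<delta> s p) (rank3 \<delta> s p)"
proof -
  let ?n = "size_of s"
  have p0: "0 < p" using p by (simp add: prime_gt_0_nat)
  have red: "reduced ?n p (basis_of s p)" "reduced ?n p (image_of s p)"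
    and img: "image_rel ?n p A (basis_of s p) (image_of s p)" and gen: "generating ?n p (basis_of s p)"
    and piv: "pivoted ?n (image_of s p) UNIV" and r: "rank_of s p = card (nonzero_cols ?n (image_of s p))"
    using ok by (auto simp: mod_ok_def)
  have red1: "reduced ?n p (image1 \<delta> s p)"
    using red(2) p0 by (auto simp: reduced_def image1_def add_row_def)
  have res: "[int (residue_change \<delta> s p) = entry_change \<delta> s] (mod int p)"
    using p0 by (simp add: residue_change_def cong_def)
  have img1: "image_rel ?n p A' (basis_of s p) (image1 \<delta> s p)"
    unfolding image1_def by (rule image_rel_add_row[OF img c res A'])
  have red2: "reduced ?n p (image2 \<delta> s p)" "reduced ?n p (basis2 \<delta> s p)"
    unfolding image2_def basis2_def using red red1 p0 by (auto intro: reduced_pivot)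
  have red3: "reduced ?n p (image3 \<delta> s p)" "reduced ?n p (basis3 \<delta> s p)"
    unfolding image3_def basis3_def using red2 p0 by (auto intro: reduced_pivot)
  have img3: "image_rel ?n p A' (basis3 \<delta> s p) (image3 \<delta> s p)"
    unfolding image3_def basis3_def image2_def basis2_def by (intro image_rel_pivot img1)
  have gen3: "generating ?n p (basis3 \<delta> s p)"
    unfolding basis3_def basis2_def by (intro generating_pivot gen)
  obtain k z where kz: "pivoted ?n (image2 \<delta> s p) (- {k})"
    "nonzero_cols ?n (image_of s p) \<subseteq> insert k (nonzero_cols ?n (image2 \<delta> s p))"
    "nonzero_cols ?n (image2 \<delta> s p) \<subseteq> insert z (nonzero_cols ?n (image_of s p))"
    using pivot_sel_row[OF p red1 piv, of "row_of s"]
    unfolding image2_def sel1_def by (auto simp: image1_def add_row_def)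
  have piv3: "pivoted ?n (image3 \<delta> s p) UNIV"
    and nz3: "nonzero_cols ?n (image3 \<delta> s p) = nonzero_cols ?n (image2 \<delta> s p)"
    using pivot_sel_col[OF p red2(1) kz(1)] unfolding image3_def sel2_def by auto
  have "rank3 \<delta> s p = card (nonzero_cols ?n (image3 \<delta> s p))"
    using card_change[of "nonzero_cols ?n (image_of s p)" "nonzero_cols ?n (image3 \<delta> s p)" k z] kz(2,3)
    unfolding rank3_def Let_def r nz3[symmetric] by (simp add: nonzero_cols_def)
  with red3 img3 gen3 piv3 show ?thesis by (simp add: mod_ok_def)
qed

lemma rel_cong: "dom_of s = dom_of s' \<Longrightarrow> order_of s = order_of s' \<Longrightarrow> rel s k Q = rel s' k Q"
  by (simp add: rel_def num_def[abs_def] idx_def)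

definition next_state :: "matrix_sym change_type \<Rightarrow> 'a state \<Rightarrow> 'a state" where
  "next_state \<delta> s = s\<lparr>input_of := apply_change \<delta> (changed_of s) (input_of s),
     aux_of := (\<lambda>S. if S \<in> aux_syms rank_program then new_aux \<delta> s S else {}),
     basis_of := basis3 \<delta> s, image_of := image3 \<delta> s, rank_of := rank3 \<delta> s\<rparr>"

lemma ok_arith: "ok s \<Longrightarrow> changed_of s \<in> tuples (dom_of s) 3 \<Longrightarrow> arith s"
  by (auto simp: ok_def arith_def)

lemma ready_arith: "ready \<delta> s \<Longrightarrow> arith s"
  by (auto simp: ready_def intro: ok_arith)

lemma int_matrix_next_state:
  assumes r: "ready \<delta> s" and \<delta>: "changed_sym \<delta> \<noteq> Less" and ij: "i < size_of s" "j < size_of s"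
  shows "int_matrix (next_state \<delta> s) i j =
    int_matrix s i j + (if i = row_of s \<and> j = col_of s then entry_change \<delta> s else 0)"
proof -
  note ar = ready_arith[OF r]
  have "el s i = changed_of s ! 0 \<longleftrightarrow> i = row_of s" "el s j = changed_of s ! 1 \<longleftrightarrow> j = col_of s"
    unfolding row_of_def col_of_def
    using idx_el[OF ar] ij el_idx[OF ar changed_in[OF ar]] by (metis one_less_numeral_iff semiring_norm(77) zero_less_numeral)+
  moreover have "el (next_state \<delta> s) k = el s k" for k by (simp add: el_def next_state_def)
  moreover have "input_of (next_state \<delta> s) = apply_change \<delta> (changed_of s) (input_of s)"
    by (simp add: next_state_def)
  moreover have "entry (apply_change \<delta> (changed_of s) (input_of s)) (el s i) (el s j) =
     entry (input_of s) (el s i) (el s j) +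
     (if el s i = changed_of s ! 0 \<and> el s j = changed_of s ! 1 then entry_change \<delta> s else 0)"
    using r by (intro entry_apply_change[OF _ \<delta>]) (simp_all add: ready_def ok_def)
  ultimately show ?thesis by (simp only: int_matrix_def)
qed

lemma ok_next_state:
  assumes r: "ready \<delta> s" and \<delta>: "changed_sym \<delta> \<noteq> Less"
  shows "ok (next_state \<delta> s)"
proof -
  let ?s = "next_state \<delta> s"
  have ok: "ok s" using r by (simp add: ready_def)
  have same: "dom_of ?s = dom_of s" "order_of ?s = order_of s" "range_of ?s = range_of s"
    by (simp_all add: next_state_def range_of_def)
  have col: "col_of s < size_of s"
    unfolding col_of_def using idx_less[OF ready_arith[OF r] changed_in[OF ready_arith[OF r]]] by simp
  have "mod_ok (size_of s) (int_matrix ?s) p (basis3 \<delta> s p) (image3 \<delta> s p) (rank3 \<delta> s p)"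
    if "prime p" "p < range_of s" for p
    using ok that by (intro mod_ok_step[OF _ _ col int_matrix_next_state[OF r \<delta>]]) (auto simp: ok_def)
  moreover have "input_ok (dom_of s) (order_of s) (input_of ?s)"
    using r by (auto simp: ready_def ok_def next_state_def intro: input_ok_change[OF _ \<delta>])
  moreover have "aux_of ?s S = new_aux \<delta> s S" if "S \<in> {Order, Plus, Times, Aux 0, Aux 1, Aux 2}" for S
    using that by (auto simp: next_state_def aux_syms_def rank_program_def)
  moreover have "basis_of ?s = basis3 \<delta> s" "image_of ?s = image3 \<delta> s" "rank_of ?s = rank3 \<delta> s"
    by (simp_all add: next_state_def)
  ultimately show ?thesis
    using ok unfolding ok_def same by (simp add: rel_cong[OF same(1,2)])
qed

section \<open>From the ranks modulo primes to the answer\<close>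

lemma encoded_rank_eq:
  assumes "ok s"
  shows "encoded_rank (dom_of s) (input_of s) = vec_space.rank (size_of s) (rat_mat (size_of s) (int_matrix s))"
proof -
  have "input_order (input_of s) = order_of s" using assms input_order by (auto simp: ok_def)
  then have "encoded_matrix (dom_of s) (input_of s) = rat_mat (size_of s) (int_matrix s)"
    by (simp add: encoded_matrix_def rat_mat_def int_matrix_def el_def)
  then show ?thesis by (simp add: encoded_rank_def)
qed

lemma abs_int_matrix_le:
  assumes "ok s"
  shows "\<bar>int_matrix s i j\<bar> \<le> int (size_of s)"
proof -
  have I: "input_ok (dom_of s) (order_of s) (input_of s)"
    and f: "finite (dom_of s)" "strict_order_of (dom_of s) (order_of s)" using assms by (auto simp: ok_def)
  have le: "pos (order_of s) a \<le> size_of s" if "[x, y, a] \<in> input_of s MPlus \<union> input_of s MMinus" for x y a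
  proof -
    have "[x, y, a] \<in> tuples (dom_of s) 3" using I that unfolding input_ok_def by blast
    then show ?thesis using pos_bounds[OF f, of a] by (simp add: tuples_def)
  qed
  consider a where "[el s i, el s j, a] \<in> input_of s MPlus" | a where "[el s i, el s j, a] \<in> input_of s MMinus"
    | "\<And>a. [el s i, el s j, a] \<notin> input_of s MPlus \<union> input_of s MMinus" by blast
  then show ?thesis
  proof cases
    case (1 a)
    then show ?thesis using entry_plus[OF I 1] le[of "el s i" "el s j" a] by (simp add: int_matrix_def)
  next
    case (2 a)
    then show ?thesis using entry_minus[OF I 2] le[of "el s i" "el s j" a] by (simp add: int_matrix_def)
  next
    case 3
    then show ?thesis by (simp add: int_matrix_def entry_none)
  qed
qed

text \<open>Every prime gives a lower bound for the rank, and a prime not dividing the witnessing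
  determinant attains it; such a prime is in range because the size is at least 2.\<close>

lemma encoded_rank_bounds:
  assumes ok: "ok s" and n: "2 \<le> size_of s"
  defines "r \<equiv> encoded_rank (dom_of s) (input_of s)"
  shows "prime p \<Longrightarrow> p < range_of s \<Longrightarrow> rank_of s p \<le> r"
    and "\<exists>p. prime p \<and> p < range_of s \<and> r \<le> rank_of s p"
proof -
  have mod_ok: "mod_ok (size_of s) (int_matrix s) p (basis_of s p) (image_of s p) (rank_of s p)"
    if "prime p" "p < range_of s" for p
    using ok that by (simp add: ok_def)
  show "prime p \<Longrightarrow> p < range_of s \<Longrightarrow> rank_of s p \<le> r"
    using mod_ok[of p] card_nonzero_cols_le_rank[of p "size_of s" "image_of s p" "int_matrix s" "basis_of s p"]
    unfolding r_def encoded_rank_eq[OF ok] by (simp add: mod_ok_def)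
  obtain d where d: "0 < d" "d \<le> size_of s ^ (2 * size_of s)"
    "\<And>p B C. prime p \<Longrightarrow> \<not> p dvd d \<Longrightarrow> image_rel (size_of s) p (int_matrix s) B C \<Longrightarrow> generating (size_of s) p B \<Longrightarrow>
        r \<le> card (nonzero_cols (size_of s) C)"
    using rank_le_card_nonzero_cols[of "size_of s" "int_matrix s"] abs_int_matrix_le[OF ok] n
    unfolding r_def encoded_rank_eq[OF ok] by (auto; blast)
  from exists_prime_not_dvd[OF n d(1,2)] obtain p where p: "prime p" "p < range_of s" "\<not> p dvd d"
    by (auto simp: range_of_def width_def)
  with mod_ok[OF p(1,2)] d(3)[OF p(1,3), of "basis_of s p" "image_of s p"]
  show "\<exists>p. prime p \<and> p < range_of s \<and> r \<le> rank_of s p" by (auto simp: mod_ok_def)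
qed

lemma rank_singleton:
  fixes A :: "nat \<Rightarrow> nat \<Rightarrow> int"
  shows "vec_space.rank 1 (rat_mat 1 A) = (if A 0 0 = 0 then 0 else 1)"
proof -
  interpret vec_space "TYPE(rat)" 1 .
  have "A 0 0 \<noteq> 0 \<Longrightarrow> det (rat_mat 1 A) \<noteq> 0"
    using det_single[OF rat_mat_carrier[of 1 A]] by (simp add: rat_mat_def)
  moreover have "A 0 0 = 0 \<Longrightarrow> rat_mat 1 A = 0\<^sub>m 1 1"
    by (rule eq_matI) (auto simp: rat_mat_def)
  ultimately show ?thesis
    using det_rank_iff[OF rat_mat_carrier, of A] rank_0I[of 1] by auto
qed

lemma singleton_answer_iff:
  assumes r: "ready \<delta> s" and \<delta>: "changed_sym \<delta> \<noteq> Less" and n: "size_of s = 1"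
  shows "singleton_answer \<delta> s \<longleftrightarrow> int_matrix (next_state \<delta> s) 0 0 \<noteq> 0"
proof -
  have I: "input_ok (dom_of s) (order_of s) (input_of s)" using r by (simp add: ready_def ok_def)
  have I': "input_ok (dom_of s) (order_of s) (input_of (next_state \<delta> s))"
    using input_ok_change[OF I \<delta>] r by (simp add: ready_def next_state_def)
  obtain e where e: "dom_of s = {e}" using n by (meson card_1_singletonE)
  have el: "el s 0 = e" using el_in[OF ready_arith[OF r], of 0] n e by simp
  have tup: "t = [e, e, e]" if "t \<in> tuples (dom_of s) 3" for t
    using that e by (auto simp: tuples_def numeral_3_eq_3 length_Suc_conv)
  have t: "changed_of s = [e, e, e]" using tup r by (simp add: ready_def)
  have only: "[e, e, a] \<in> input_of (next_state \<delta> s) R \<Longrightarrow> a = e" if "R \<noteq> Less" for a R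
  proof -
    assume "[e, e, a] \<in> input_of (next_state \<delta> s) R"
    then have "[e, e, a] \<in> tuples (dom_of s) 3" using I' that unfolding input_ok_def by (cases R) blast+
    then show "a = e" using tup by blast
  qed
  have pos: "0 < pos (order_of s) e" by (simp add: pos_def)
  have "int_matrix (next_state \<delta> s) 0 0 = entry (input_of (next_state \<delta> s)) e e"
    using el by (simp add: int_matrix_def el_def next_state_def)
  also have "\<dots> \<noteq> 0 \<longleftrightarrow> [e, e, e] \<in> input_of (next_state \<delta> s) MPlus \<union> input_of (next_state \<delta> s) MMinus"
    using entry_plus[OF I', of e e e] entry_minus[OF I', of e e e] pos
      entry_none[of e e "input_of (next_state \<delta> s)"] only by auto
  also have "\<dots> \<longleftrightarrow> singleton_answer \<delta> s"
  proof -
    have "changed_sym \<delta> = MPlus \<or> changed_sym \<delta> = MMinus" using \<delta> by (cases "changed_sym \<delta>") auto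
    then show ?thesis by (cases \<delta>) (auto simp: next_state_def t)
  qed
  finally show ?thesis by simp
qed

lemma new_answer:
  assumes r: "ready \<delta> s" and \<delta>: "changed_sym \<delta> \<noteq> Less"
  shows "new_aux \<delta> s (Aux 3) = rank_query (dom_of s) (apply_change \<delta> (changed_of s) (input_of s))"
proof -
  let ?s = "next_state \<delta> s" and ?n = "size_of s"
  have ok: "ok ?s" by (rule ok_next_state[OF r \<delta>])
  have same: "dom_of ?s = dom_of s" "order_of ?s = order_of s" "range_of ?s = range_of s"
      "rank_of ?s = rank3 \<delta> s" "input_of ?s = apply_change \<delta> (changed_of s) (input_of s)"
    by (simp_all add: next_state_def range_of_def)
  define k where "k = encoded_rank (dom_of s) (input_of ?s)"
  have k: "k = vec_space.rank ?n (rat_mat ?n (int_matrix ?s))"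
    using encoded_rank_eq[OF ok] same by (simp add: k_def)
  have kn: "k \<le> ?n" unfolding k by (rule vec_space.rank_le_nc[OF rat_mat_carrier])
  have "input_ok (dom_of ?s) (order_of ?s) (input_of ?s)" using ok by (simp add: ok_def)
  from input_order[OF this] have order: "input_order (input_of ?s) = order_of s" using same by simp
  have ar: "arith s" by (rule ready_arith[OF r])
  \<comment> \<open>Index \<open>i\<close> stands for the number i + 1. The largest index below some
    rank modulo a prime is therefore the element for the maximum of these ranks.\<close>
  have "is_answer \<delta> s i \<longleftrightarrow> i + 1 = k" if i: "i < ?n" for i
  proof (cases "?n = 1")
    case True
    then show ?thesis
      using singleton_answer_iff[OF r \<delta> True] rank_singleton[of "int_matrix ?s"] i k
      by (auto simp: is_answer_def)
  next
    case False
    then have n: "2 \<le> size_of ?s" using size_pos[OF ar] same by simp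
    note b = encoded_rank_bounds[OF ok n, unfolded same(1,3,4), folded k_def]
    have "(\<exists>p<range_of s. prime p \<and> j < rank3 \<delta> s p) \<longleftrightarrow> j < k" for j
      using b by (meson less_le_trans)
    moreover have "?n \<le> range_of s"
      unfolding range_of_def width_def using size_pos[OF ar] by (intro self_le_power) auto
    moreover have "(i < k \<and> (\<forall>r'<range_of s. i < r' \<longrightarrow> \<not> r' < k)) \<longleftrightarrow> i + 1 = k" if "?n \<le> range_of s"
    proof
      assume a: "i < k \<and> (\<forall>r'<range_of s. i < r' \<longrightarrow> \<not> r' < k)"
      then show "i + 1 = k" using kn that by (metis Suc_eq_plus1 Suc_lessI less_le_trans lessI)
    qed auto
    ultimately show ?thesis unfolding is_answer_def using False by simp
  qed
  then have "new_aux \<delta> s (Aux 3) = {[el s i] | i. i < ?n \<and> i + 1 = k}" by auto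
  also have "\<dots> = (if 0 < k then {[el s (k - 1)]} else {})" using kn by auto
  also have "\<dots> = rank_query (dom_of s) (input_of ?s)"
    using order by (auto simp: rank_query_def k_def[symmetric] el_def)
  finally show ?thesis using same by simp
qed

definition initial_state :: "'a set \<Rightarrow> ('a \<times> 'a) set \<Rightarrow> 'a state" where
  "initial_state D L = \<lparr>dom_of = D, order_of = L, input_of = matrix_initial D L, aux_of = initial_aux D L,
     changed_of = [], basis_of = (\<lambda>_. unit_entries), image_of = (\<lambda>_. null_entries), rank_of = (\<lambda>_. 0)\<rparr>"

lemma mod_ok_initial:
  assumes "prime p"
  shows "mod_ok n (\<lambda>_ _. 0) p unit_entries null_entries 0"
proof -
  have p: "1 < p" using assms prime_gt_1_nat by blast
  have "generating n p unit_entries"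
    unfolding generating_def
  proof
    fix y :: "nat \<Rightarrow> int"
    have "(\<Sum>j<n. int (unit_entries i j) * y j) = y i" if "i < n" for i
      using that by (simp add: unit_entries_def of_bool_def if_distrib[of int] if_distrib[of "\<lambda>x. x * _"] cong: if_cong)
    then show "\<exists>x. \<forall>i<n. [(\<Sum>j<n. int (unit_entries i j) * x j) = y i] (mod int p)"
      by (intro exI[of _ y]) simp
  qed
  then show ?thesis
    using p by (auto simp: mod_ok_def reduced_def image_rel_def pivoted_def nonzero_cols_def unit_entries_def null_entries_def)
qed

text \<open>The stored families equal the reference families and all ranks are 0, so the three
  relations are empty, as the initial auxiliary relations are.\<close>

lemma ok_initial:
  assumes "finite D" "D \<noteq> {}" "strict_order_of D L"
  shows "ok (initial_state D L)"
proof -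
  let ?s = "initial_state D L"
  have zero: "int_matrix ?s = (\<lambda>_ _. 0)"
    by (intro ext) (simp add: int_matrix_def initial_state_def entry_def)
  have "rel ?s 4 (stored (size_of ?s) unit_entries (basis_of ?s)) = {}"
    "rel ?s 4 (stored (size_of ?s) null_entries (image_of ?s)) = {}"
    "rel ?s 2 (below_rank (rank_of ?s)) = {}"
    by (auto simp: rel_def stored_def below_rank_def initial_state_def)
  then show ?thesis
    unfolding ok_def zero using assms mod_ok_initial
    by (auto simp: initial_state_def input_ok_def)
qed

lemma rank_query_initial:
  assumes "finite D" "strict_order_of D L"
  shows "rank_query D (matrix_initial D L) = {}"
proof -
  have "encoded_matrix D (matrix_initial D L) = 0\<^sub>m (card D) (card D)"
    by (rule eq_matI) (simp_all add: encoded_matrix_def entry_def)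
  then have "encoded_rank D (matrix_initial D L) = 0"
    by (simp add: encoded_rank_def vec_space.rank_0I)
  then show ?thesis by (simp add: rank_query_def)
qed

theorem theorem2:
  shows "(MatrixRank :: (matrix_sym, 'a) dyn_problem) \<in> DynFO_arith"
proof -
  let ?Q = "MatrixRank :: (matrix_sym, 'a) dyn_problem"
  have "\<exists>\<phi>. change.updates TYPE('a) \<delta> S \<phi>" if "changed_sym \<delta> \<noteq> Less" "S \<in> aux_syms rank_program" for \<delta> S
  proof -
    interpret change \<delta> "TYPE('a)" by unfold_locales (rule that(1))
    show ?thesis by (rule exists_updates[OF that(2)])
  qed
  then obtain u where u: "\<And>\<delta> S. changed_sym \<delta> \<noteq> Less \<Longrightarrow> S \<in> aux_syms rank_program \<Longrightarrow> change.updates TYPE('a) \<delta> S (u \<delta> S)"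
    by metis
  \<comment> \<open>Only the placeholder for the formulas is replaced, so symbols and arities agree
    with those for which the formulas were built.\<close>
  define P where "P = rank_program\<lparr>update := u\<rparr>"
  have syms: "aux_syms P = aux_syms rank_program" by (simp add: aux_syms_def P_def)
  have arity: "aux_arity P = aux_arity rank_program"
  proof
    show "aux_arity P S = aux_arity rank_program S" for S by (cases S) (simp_all add: P_def)
  qed
  have upd: "free_vars (update P \<delta> S) \<subseteq> {..<3 + aux_arity P S} \<and>
      over_vocab (UNIV <+> aux_syms P) (case_sum matrix_arity (aux_arity P)) (update P \<delta> S) \<and>
      (\<forall>(s :: 'a state) b. ready \<delta> s \<longrightarrow> b \<in> tuples (dom_of s) (aux_arity P S) \<longrightarrow>
         sat (dom_of s) (case_sum (input_of s) (aux_of s)) (\<lambda>i. (changed_of s @ b) ! i) (update P \<delta> S) =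
           (b \<in> new_aux \<delta> s S))"
    if \<delta>: "changed_sym \<delta> \<noteq> Less" and S: "S \<in> aux_syms P" for \<delta> S
  proof -
    interpret change \<delta> "TYPE('a)" by unfold_locales (rule \<delta>)
    have "updates S (update P \<delta> S)" using u[OF \<delta>, of S] S unfolding syms by (simp add: P_def)
    then show ?thesis unfolding updates_def syms arity .
  qed
  have three: "matrix_arity R = 3" if "R \<noteq> Less" for R using that by (cases R) auto
  have "wf_program ?Q P"
  proof -
    have "answer P \<in> aux_syms P" "aux_arity P (answer P) = 1"
      by (auto simp: P_def rank_program_def aux_syms_def)
    moreover have "changed_sym \<delta> \<in> {MPlus, MMinus} \<Longrightarrow> changed_sym \<delta> \<noteq> Less" for \<delta> by auto
    ultimately show ?thesis
      unfolding wf_program_def using upd three by (simp add: MatrixRank_def)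
  qed
  moreover have "maintains P ?Q"
    unfolding maintains_def
  proof (intro allI impI)
    fix D L and I :: "(matrix_sym, 'a) interp" and A
    assume fin: "finite D" and ord: "strict_order_of D L" and reach: "reachable ?Q P D L I A"
    \<comment> \<open>The answer is established by each change; before the first one it is empty,
      which is correct for the zero matrix. The invariant presupposes a nonempty domain, whereas the
      claim covers the empty one too.\<close>
    have "(I = matrix_initial D L \<and> A = initial_aux D L \<or> A (Aux 3) = rank_query D I) \<and>
       (D \<noteq> {} \<longrightarrow> (\<exists>s. ok s \<and> dom_of s = D \<and> order_of s = L \<and> input_of s = I \<and> aux_of s = A))"
      using reach
    proof induction
      case start
      have "\<exists>s. ok s \<and> dom_of s = D \<and> order_of s = L \<and> input_of s = matrix_initial D L \<and> aux_of s = initial_aux D L"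
        if "D \<noteq> {}"
        by (rule exI[of _ "initial_state D L"]) (use ok_initial[OF fin that ord] in \<open>simp add: initial_state_def\<close>)
      then show ?case by (simp add: MatrixRank_def)
    next
      case (change I A \<delta> a)
      have \<delta>: "changed_sym \<delta> \<noteq> Less" using change.hyps(2) by (auto simp: MatrixRank_def)
      have a: "a \<in> tuples D 3" using change.hyps(3) three[OF \<delta>] by (simp add: MatrixRank_def)
      \<comment> \<open>A triple of elements exists, so an empty domain admits no change at
        all.\<close>
      then have "D \<noteq> {}" by (auto simp: tuples_def)
      with change.IH obtain s0 where s0: "ok s0" "dom_of s0 = D" "order_of s0 = L" "input_of s0 = I" "aux_of s0 = A"
        by blast
      \<comment> \<open>The incoming tuple is recorded in the state, where the update formulas look
        it up.\<close>
      define s where "s = s0\<lparr>changed_of := a\<rparr>"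
      have s: "dom_of s = D" "order_of s = L" "input_of s = I" "aux_of s = A" "changed_of s = a"
        using s0 by (simp_all add: s_def)
      have "ok s"
      proof -
        have "rel s = rel s0" "int_matrix s = int_matrix s0"
          by (intro ext; simp add: s_def rel_def num_def[abs_def] idx_def int_matrix_def el_def)+
        moreover have "range_of s = range_of s0" by (simp add: s_def range_of_def)
        ultimately have "rel s = rel s0" "int_matrix s = int_matrix s0" "range_of s = range_of s0" .
        then show ?thesis using s0(1) by (simp add: ok_def s_def)
      qed
      then have r: "ready \<delta> s" using a change.hyps(4) by (simp add: ready_def s MatrixRank_def)
      have A': "update_aux P D \<delta> a I A = aux_of (next_state \<delta> s)"
      proof
        fix S
        show "update_aux P D \<delta> a I A S = aux_of (next_state \<delta> s) S"
        proof (cases "S \<in> aux_syms P")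
          case True
          have "b \<in> tuples D (aux_arity P S)" if "b \<in> new_aux \<delta> s S" for b
          proof -
            have ar: "arith s" by (rule ready_arith[OF r])
            show ?thesis
              using that True ar el_in[OF ar] s
              by (cases S) (auto simp: arith_def rel_def aux_syms_def P_def rank_program_def tuples_def
                  less_Suc_eq numeral_eq_Suc strict_order_of_def split: if_splits)
          qed
          then have "update_aux P D \<delta> a I A S = new_aux \<delta> s S"
            using upd[OF \<delta> True] r s True by (auto simp: update_aux_def)
          then show ?thesis using True by (simp add: next_state_def syms)
        qed (simp add: update_aux_def next_state_def syms)
      qed
      have "ok (next_state \<delta> s)" by (rule ok_next_state[OF r \<delta>])
      moreover have "aux_of (next_state \<delta> s) (Aux 3) = rank_query D (apply_change \<delta> a I)"
        using new_answer[OF r \<delta>] by (simp add: next_state_def aux_syms_def rank_program_def s)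
      ultimately show ?case unfolding A'
        by (intro conjI impI disjI2 exI[of _ "next_state \<delta> s"]) (simp_all add: next_state_def s)
    qed
    then have "A (Aux 3) = rank_query D I"
      using rank_query_initial[OF fin ord] by auto
    then show "A (answer P) = query ?Q D I"
      by (simp add: P_def rank_program_def MatrixRank_def)
  qed
  ultimately show ?thesis unfolding DynFO_arith_def by blast
qed

end
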